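(* Let $\Sigma$ be a compact orientable surface with a reference Riemannian metric $g_0$ whose scalar curvature $R_0$ is continuous. Let $g_1=e^{af}g_0$ be the random metric described in the context, with scalar curvature $R_1$, and let $h=\Delta_0 f$, $w=\Delta_0 f+R_0f$, $\sigma_w^2=\sup_{x\in\Sigma}\mathbb{E}[w(x)^2]$. Assume that the random metric is chosen so that the random fields $f,h,w$ are a.s. $C^0$. Let $a\to0^+$ and $u\to0^+$ so that $\frac{u}{a}\to\infty$. Then $$\log\mathrm{Prob}\{\|R_1-R_0\|_\infty>u\}\sim-\frac{u^2}{2a^2\sigma_w^2}.$$
   Context: $\|\cdot\|_\infty$ is the sup norm on $\Sigma$. $\Delta_0$ is the (negative definite) Laplacian of $g_0$; $\{\phi_j\}_{j\ge 0}$ is an orthonormal basis of $L^2(\Sigma,g_0)$ of real eigenfunctions, $-\Delta_0\phi_j=\lambda_j\phi_j$, $0=\lambda_0<\lambda_1\le\lambda_2\le\dots$. The random conformal factor is $f(x)=-\sum_{j\ge1}a_jc_j\phi_j(x)$, where $a_j$ are i.i.d. standard Gaussians and $c_j=F(\lambda_j)>0$ with $F(t)$ eventually monotone decreasing, $F(t)\to0$ as $t\to\infty$. The scalar curvature of $g_1=e^{af}g_0$ is $R_1=e^{-af}[R_0-a\Delta_0f]$. No assumption is made that $R_0$ is constant or has constant sign. *)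

theory Defs
  imports "HOL-Probability.Probability" "HOL-Library.Landau_Symbols"
begin

definition partial :: "2 \<Rightarrow> (real^2 \<Rightarrow> real) \<Rightarrow> real^2 \<Rightarrow> real" where
  "partial i u x = frechet_derivative u (at x) (axis i 1)"

text \<open>Functions of class \<open>C\<^sup>k\<close>; only used on open subsets of the plane.\<close>

primrec Ck_on :: "nat \<Rightarrow> (real^2) set \<Rightarrow> (real^2 \<Rightarrow> real) \<Rightarrow> bool" where
  "Ck_on 0 S u \<longleftrightarrow> continuous_on S u"
| "Ck_on (Suc k) S u \<longleftrightarrow> u differentiable_on S \<and> (\<forall>i. Ck_on k S (partial i u))"

type_synonym 's chart = "'s set \<times> ('s \<Rightarrow> real^2)"

abbreviation chart_dom :: "'s chart \<Rightarrow> 's set" where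
  "chart_dom c \<equiv> fst c"

abbreviation coord :: "'s chart \<Rightarrow> 's \<Rightarrow> real^2" where
  "coord c \<equiv> snd c"

definition chart_inv :: "'s chart \<Rightarrow> real^2 \<Rightarrow> 's" where
  "chart_inv c = inv_into (chart_dom c) (coord c)"

definition is_chart :: "'s::topological_space chart \<Rightarrow> bool" where
  "is_chart c \<longleftrightarrow> open (chart_dom c) \<and> open (coord c ` chart_dom c) \<and>
     homeomorphism (chart_dom c) (coord c ` chart_dom c) (coord c) (chart_inv c)"

definition transition :: "'s chart \<Rightarrow> 's chart \<Rightarrow> real^2 \<Rightarrow> real^2" where
  "transition c d = coord d \<circ> chart_inv c"

definition overlap :: "'s chart \<Rightarrow> 's chart \<Rightarrow> (real^2) set" where
  "overlap c d = coord c ` (chart_dom c \<inter> chart_dom d)"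

definition jacobian :: "(real^2 \<Rightarrow> real^2) \<Rightarrow> real^2 \<Rightarrow> real^2^2" where
  "jacobian T x = matrix (frechet_derivative T (at x))"

definition smooth_atlas :: "'s::topological_space chart set \<Rightarrow> bool" where
  "smooth_atlas \<A> \<longleftrightarrow>
     (\<forall>c\<in>\<A>. is_chart c) \<and> (\<Union>c\<in>\<A>. chart_dom c) = UNIV \<and>
     (\<forall>c\<in>\<A>. \<forall>d\<in>\<A>. \<forall>i k. Ck_on k (overlap c d) (\<lambda>x. transition c d x $ i))"

text \<open>A compatible atlas need not be contained in the given one, hence the second
  atlas \<open>\<B>\<close>.\<close>

definition orientable :: "'s::topological_space chart set \<Rightarrow> bool" where
  "orientable \<A> \<longleftrightarrow>
     (\<exists>\<B>. smooth_atlas \<B> \<and> smooth_atlas (\<A> \<union> \<B>) \<and>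
        (\<forall>c\<in>\<B>. \<forall>d\<in>\<B>. \<forall>x\<in>overlap c d. det (jacobian (transition c d) x) > 0))"

text \<open>The points of the surface are the elements of a Hausdorff type. Second countability
  follows from compactness. Connectedness is not part of the definition; it is forced by
  the simplicity of the eigenvalue \<open>0\<close>.\<close>

definition compact_orientable_surface :: "'s::t2_space chart set \<Rightarrow> bool" where
  "compact_orientable_surface \<A> \<longleftrightarrow>
     compact (UNIV :: 's set) \<and> smooth_atlas \<A> \<and> orientable \<A>"

definition Ck_surface :: "nat \<Rightarrow> 's chart set \<Rightarrow> ('s \<Rightarrow> real) \<Rightarrow> bool" where
  "Ck_surface k \<A> u \<longleftrightarrow> (\<forall>c\<in>\<A>. Ck_on k (coord c ` chart_dom c) (u \<circ> chart_inv c))"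

text \<open>A metric is given by its coefficient matrix \<open>g c x\<close> in each chart \<open>c\<close>, at the point with
  coordinates \<open>x\<close>. Class \<open>C\<^sup>2\<close> is what the coordinate formula for the curvature needs.\<close>

type_synonym 's metric_coeffs = "'s chart \<Rightarrow> real^2 \<Rightarrow> real^2^2"

definition riemannian_metric :: "'s chart set \<Rightarrow> 's metric_coeffs \<Rightarrow> bool" where
  "riemannian_metric \<A> g \<longleftrightarrow>
     (\<forall>c\<in>\<A>. \<forall>i j. Ck_on 2 (coord c ` chart_dom c) (\<lambda>x. g c x $ i $ j)) \<and>
     (\<forall>c\<in>\<A>. \<forall>x\<in>coord c ` chart_dom c.
        transpose (g c x) = g c x \<and> (\<forall>v. v \<noteq> 0 \<longrightarrow> v \<bullet> (g c x *v v) > 0)) \<and>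
     (\<forall>c\<in>\<A>. \<forall>d\<in>\<A>. \<forall>x\<in>overlap c d.
        g c x = transpose (jacobian (transition c d) x) ** g d (transition c d x)
                  ** jacobian (transition c d) x)"

text \<open>The quantities below do not depend on the chart in which they are computed.\<close>

definition chart_at :: "'s chart set \<Rightarrow> 's \<Rightarrow> 's chart" where
  "chart_at \<A> p = (SOME c. c \<in> \<A> \<and> p \<in> chart_dom c)"

definition coord_laplacian :: "(real^2 \<Rightarrow> real^2^2) \<Rightarrow> (real^2 \<Rightarrow> real) \<Rightarrow> real^2 \<Rightarrow> real" where
  "coord_laplacian G u x =
     (\<Sum>i\<in>UNIV. partial i (\<lambda>y. sqrt (det (G y)) *
        (\<Sum>j\<in>UNIV. matrix_inv (G y) $ i $ j * partial j u y)) x) / sqrt (det (G x))"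

definition laplacian :: "'s chart set \<Rightarrow> 's metric_coeffs \<Rightarrow> ('s \<Rightarrow> real) \<Rightarrow> 's \<Rightarrow> real" where
  "laplacian \<A> g u p =
     (let c = chart_at \<A> p in coord_laplacian (g c) (u \<circ> chart_inv c) (coord c p))"

definition christoffel :: "(real^2 \<Rightarrow> real^2^2) \<Rightarrow> 2 \<Rightarrow> 2 \<Rightarrow> 2 \<Rightarrow> real^2 \<Rightarrow> real" where
  "christoffel G k i j x =
     (\<Sum>l\<in>UNIV. matrix_inv (G x) $ k $ l *
        (partial i (\<lambda>y. G y $ j $ l) x + partial j (\<lambda>y. G y $ i $ l) x
          - partial l (\<lambda>y. G y $ i $ j) x)) / 2"

definition coord_ricci :: "(real^2 \<Rightarrow> real^2^2) \<Rightarrow> 2 \<Rightarrow> 2 \<Rightarrow> real^2 \<Rightarrow> real" where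
  "coord_ricci G i j x =
     (\<Sum>k\<in>UNIV. partial k (christoffel G k i j) x - partial j (christoffel G k i k) x
        + (\<Sum>l\<in>UNIV. christoffel G k k l x * christoffel G l i j x
                     - christoffel G k j l x * christoffel G l i k x))"

definition coord_scalar_curvature :: "(real^2 \<Rightarrow> real^2^2) \<Rightarrow> real^2 \<Rightarrow> real" where
  "coord_scalar_curvature G x =
     (\<Sum>i\<in>UNIV. \<Sum>j\<in>UNIV. matrix_inv (G x) $ i $ j * coord_ricci G i j x)"

definition scalar_curvature :: "'s chart set \<Rightarrow> 's metric_coeffs \<Rightarrow> 's \<Rightarrow> real" where
  "scalar_curvature \<A> g p =
     (let c = chart_at \<A> p in coord_scalar_curvature (g c) (coord c p))"

text \<open>These conditions determine the Riemannian area measure uniquely.\<close>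

definition riemannian_area ::
    "'s::topological_space chart set \<Rightarrow> 's metric_coeffs \<Rightarrow> 's measure \<Rightarrow> bool" where
  "riemannian_area \<A> g \<mu> \<longleftrightarrow>
     sets \<mu> = sets borel \<and>
     (\<forall>c\<in>\<A>. \<forall>B\<in>sets borel. B \<subseteq> chart_dom c \<longrightarrow>
        emeasure \<mu> B = (\<integral>\<^sup>+x\<in>coord c ` B. ennreal (sqrt (det (g c x))) \<partial>lborel))"

text \<open>\<open>h = \<Delta>u\<close> in the sense of distributions. This is the meaning of \<open>\<Delta>\<^sub>0 f\<close> when \<open>f\<close> and
  \<open>\<Delta>\<^sub>0 f\<close> are merely continuous; such an \<open>f\<close> need not be of class \<open>C\<^sup>2\<close>.\<close>

definition is_laplacian_of ::
    "'s chart set \<Rightarrow> 's metric_coeffs \<Rightarrow> 's measure \<Rightarrow> ('s \<Rightarrow> real) \<Rightarrow> ('s \<Rightarrow> real) \<Rightarrow> bool" where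
  "is_laplacian_of \<A> g \<mu> u h \<longleftrightarrow>
     integrable \<mu> u \<and> integrable \<mu> h \<and>
     (\<forall>\<psi>. Ck_surface 2 \<A> \<psi> \<longrightarrow>
        (LINT x|\<mu>. h x * \<psi> x) = (LINT x|\<mu>. u x * laplacian \<A> g \<psi> x))"

text \<open>The scalar curvature of \<open>e\<^sup>v g\<^sub>0\<close> on a surface, where \<open>R0\<close> is the scalar curvature of
  \<open>g\<^sub>0\<close> and \<open>l = \<Delta>\<^sub>0 v\<close>, which need only exist in the sense of distributions.\<close>

definition conformal_scalar_curvature ::
    "('s \<Rightarrow> real) \<Rightarrow> ('s \<Rightarrow> real) \<Rightarrow> ('s \<Rightarrow> real) \<Rightarrow> 's \<Rightarrow> real" where
  "conformal_scalar_curvature R0 v l x = exp (- v x) * (R0 x - l x)"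

definition L2_function :: "'s measure \<Rightarrow> ('s \<Rightarrow> real) \<Rightarrow> bool" where
  "L2_function \<mu> u \<longleftrightarrow> u \<in> borel_measurable \<mu> \<and> integrable \<mu> (\<lambda>x. (u x)\<^sup>2)"

definition orthonormal_basis_L2 :: "'s measure \<Rightarrow> (nat \<Rightarrow> 's \<Rightarrow> real) \<Rightarrow> bool" where
  "orthonormal_basis_L2 \<mu> \<phi> \<longleftrightarrow>
     (\<forall>j. L2_function \<mu> (\<phi> j)) \<and>
     (\<forall>i j. (LINT x|\<mu>. \<phi> i x * \<phi> j x) = (if i = j then 1 else 0)) \<and>
     (\<forall>u. L2_function \<mu> u \<longrightarrow>
        (\<lambda>n. LINT x|\<mu>. (u x - (\<Sum>j<n. (LINT y|\<mu>. u y * \<phi> j y) * \<phi> j x))\<^sup>2)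
          \<longlonglongrightarrow> 0)"

definition laplace_eigenbasis ::
    "'s chart set \<Rightarrow> 's metric_coeffs \<Rightarrow> 's measure \<Rightarrow>
     (nat \<Rightarrow> 's \<Rightarrow> real) \<Rightarrow> (nat \<Rightarrow> real) \<Rightarrow> bool" where
  "laplace_eigenbasis \<A> g \<mu> \<phi> lam \<longleftrightarrow>
     orthonormal_basis_L2 \<mu> \<phi> \<and>
     (\<forall>j. Ck_surface 2 \<A> (\<phi> j) \<and> (\<forall>x. - laplacian \<A> g (\<phi> j) x = lam j * \<phi> j x)) \<and>
     lam 0 = 0 \<and> 0 < lam 1 \<and> (\<forall>j\<ge>1. lam j \<le> lam (Suc j))"

definition sup_norm :: "('s \<Rightarrow> real) \<Rightarrow> ereal" where
  "sup_norm u = (SUP x. ereal \<bar>u x\<bar>)"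

text \<open>The filter of pairs \<open>(a, u)\<close> with \<open>a \<rightarrow> 0+\<close>, \<open>u \<rightarrow> 0+\<close> and \<open>u / a \<rightarrow> \<infinity>\<close>.\<close>

definition small_au :: "(real \<times> real) filter" where
  "small_au = inf (at_right 0 \<times>\<^sub>F at_right 0) (filtercomap (\<lambda>(a, u). u / a) at_top)"

end

theory Submission
  imports Defs
begin

text \<open>
  To first order in \<open>a\<close>, \<open>R\<^sub>1 - R\<^sub>0 = - a w\<close>, with an error of order \<open>a\<^sup>2 (\<parallel>f\<parallel> + \<parallel>h\<parallel>)\<^sup>2\<close>. By Fernique's
  theorem \<open>\<parallel>f\<parallel>\<close> and \<open>\<parallel>h\<parallel>\<close> have Gaussian tails, so \<open>a (\<parallel>f\<parallel> + \<parallel>h\<parallel>)\<close> exceeds a small multiple of \<open>\<surd>u\<close> only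
  with probability \<open>exp (- const * u / a\<^sup>2)\<close>, which is negligible against \<open>exp (- u\<^sup>2 / (2 a\<^sup>2 \<sigma>\<^sub>w\<^sup>2))\<close> as
  \<open>u \<rightarrow> 0\<close>. What remains is the tail of \<open>\<parallel>w\<parallel>\<close> at level \<open>u / a \<rightarrow> \<infinity>\<close>: it is bounded below by the tail of
  \<open>w(x)\<close> at a point \<open>x\<close> of nearly maximal variance, and above by a union bound over a finite net, the
  oscillation around the net being controlled by Fernique's theorem again.

  All fields are almost sure limits of linear combinations of the Gaussian sequence. For \<open>f\<close> this is the
  assumption; for \<open>h\<close> it follows by pairing with the eigenfunctions and averaging over small open sets.

  That \<open>\<sigma>\<^sub>w > 0\<close> is also needed. If \<open>w = 0\<close>, pairing \<open>\<Delta>f = - R\<^sub>0 f\<close> with \<open>1\<close> and with the \<open>\<phi>\<^sub>j\<close> forces all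
  the positive eigenvalues, hence all the \<open>c\<^sub>j\<close>, to coincide; then \<open>f\<close> would be white noise.
\<close>

section \<open>The standard Gaussian measure on sequences\<close>

definition rot2 :: "real \<times> real \<Rightarrow> real \<times> real" where
  "rot2 = (\<lambda>(x, y). ((x + y) / sqrt 2, (x - y) / sqrt 2))"

lemma measurable_rot2 [measurable]: "rot2 \<in> borel \<Otimes>\<^sub>M borel \<rightarrow>\<^sub>M borel \<Otimes>\<^sub>M borel"
  unfolding rot2_def by measurable

lemma std_normal_density_rot2:
  "std_normal_density ((x + y) / sqrt 2) * std_normal_density ((x - y) / sqrt 2)
     = std_normal_density x * std_normal_density y"
proof -
  have "((x + y) / sqrt 2)\<^sup>2 + ((x - y) / sqrt 2)\<^sup>2 = x\<^sup>2 + y\<^sup>2"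
    by (simp add: power_divide power2_eq_square algebra_simps add_divide_distrib diff_divide_distrib)
  then have "- ((x + y) / sqrt 2)\<^sup>2 / 2 + - ((x - y) / sqrt 2)\<^sup>2 / 2 = - x\<^sup>2 / 2 + - y\<^sup>2 / 2"
    by linarith
  then have "exp (- ((x + y) / sqrt 2)\<^sup>2 / 2) * exp (- ((x - y) / sqrt 2)\<^sup>2 / 2)
      = exp (- x\<^sup>2 / 2) * exp (- y\<^sup>2 / 2)"
    by (simp only: exp_add[symmetric])
  then show ?thesis
    unfolding std_normal_density_def by (simp add: field_simps)
qed

lemma nn_integral_lborel_rot2:
  assumes [measurable]: "k \<in> borel_measurable (borel \<Otimes>\<^sub>M borel)"
  shows "(\<integral>\<^sup>+y. \<integral>\<^sup>+x. k ((x + y) / sqrt 2, (x - y) / sqrt 2) \<partial>lborel \<partial>lborel)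
       = (\<integral>\<^sup>+u. \<integral>\<^sup>+v. k (u, v) \<partial>lborel \<partial>lborel)"
proof -
  have s2: "x * (sqrt 2 * sqrt 2) = 2 * x" "sqrt 2 \<noteq> (0::real)" for x :: real by auto
  have "(\<integral>\<^sup>+y. \<integral>\<^sup>+x. k ((x + y) / sqrt 2, (x - y) / sqrt 2) \<partial>lborel \<partial>lborel)
      = (\<integral>\<^sup>+y. ennreal (sqrt 2) * \<integral>\<^sup>+u. k (u, u - sqrt 2 * y) \<partial>lborel \<partial>lborel)"
  proof (rule nn_integral_cong)
    fix y :: real
    have *: "(- y + sqrt 2 * u + y) / sqrt 2 = u" "(- y + sqrt 2 * u - y) / sqrt 2 = u - sqrt 2 * y" for u
      using s2(1)[of y] by (simp_all add: field_simps)
    show "(\<integral>\<^sup>+x. k ((x + y) / sqrt 2, (x - y) / sqrt 2) \<partial>lborel)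
        = ennreal (sqrt 2) * (\<integral>\<^sup>+u. k (u, u - sqrt 2 * y) \<partial>lborel)"
      by (subst nn_integral_real_affine[where t="-y" and c="sqrt 2"]) (simp_all only: * , auto)
  qed
  also have "\<dots> = ennreal (sqrt 2) * (\<integral>\<^sup>+y. \<integral>\<^sup>+u. k (u, u - sqrt 2 * y) \<partial>lborel \<partial>lborel)"
    by (rule nn_integral_cmult) simp
  also have "\<dots> = ennreal (sqrt 2) * (\<integral>\<^sup>+u. \<integral>\<^sup>+y. k (u, u - sqrt 2 * y) \<partial>lborel \<partial>lborel)"
    by (subst lborel_pair.Fubini') simp_all
  also have "\<dots> = (\<integral>\<^sup>+u. ennreal (sqrt 2) * \<integral>\<^sup>+y. k (u, u - sqrt 2 * y) \<partial>lborel \<partial>lborel)"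
    by (rule nn_integral_cmult[symmetric]) simp
  also have "\<dots> = (\<integral>\<^sup>+u. \<integral>\<^sup>+v. k (u, v) \<partial>lborel \<partial>lborel)"
  proof (rule nn_integral_cong)
    fix u :: real
    show "ennreal (sqrt 2) * (\<integral>\<^sup>+y. k (u, u - sqrt 2 * y) \<partial>lborel) = (\<integral>\<^sup>+v. k (u, v) \<partial>lborel)"
      by (subst (2) nn_integral_real_affine[where t=u and c="- sqrt 2"]) auto
  qed
  finally show ?thesis .
qed

interpretation std_normal: prob_space std_normal_distribution
  by (rule prob_space_normal_density) simp

lemma nn_integral_std_normal_pair:
  assumes [measurable]: "k \<in> borel_measurable (borel \<Otimes>\<^sub>M borel)"
  shows "(\<integral>\<^sup>+z. k z \<partial>(std_normal_distribution \<Otimes>\<^sub>M std_normal_distribution))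
    = (\<integral>\<^sup>+x. \<integral>\<^sup>+y. ennreal (std_normal_density x * std_normal_density y) * k (x, y) \<partial>lborel \<partial>lborel)"
proof -
  have [measurable_cong]: "sets std_normal_distribution = sets borel" by simp
  have "(\<integral>\<^sup>+z. k z \<partial>(std_normal_distribution \<Otimes>\<^sub>M std_normal_distribution))
      = (\<integral>\<^sup>+x. \<integral>\<^sup>+y. k (x, y) \<partial>std_normal_distribution \<partial>std_normal_distribution)"
    by (rule std_normal.nn_integral_fst[symmetric]) measurable
  also have "\<dots> = (\<integral>\<^sup>+x. std_normal_density x * (\<integral>\<^sup>+y. std_normal_density y * k (x, y) \<partial>lborel) \<partial>lborel)"
    by (simp add: nn_integral_density)
  also have "\<dots> = (\<integral>\<^sup>+x. \<integral>\<^sup>+y. ennreal (std_normal_density x * std_normal_density y) * k (x, y) \<partial>lborel \<partial>lborel)"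
    by (simp add: nn_integral_cmult[symmetric] ennreal_mult' mult.assoc)
  finally show ?thesis .
qed

lemma distr_rot2:
  "distr (std_normal_distribution \<Otimes>\<^sub>M std_normal_distribution)
     (std_normal_distribution \<Otimes>\<^sub>M std_normal_distribution) rot2
   = std_normal_distribution \<Otimes>\<^sub>M std_normal_distribution" (is "distr ?P ?P rot2 = ?P")
proof (rule measure_eqI)
  have [measurable_cong]: "sets ?P = sets (borel \<Otimes>\<^sub>M borel)"
    by (intro sets_pair_measure_cong) auto
  fix A assume "A \<in> sets (distr ?P ?P rot2)"
  then have [measurable]: "A \<in> sets (borel \<Otimes>\<^sub>M borel)"
    using \<open>sets ?P = sets (borel \<Otimes>\<^sub>M borel)\<close> by simp
  let ?k = "\<lambda>z. ennreal (std_normal_density (fst z) * std_normal_density (snd z)) * indicator A z"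
  have "emeasure (distr ?P ?P rot2) A = (\<integral>\<^sup>+z. indicator A z \<partial>distr ?P ?P rot2)"
    by simp
  also have "\<dots> = (\<integral>\<^sup>+z. indicator A (rot2 z) \<partial>?P)"
    by (rule nn_integral_distr) measurable
  also have "\<dots> = (\<integral>\<^sup>+x. \<integral>\<^sup>+y. ?k ((x + y) / sqrt 2, (x - y) / sqrt 2) \<partial>lborel \<partial>lborel)"
    by (subst nn_integral_std_normal_pair) (simp_all add: std_normal_density_rot2 rot2_def)
  also have "\<dots> = (\<integral>\<^sup>+y. \<integral>\<^sup>+x. ?k ((x + y) / sqrt 2, (x - y) / sqrt 2) \<partial>lborel \<partial>lborel)"
    by (rule lborel_pair.Fubini'[symmetric]) measurable
  also have "\<dots> = (\<integral>\<^sup>+u. \<integral>\<^sup>+v. ?k (u, v) \<partial>lborel \<partial>lborel)"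
    by (rule nn_integral_lborel_rot2) measurable
  also have "\<dots> = (\<integral>\<^sup>+z. indicator A z \<partial>?P)"
    by (subst nn_integral_std_normal_pair) simp_all
  also have "\<dots> = emeasure ?P A"
    by simp
  finally show "emeasure (distr ?P ?P rot2) A = emeasure ?P A" .
qed simp

definition gauss_seq :: "(nat \<Rightarrow> real) measure" where
  "gauss_seq = PiM UNIV (\<lambda>_. std_normal_distribution)"

lemma sets_gauss_seq [measurable_cong]: "sets gauss_seq = sets (PiM UNIV (\<lambda>_. borel))"
  unfolding gauss_seq_def by (intro sets_PiM_cong) auto

lemma space_gauss_seq [simp]: "space gauss_seq = UNIV"
  by (simp add: gauss_seq_def space_PiM)

interpretation gauss_seq: prob_space gauss_seq
  unfolding gauss_seq_def by (intro prob_space_PiM std_normal.prob_space_axioms)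

interpretation gauss_seq2: pair_prob_space gauss_seq gauss_seq ..

lemma measurable_gauss_seq_component [measurable]: "(\<lambda>x. x k) \<in> borel_measurable gauss_seq"
  by measurable

lemma distr_gauss_seq_component: "distr gauss_seq borel (\<lambda>x. x k) = std_normal_distribution"
  using distr_PiM_component[of UNIV "\<lambda>_. std_normal_distribution" k] std_normal.prob_space_axioms
  unfolding gauss_seq_def by (simp cong: distr_cong)

lemma distr_PiM_coordinatewise:
  fixes P :: "'i \<Rightarrow> 'a measure"
  assumes P: "\<And>i. prob_space (P i)"
    and T: "\<And>i. T i \<in> P i \<rightarrow>\<^sub>M P i" "\<And>i. distr (P i) (P i) (T i) = P i"
  shows "distr (PiM UNIV P) (PiM UNIV P) (\<lambda>x i. T i (x i)) = PiM UNIV P"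
proof -
  interpret product_prob_space P UNIV
    by (intro product_prob_spaceI P)
  note T(1)[measurable]
  have m: "(\<lambda>x i. T i (x i)) \<in> PiM UNIV P \<rightarrow>\<^sub>M PiM UNIV P"
    by (rule measurable_PiM_single') (auto simp: space_PiM PiE_def extensional_def dest: measurable_space[OF T(1)])
  show ?thesis
  proof (rule PiM_eq)
    fix J F assume J: "finite J" "J \<subseteq> (UNIV :: 'i set)" and F: "\<And>j. j \<in> J \<Longrightarrow> F j \<in> sets (P j)"
    have e: "(\<lambda>x i. T i (x i)) -` prod_emb UNIV P J (Pi\<^sub>E J F) \<inter> space (PiM UNIV P)
      = prod_emb UNIV P J (\<Pi>\<^sub>E j\<in>J. T j -` F j \<inter> space (P j))"
      using measurable_space[OF T(1)]
      by (auto simp: prod_emb_def space_PiM PiE_iff Pi_iff)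
    have "emeasure (distr (PiM UNIV P) (PiM UNIV P) (\<lambda>x i. T i (x i))) (prod_emb UNIV P J (Pi\<^sub>E J F))
      = (\<Prod>j\<in>J. emeasure (P j) (T j -` F j \<inter> space (P j)))"
      using J F m by (subst emeasure_distr) (auto simp: e intro!: emeasure_PiM_emb sets_PiM_I)
    also have "\<dots> = (\<Prod>j\<in>J. emeasure (distr (P j) (P j) (T j)) (F j))"
      using F T(1) by (intro prod.cong) (auto simp: emeasure_distr)
    finally show "emeasure (distr (PiM UNIV P) (PiM UNIV P) (\<lambda>x i. T i (x i))) (prod_emb UNIV P J (Pi\<^sub>E J F))
      = (\<Prod>j\<in>J. emeasure (P j) (F j))"
      by (simp add: T(2))
  qed simp
qed

lemma distr_pair_PiM:
  fixes P :: "'i \<Rightarrow> 'a measure" and Q :: "'i \<Rightarrow> 'b measure"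
  assumes P: "\<And>i. prob_space (P i)" and Q: "\<And>i. prob_space (Q i)"
  shows "distr (PiM UNIV P \<Otimes>\<^sub>M PiM UNIV Q) (PiM UNIV (\<lambda>i. P i \<Otimes>\<^sub>M Q i)) (\<lambda>(x, y) i. (x i, y i))
       = PiM UNIV (\<lambda>i. P i \<Otimes>\<^sub>M Q i)"
proof -
  interpret P: product_prob_space P UNIV by (intro product_prob_spaceI P)
  interpret Q: product_prob_space Q UNIV by (intro product_prob_spaceI Q)
  interpret PQ: product_prob_space "\<lambda>i. P i \<Otimes>\<^sub>M Q i" UNIV
    by (intro product_prob_spaceI prob_space_pair P Q)
  let ?D = "PiM UNIV P \<Otimes>\<^sub>M PiM UNIV Q" and ?\<psi> = "\<lambda>(x, y) i. (x i, y i)"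
  have m [measurable]: "?\<psi> \<in> ?D \<rightarrow>\<^sub>M PiM UNIV (\<lambda>i. P i \<Otimes>\<^sub>M Q i)"
    by (rule measurable_PiM_single')
       (auto simp: space_PiM PiE_def extensional_def space_pair_measure split_beta')
  show ?thesis
  proof (rule PQ.PiM_eq)
    fix J E assume J: "finite J" "J \<subseteq> (UNIV :: 'i set)" and E: "\<And>j. j \<in> J \<Longrightarrow> E j \<in> sets (P j \<Otimes>\<^sub>M Q j)"
    let ?C = "prod_emb UNIV (\<lambda>i. P i \<Otimes>\<^sub>M Q i) J (Pi\<^sub>E J E)"
    have C: "?C \<in> sets (PiM UNIV (\<lambda>i. P i \<Otimes>\<^sub>M Q i))"
      using J E by (intro sets_PiM_I) auto
    have sec: "Pair x -` E j \<in> sets (Q j)" if "j \<in> J" for j x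
      using E[OF that] by (rule sets_Pair1)
    have fin: "(\<lambda>x. emeasure (Q j) (Pair x -` E j)) \<in> borel_measurable (P j)" if "j \<in> J" for j
      using E[OF that] by (rule Q.M.measurable_emeasure_Pair)
    have "emeasure (distr ?D (PiM UNIV (\<lambda>i. P i \<Otimes>\<^sub>M Q i)) ?\<psi>) ?C = emeasure ?D (?\<psi> -` ?C \<inter> space ?D)"
      using C by (intro emeasure_distr m)
    also have "\<dots> = (\<integral>\<^sup>+x. emeasure (PiM UNIV Q) (Pair x -` (?\<psi> -` ?C \<inter> space ?D)) \<partial>PiM UNIV P)"
      using measurable_sets[OF m C] by (rule Q.P.emeasure_pair_measure_alt)
    also have "\<dots> = (\<integral>\<^sup>+x. (\<Prod>j\<in>J. emeasure (Q j) (Pair (x j) -` E j)) \<partial>PiM UNIV P)"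
    proof (rule nn_integral_cong)
      fix x assume x: "x \<in> space (PiM UNIV P)"
      have "Pair x -` (?\<psi> -` ?C \<inter> space ?D) = prod_emb UNIV Q J (\<Pi>\<^sub>E j\<in>J. Pair (x j) -` E j)"
        using x by (auto simp: prod_emb_def space_PiM space_pair_measure PiE_iff Pi_iff)
      then show "emeasure (PiM UNIV Q) (Pair x -` (?\<psi> -` ?C \<inter> space ?D))
          = (\<Prod>j\<in>J. emeasure (Q j) (Pair (x j) -` E j))"
        using J sec by (simp add: Q.emeasure_PiM_emb)
    qed
    also have "\<dots> = (\<integral>\<^sup>+x. (\<Prod>j\<in>J. emeasure (Q j) (Pair (x j) -` E j)) \<partial>PiM J P)"
      using J fin by (subst P.distr_PiM_restrict_finite[of J, symmetric])
        (auto simp: nn_integral_distr measurable_restrict_subset cong: nn_integral_cong intro!: nn_integral_distr[THEN trans] borel_measurable_prod)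
    also have "\<dots> = (\<Prod>j\<in>J. \<integral>\<^sup>+x. emeasure (Q j) (Pair x -` E j) \<partial>P j)"
      using J fin by (intro P.product_nn_integral_prod) auto
    also have "\<dots> = (\<Prod>j\<in>J. emeasure (P j \<Otimes>\<^sub>M Q j) (E j))"
      using E by (intro prod.cong) (auto simp: Q.M.emeasure_pair_measure_alt)
    finally show "emeasure (distr ?D (PiM UNIV (\<lambda>i. P i \<Otimes>\<^sub>M Q i)) ?\<psi>) ?C
        = (\<Prod>j\<in>J. emeasure (P j \<Otimes>\<^sub>M Q j) (E j))" .
  qed simp
qed

definition rot_seq :: "(nat \<Rightarrow> real) \<times> (nat \<Rightarrow> real) \<Rightarrow> (nat \<Rightarrow> real) \<times> (nat \<Rightarrow> real)" where
  "rot_seq = (\<lambda>(x, y). (\<lambda>j. (x j + y j) / sqrt 2, \<lambda>j. (x j - y j) / sqrt 2))"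

lemma measurable_rot_seq [measurable]:
  "rot_seq \<in> gauss_seq \<Otimes>\<^sub>M gauss_seq \<rightarrow>\<^sub>M gauss_seq \<Otimes>\<^sub>M gauss_seq"
proof -
  have "(\<lambda>z. \<lambda>j. (fst z j + snd z j) / sqrt 2) \<in> gauss_seq \<Otimes>\<^sub>M gauss_seq \<rightarrow>\<^sub>M PiM UNIV (\<lambda>_. borel)"
    "(\<lambda>z. \<lambda>j. (fst z j - snd z j) / sqrt 2) \<in> gauss_seq \<Otimes>\<^sub>M gauss_seq \<rightarrow>\<^sub>M PiM UNIV (\<lambda>_. borel)"
    by (rule measurable_PiM_single'; auto simp: space_PiM)+
  then show ?thesis
    unfolding rot_seq_def split_beta'
    by (intro measurable_Pair) (simp_all add: measurable_cong_sets[OF refl sets_gauss_seq])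
qed

lemma distr_rot_seq:
  "distr (gauss_seq \<Otimes>\<^sub>M gauss_seq) (gauss_seq \<Otimes>\<^sub>M gauss_seq) rot_seq = gauss_seq \<Otimes>\<^sub>M gauss_seq"
proof -
  define P where "P = (\<lambda>i::nat. std_normal_distribution \<Otimes>\<^sub>M std_normal_distribution)"
  let ?N = "gauss_seq \<Otimes>\<^sub>M gauss_seq"
  define zip where "zip = (\<lambda>(x, y) (i::nat). (x i, y i) :: real \<times> real)"
  define unzip where "unzip = (\<lambda>z :: nat \<Rightarrow> real \<times> real. (\<lambda>i. fst (z i), \<lambda>i. snd (z i)))"
  have sets_P: "sets (P i) = sets (borel \<Otimes>\<^sub>M borel)" for i
    unfolding P_def by (intro sets_pair_measure_cong) auto
  have zip: "zip \<in> ?N \<rightarrow>\<^sub>M PiM UNIV P" "distr ?N (PiM UNIV P) zip = PiM UNIV P"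
  proof -
    show "zip \<in> ?N \<rightarrow>\<^sub>M PiM UNIV P"
      unfolding zip_def split_beta'
      by (rule measurable_PiM_single')
         (auto simp: space_PiM measurable_cong_sets[OF refl sets_P] sets_eq_imp_space_eq[OF sets_P] space_pair_measure)
    show "distr ?N (PiM UNIV P) zip = PiM UNIV P"
      unfolding zip_def gauss_seq_def P_def
      by (rule distr_pair_PiM) (rule std_normal.prob_space_axioms)+
  qed
  have unzip: "unzip \<in> PiM UNIV P \<rightarrow>\<^sub>M ?N"
  proof -
    have c: "(\<lambda>z. z i) \<in> PiM UNIV P \<rightarrow>\<^sub>M borel \<Otimes>\<^sub>M borel" for i
      using measurable_component_singleton[of i UNIV P] by (simp add: measurable_cong_sets[OF refl sets_P])
    have "(\<lambda>z i. fst (z i)) \<in> PiM UNIV P \<rightarrow>\<^sub>M PiM UNIV (\<lambda>_. borel)"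
      "(\<lambda>z i. snd (z i)) \<in> PiM UNIV P \<rightarrow>\<^sub>M PiM UNIV (\<lambda>_. borel)"
      using c by (auto intro!: measurable_PiM_single' simp: space_PiM dest: measurable_fst'' measurable_snd'')
    then show ?thesis
      unfolding unzip_def by (intro measurable_Pair) (simp_all add: measurable_cong_sets[OF refl sets_gauss_seq])
  qed
  have rot: "rot2 \<in> P i \<rightarrow>\<^sub>M P i" "distr (P i) (P i) rot2 = P i" for i
    using distr_rot2 by (simp_all add: measurable_cong_sets[OF sets_P sets_P]) (simp add: P_def)
  have P: "prob_space (P i)" for i
    unfolding P_def by (intro prob_space_pair std_normal.prob_space_axioms)
  define rot where "rot = (\<lambda>(x :: nat \<Rightarrow> real \<times> real) i. rot2 (x i))"
  have rotP: "distr (PiM UNIV P) (PiM UNIV P) rot = PiM UNIV P"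
    unfolding rot_def by (rule distr_PiM_coordinatewise[OF P rot])
  have rotm: "rot \<in> PiM UNIV P \<rightarrow>\<^sub>M PiM UNIV P"
    unfolding rot_def using rot(1)
    by (intro measurable_PiM_single')
       (auto simp: space_PiM sets_eq_imp_space_eq[OF sets_P] space_pair_measure)
  have id: "distr (PiM UNIV P) ?N unzip = ?N"
  proof -
    have "distr (PiM UNIV P) ?N unzip = distr (distr ?N (PiM UNIV P) zip) ?N unzip"
      by (simp add: zip)
    also have "\<dots> = distr ?N ?N (unzip \<circ> zip)"
      by (rule distr_distr[OF unzip zip(1)])
    also have "unzip \<circ> zip = (\<lambda>x. x)"
      by (auto simp: zip_def unzip_def)
    finally show ?thesis by simp
  qed
  have "rot_seq = unzip \<circ> rot \<circ> zip"
    by (auto simp: rot_seq_def unzip_def rot_def zip_def rot2_def)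
  then have "distr ?N ?N rot_seq = distr (distr (distr ?N (PiM UNIV P) zip) (PiM UNIV P) rot) ?N unzip"
    using unzip rotm zip(1) by (simp add: distr_distr comp_assoc)
  then show ?thesis
    by (simp add: zip rotP id)
qed

definition flip :: "nat \<Rightarrow> (nat \<Rightarrow> real) \<Rightarrow> nat \<Rightarrow> real" where
  "flip k x = x(k := - x k)"

lemma measurable_flip [measurable]: "flip k \<in> gauss_seq \<rightarrow>\<^sub>M gauss_seq"
proof -
  have "flip k \<in> gauss_seq \<rightarrow>\<^sub>M PiM UNIV (\<lambda>_. borel)"
  proof (rule measurable_PiM_single')
    fix i
    show "(\<lambda>x. flip k x i) \<in> borel_measurable gauss_seq"
      by (cases "i = k") (simp_all add: flip_def)
  qed (auto simp: space_PiM)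
  then show ?thesis
    by (simp add: measurable_cong_sets[OF refl sets_gauss_seq])
qed

lemma distr_std_normal_uminus: "distr std_normal_distribution std_normal_distribution uminus = std_normal_distribution"
proof (rule measure_eqI)
  fix A assume "A \<in> sets (distr std_normal_distribution std_normal_distribution uminus)"
  then have [measurable]: "A \<in> sets borel" by simp
  have "emeasure (distr std_normal_distribution std_normal_distribution uminus) A
      = (\<integral>\<^sup>+x. indicator A x \<partial>distr std_normal_distribution std_normal_distribution uminus)"
    by simp
  also have "\<dots> = (\<integral>\<^sup>+x. indicator A (- x) \<partial>std_normal_distribution)"
    by (rule nn_integral_distr) auto
  also have "\<dots> = (\<integral>\<^sup>+x. ennreal (std_normal_density x) * indicator A (- x) \<partial>lborel)"
    by (simp add: nn_integral_density)
  also have "\<dots> = (\<integral>\<^sup>+x. ennreal (std_normal_density x) * indicator A x \<partial>lborel)"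
    by (subst (2) nn_integral_real_affine[where c="-1" and t=0]) (auto simp: normal_density_def)
  also have "\<dots> = emeasure std_normal_distribution A"
    by (simp add: emeasure_density)
  finally show "emeasure (distr std_normal_distribution std_normal_distribution uminus) A
      = emeasure std_normal_distribution A" .
qed simp

lemma distr_flip: "distr gauss_seq gauss_seq (flip k) = gauss_seq"
proof -
  have "flip k = (\<lambda>x i. (if i = k then uminus else (\<lambda>y. y)) (x i))"
    by (rule ext)+ (simp add: flip_def)
  then show ?thesis
    unfolding gauss_seq_def
    by (simp only:) (rule distr_PiM_coordinatewise,
      auto simp: std_normal.prob_space_axioms distr_std_normal_uminus distr_id2)
qed

lemma AE_measure_preserving:
  assumes "T \<in> M \<rightarrow>\<^sub>M N" "distr M N T = N" "AE x in N. P x"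
  shows "AE x in M. P (T x)"
  by (rule AE_distrD[OF assms(1)]) (simp only: assms)

lemma distr_gauss_seq2:
  "distr (gauss_seq \<Otimes>\<^sub>M gauss_seq) gauss_seq fst = gauss_seq"
  "distr (gauss_seq \<Otimes>\<^sub>M gauss_seq) gauss_seq snd = gauss_seq"
proof -
  show fst: "distr (gauss_seq \<Otimes>\<^sub>M gauss_seq) gauss_seq fst = gauss_seq"
    by (rule gauss_seq.distr_pair_fst)
  have "distr (gauss_seq \<Otimes>\<^sub>M gauss_seq) gauss_seq snd
      = distr (distr (gauss_seq \<Otimes>\<^sub>M gauss_seq) (gauss_seq \<Otimes>\<^sub>M gauss_seq) (\<lambda>(x, y). (y, x))) gauss_seq snd"
    using gauss_seq2.distr_pair_swap by simp
  also have "\<dots> = distr (gauss_seq \<Otimes>\<^sub>M gauss_seq) gauss_seq fst"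
    by (subst distr_distr) (auto simp: comp_def split_beta' intro!: distr_cong)
  finally show "distr (gauss_seq \<Otimes>\<^sub>M gauss_seq) gauss_seq snd = gauss_seq"
    by (simp add: fst)
qed

lemma AE_gauss_seq2:
  assumes "AE x in gauss_seq. P x"
  shows "AE z in gauss_seq \<Otimes>\<^sub>M gauss_seq. P (fst z) \<and> P (snd z) \<and> P (fst (rot_seq z)) \<and> P (snd (rot_seq z))"
proof -
  have 1: "AE z in gauss_seq \<Otimes>\<^sub>M gauss_seq. P (fst z) \<and> P (snd z)"
    using AE_measure_preserving[OF _ distr_gauss_seq2(1) assms]
      AE_measure_preserving[OF _ distr_gauss_seq2(2) assms] by simp
  from AE_measure_preserving[OF _ distr_rot_seq this] 1 show ?thesis by simp
qed

section \<open>Linear functionals of a Gaussian sequence\<close>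

text \<open>A measurable functional that is additive along the rotation by 45 degrees; the sequence
  \<open>b\<close> records its coefficients, recovered by reflecting one coordinate. Unlike being an
  \<open>L\<^sup>2\<close>-convergent series \<open>\<Sum>k. b k * x k\<close>, this is visibly closed under almost sure limits.\<close>

definition gauss_linear :: "((nat \<Rightarrow> real) \<Rightarrow> real) \<Rightarrow> (nat \<Rightarrow> real) \<Rightarrow> bool" where
  "gauss_linear G b \<longleftrightarrow> G \<in> borel_measurable gauss_seq \<and>
     (AE z in gauss_seq \<Otimes>\<^sub>M gauss_seq.
        G (fst (rot_seq z)) = (G (fst z) + G (snd z)) / sqrt 2 \<and>
        G (snd (rot_seq z)) = (G (fst z) - G (snd z)) / sqrt 2) \<and>
     (\<forall>k. AE x in gauss_seq. G (flip k x) = G x - 2 * b k * x k)"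

lemma gauss_linear_measurable: "gauss_linear G b \<Longrightarrow> G \<in> borel_measurable gauss_seq"
  by (simp add: gauss_linear_def)

lemma gauss_linear_component: "gauss_linear (\<lambda>x. x i) (\<lambda>k. if k = i then 1 else 0)"
  by (auto simp: gauss_linear_def rot_seq_def flip_def split_beta')

lemma gauss_linear_zero: "gauss_linear (\<lambda>_. 0) (\<lambda>_. 0)"
  by (auto simp: gauss_linear_def)

lemma gauss_linear_scale:
  assumes "gauss_linear G b"
  shows "gauss_linear (\<lambda>x. r * G x) (\<lambda>k. r * b k)"
  unfolding gauss_linear_def
proof (intro conjI allI)
  show "(\<lambda>x. r * G x) \<in> borel_measurable gauss_seq"
    using assms by (auto simp: gauss_linear_def)
  have "AE z in gauss_seq \<Otimes>\<^sub>M gauss_seq.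
        G (fst (rot_seq z)) = (G (fst z) + G (snd z)) / sqrt 2 \<and>
        G (snd (rot_seq z)) = (G (fst z) - G (snd z)) / sqrt 2"
    using assms by (auto simp: gauss_linear_def)
  then show "AE z in gauss_seq \<Otimes>\<^sub>M gauss_seq.
        r * G (fst (rot_seq z)) = (r * G (fst z) + r * G (snd z)) / sqrt 2 \<and>
        r * G (snd (rot_seq z)) = (r * G (fst z) - r * G (snd z)) / sqrt 2"
    by eventually_elim (auto simp: algebra_simps)
  fix k
  have "AE x in gauss_seq. G (flip k x) = G x - 2 * b k * x k"
    using assms by (auto simp: gauss_linear_def)
  then show "AE x in gauss_seq. r * G (flip k x) = r * G x - 2 * (r * b k) * x k"
    by eventually_elim (simp only:, simp add: algebra_simps)
qed

lemma gauss_linear_add: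
  assumes "gauss_linear G b" "gauss_linear G' b'"
  shows "gauss_linear (\<lambda>x. G x + G' x) (\<lambda>k. b k + b' k)"
  unfolding gauss_linear_def
proof (intro conjI allI)
  show "(\<lambda>x. G x + G' x) \<in> borel_measurable gauss_seq"
    using assms by (auto simp: gauss_linear_def)
  have "AE z in gauss_seq \<Otimes>\<^sub>M gauss_seq.
        G (fst (rot_seq z)) = (G (fst z) + G (snd z)) / sqrt 2 \<and>
        G (snd (rot_seq z)) = (G (fst z) - G (snd z)) / sqrt 2"
       "AE z in gauss_seq \<Otimes>\<^sub>M gauss_seq.
        G' (fst (rot_seq z)) = (G' (fst z) + G' (snd z)) / sqrt 2 \<and>
        G' (snd (rot_seq z)) = (G' (fst z) - G' (snd z)) / sqrt 2"
    using assms by (auto simp: gauss_linear_def)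
  then show "AE z in gauss_seq \<Otimes>\<^sub>M gauss_seq.
        G (fst (rot_seq z)) + G' (fst (rot_seq z)) = (G (fst z) + G' (fst z) + (G (snd z) + G' (snd z))) / sqrt 2 \<and>
        G (snd (rot_seq z)) + G' (snd (rot_seq z)) = (G (fst z) + G' (fst z) - (G (snd z) + G' (snd z))) / sqrt 2"
    by eventually_elim (auto simp: add_divide_distrib diff_divide_distrib)
  fix k
  have "AE x in gauss_seq. G (flip k x) = G x - 2 * b k * x k"
       "AE x in gauss_seq. G' (flip k x) = G' x - 2 * b' k * x k"
    using assms by (auto simp: gauss_linear_def)
  then show "AE x in gauss_seq. G (flip k x) + G' (flip k x) = G x + G' x - 2 * (b k + b' k) * x k"
    by eventually_elim (auto simp: algebra_simps)
qed

lemma AE_std_normal_nonzero: "AE x in gauss_seq. x k \<noteq> 0"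
proof -
  have "AE x in lborel. x \<noteq> (0::real)"
    by (rule AE_lborel_singleton)
  then have "AE x in std_normal_distribution. x \<noteq> (0::real)"
    by (subst AE_density) auto
  then have "AE x in distr gauss_seq borel (\<lambda>x. x k). x \<noteq> 0"
    unfolding distr_gauss_seq_component .
  then show ?thesis
    by (rule AE_distrD[rotated]) simp
qed

lemma gauss_linear_limit:
  assumes lin: "\<And>n. gauss_linear (G n) (b n)"
    and H: "H \<in> borel_measurable gauss_seq"
    and lim: "AE x in gauss_seq. (\<lambda>n. G n x) \<longlonglongrightarrow> H x"
  obtains d where "gauss_linear H d" "\<And>k. (\<lambda>n. b n k) \<longlonglongrightarrow> d k"
proof -
  have "\<exists>d. (\<lambda>n. b n k) \<longlonglongrightarrow> d \<and> (AE x in gauss_seq. H (flip k x) = H x - 2 * d * x k)" for k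
  proof -
    have "AE x in gauss_seq. G n (flip k x) = G n x - 2 * b n k * x k" for n
      using lin[of n] unfolding gauss_linear_def by blast
    then have "AE x in gauss_seq. \<forall>n. G n (flip k x) = G n x - 2 * b n k * x k"
      unfolding AE_all_countable by blast
    moreover have "AE x in gauss_seq. (\<lambda>n. G n (flip k x)) \<longlonglongrightarrow> H (flip k x)"
      using AE_measure_preserving[OF measurable_flip distr_flip lim] .
    ultimately have ae: "AE x in gauss_seq. x k \<noteq> 0 \<and> (\<lambda>n. b n k) \<longlonglongrightarrow> (H x - H (flip k x)) / (2 * x k)"
      using lim AE_std_normal_nonzero[of k]
    proof eventually_elim
      case (elim x)
      have "(\<lambda>n. (G n x - G n (flip k x)) / (2 * x k)) \<longlonglongrightarrow> (H x - H (flip k x)) / (2 * x k)"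
        using elim(2-4) by (intro tendsto_divide tendsto_diff tendsto_const) auto
      moreover have "(G n x - G n (flip k x)) / (2 * x k) = b n k" for n
        using elim(1)[rule_format, of n] elim(4) by simp
      ultimately show ?case using elim(4) by simp
    qed
    have "\<exists>x. x k \<noteq> 0 \<and> (\<lambda>n. b n k) \<longlonglongrightarrow> (H x - H (flip k x)) / (2 * x k)"
      using eventually_happens'[OF gauss_seq.ae_filter_bot ae] by blast
    then obtain d where d: "(\<lambda>n. b n k) \<longlonglongrightarrow> d" by blast
    have "AE x in gauss_seq. H (flip k x) = H x - 2 * d * x k"
      using ae
    proof eventually_elim
      case (elim x)
      then have nz: "x k \<noteq> 0" and "d = (H x - H (flip k x)) / (2 * x k)"
        using LIMSEQ_unique[OF d] by blast+
      from this(2) have "d * (2 * x k) = (H x - H (flip k x)) / (2 * x k) * (2 * x k)"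
        by (simp only:)
      also have "\<dots> = H x - H (flip k x)"
        using nz by simp
      finally show ?case by linarith
    qed
    with d show ?thesis by blast
  qed
  then have "\<exists>d. \<forall>k. (\<lambda>n. b n k) \<longlonglongrightarrow> d k \<and> (AE x in gauss_seq. H (flip k x) = H x - 2 * d k * x k)"
    by (intro choice allI)
  then obtain d where d: "\<And>k. (\<lambda>n. b n k) \<longlonglongrightarrow> d k"
    "\<And>k. AE x in gauss_seq. H (flip k x) = H x - 2 * d k * x k"
    by auto
  have "AE z in gauss_seq \<Otimes>\<^sub>M gauss_seq.
        G n (fst (rot_seq z)) = (G n (fst z) + G n (snd z)) / sqrt 2 \<and>
        G n (snd (rot_seq z)) = (G n (fst z) - G n (snd z)) / sqrt 2" for n
    using lin[of n] unfolding gauss_linear_def by blast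
  then have "AE z in gauss_seq \<Otimes>\<^sub>M gauss_seq. \<forall>n.
        G n (fst (rot_seq z)) = (G n (fst z) + G n (snd z)) / sqrt 2 \<and>
        G n (snd (rot_seq z)) = (G n (fst z) - G n (snd z)) / sqrt 2"
    unfolding AE_all_countable by blast
  with AE_gauss_seq2[OF lim]
  have rot: "AE z in gauss_seq \<Otimes>\<^sub>M gauss_seq.
        H (fst (rot_seq z)) = (H (fst z) + H (snd z)) / sqrt 2 \<and>
        H (snd (rot_seq z)) = (H (fst z) - H (snd z)) / sqrt 2"
  proof eventually_elim
    case (elim z)
    have 1: "(\<lambda>n. (G n (fst z) + G n (snd z)) / sqrt 2) \<longlonglongrightarrow> (H (fst z) + H (snd z)) / sqrt 2"
      using elim(1) by (intro tendsto_divide tendsto_add tendsto_const) auto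
    have 2: "(\<lambda>n. (G n (fst z) - G n (snd z)) / sqrt 2) \<longlonglongrightarrow> (H (fst z) - H (snd z)) / sqrt 2"
      using elim(1) by (intro tendsto_divide tendsto_diff tendsto_const) auto
    have 3: "(\<lambda>n. (G n (fst z) + G n (snd z)) / sqrt 2) \<longlonglongrightarrow> H (fst (rot_seq z))"
      "(\<lambda>n. (G n (fst z) - G n (snd z)) / sqrt 2) \<longlonglongrightarrow> H (snd (rot_seq z))"
      using elim by simp_all
    show ?case
      using LIMSEQ_unique[OF 3(1) 1] LIMSEQ_unique[OF 3(2) 2] by blast
  qed
  have "gauss_linear H d"
    unfolding gauss_linear_def by (intro conjI allI H rot d(2))
  with d(1) that show thesis by blast
qed

section \<open>Tails of suprema: Fernique's theorem\<close>

locale gauss_linear_family =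
  fixes Q :: "'q set" and G :: "'q \<Rightarrow> (nat \<Rightarrow> real) \<Rightarrow> real" and b :: "'q \<Rightarrow> nat \<Rightarrow> real"
  assumes countable_index: "countable Q"
    and gauss_linear: "q \<in> Q \<Longrightarrow> gauss_linear (G q) (b q)"
begin

definition exceed :: "real \<Rightarrow> (nat \<Rightarrow> real) set" where
  "exceed t = {x. \<exists>q\<in>Q. \<bar>G q x\<bar> > t}"

lemma sets_exceed [measurable]: "exceed t \<in> sets gauss_seq"
proof -
  have "{x \<in> space gauss_seq. \<bar>G q x\<bar> > t} \<in> sets gauss_seq" if "q \<in> Q" for q
    using gauss_linear_measurable[OF gauss_linear[OF that]] by measurable
  then have "(\<Union>q\<in>Q. {x \<in> space gauss_seq. \<bar>G q x\<bar> > t}) \<in> sets gauss_seq"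
    using countable_index by (intro sets.countable_UN') auto
  also have "(\<Union>q\<in>Q. {x \<in> space gauss_seq. \<bar>G q x\<bar> > t}) = exceed t"
    by (auto simp: exceed_def)
  finally show ?thesis .
qed

lemma exceed_rotation:
  "gauss_seq.prob (exceed t) * gauss_seq.prob (- exceed s) \<le> (gauss_seq.prob (exceed ((t - s) / sqrt 2)))\<^sup>2"
proof -
  let ?N = "gauss_seq \<Otimes>\<^sub>M gauss_seq" and ?r = "(t - s) / sqrt 2"
  have compl [measurable]: "- exceed s \<in> sets gauss_seq"
    using sets.compl_sets[OF sets_exceed[of s]] by (simp add: Compl_eq_Diff_UNIV)
  have "AE z in ?N. G q (fst (rot_seq z)) = (G q (fst z) + G q (snd z)) / sqrt 2 \<and>
        G q (snd (rot_seq z)) = (G q (fst z) - G q (snd z)) / sqrt 2" if "q \<in> Q" for q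
    using gauss_linear[OF that] unfolding gauss_linear_def by blast
  then have "AE z in ?N. \<forall>q\<in>Q. G q (fst (rot_seq z)) = (G q (fst z) + G q (snd z)) / sqrt 2 \<and>
        G q (snd (rot_seq z)) = (G q (fst z) - G q (snd z)) / sqrt 2"
    using countable_index by (subst AE_ball_countable) auto
  then have "AE z in ?N. z \<in> rot_seq -` (exceed t \<times> - exceed s) \<inter> space ?N
      \<longrightarrow> z \<in> exceed ?r \<times> exceed ?r"
  proof eventually_elim
    case (elim z)
    show ?case
    proof
      assume "z \<in> rot_seq -` (exceed t \<times> - exceed s) \<inter> space ?N"
      then have z: "fst (rot_seq z) \<in> exceed t" "snd (rot_seq z) \<notin> exceed s"
        by (auto simp: mem_Times_iff)
      then obtain q where q: "q \<in> Q" "\<bar>G q (fst (rot_seq z))\<bar> > t"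
        by (auto simp: exceed_def)
      have "\<bar>G q (snd (rot_seq z))\<bar> \<le> s"
        using z(2) q(1) by (auto simp: exceed_def not_less)
      moreover define u v where "u = G q (fst z)" and "v = G q (snd z)"
      ultimately have uv: "t < \<bar>u + v\<bar> / sqrt 2" "\<bar>u - v\<bar> / sqrt 2 \<le> s"
        using q elim by auto
      have "?r < \<bar>u\<bar> \<and> ?r < \<bar>v\<bar>"
      proof -
        have "t * sqrt 2 < \<bar>u + v\<bar>" "\<bar>u - v\<bar> \<le> s * sqrt 2"
          using uv by (simp_all add: field_simps)
        moreover have "\<bar>u + v\<bar> \<le> 2 * \<bar>u\<bar> + \<bar>u - v\<bar>" "\<bar>u + v\<bar> \<le> 2 * \<bar>v\<bar> + \<bar>u - v\<bar>"
          by linarith+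
        ultimately have "t * sqrt 2 - s * sqrt 2 < 2 * \<bar>u\<bar>" "t * sqrt 2 - s * sqrt 2 < 2 * \<bar>v\<bar>"
          by linarith+
        moreover have "t * sqrt 2 - s * sqrt 2 = 2 * ?r"
          by (simp add: field_simps)
        ultimately show ?thesis by linarith
      qed
      then have "fst z \<in> exceed ?r" "snd z \<in> exceed ?r"
        using q(1) by (auto simp: exceed_def u_def v_def)
      then show "z \<in> exceed ?r \<times> exceed ?r"
        by (simp add: mem_Times_iff)
    qed
  qed
  then have "measure ?N (rot_seq -` (exceed t \<times> - exceed s) \<inter> space ?N) \<le> measure ?N (exceed ?r \<times> exceed ?r)"
    by (intro gauss_seq2.P.finite_measure_mono_AE) auto
  moreover have "measure ?N (rot_seq -` (exceed t \<times> - exceed s) \<inter> space ?N) = measure ?N (exceed t \<times> - exceed s)"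
    by (subst measure_distr[symmetric, OF measurable_rot_seq]) (auto simp: distr_rot_seq)
  ultimately show ?thesis
    by (simp add: measure_def gauss_seq.emeasure_pair_measure_Times enn2real_mult power2_eq_square)
qed

definition fernique_level :: "real \<Rightarrow> nat \<Rightarrow> real" where
  "fernique_level s n = s * ((2 + sqrt 2) * sqrt 2 ^ n - (sqrt 2 + 1))"

text \<open>The levels solve \<open>t\<^sub>0 = s\<close>, \<open>(t\<^sub>n\<^sub>+\<^sub>1 - s) / \<surd>2 = t\<^sub>n\<close>, so that each application of the rotation
  squares the probability while the level grows only by the factor \<open>\<surd>2\<close>.\<close>
lemma prob_exceed_level:
  assumes "gauss_seq.prob (exceed s) \<le> 1 / 4"
  shows "gauss_seq.prob (exceed (fernique_level s n)) \<le> (1 / 3) ^ (2 ^ n) * gauss_seq.prob (- exceed s)"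
proof (induction n)
  case 0
  have "gauss_seq.prob (- exceed s) = 1 - gauss_seq.prob (exceed s)"
    using gauss_seq.prob_compl[OF sets_exceed[of s]] by (simp add: Compl_eq_Diff_UNIV)
  with assms show ?case
    by (simp add: fernique_level_def)
next
  case (Suc n)
  let ?\<beta> = "gauss_seq.prob (- exceed s)"
  have \<beta>: "?\<beta> > 0"
    using assms gauss_seq.prob_compl[OF sets_exceed[of s]] by (simp add: Compl_eq_Diff_UNIV)
  have lev: "(fernique_level s (Suc n) - s) / sqrt 2 = fernique_level s n"
    by (simp add: fernique_level_def field_simps)
  have "gauss_seq.prob (exceed (fernique_level s (Suc n))) * ?\<beta> \<le> (gauss_seq.prob (exceed (fernique_level s n)))\<^sup>2"
    using exceed_rotation[of "fernique_level s (Suc n)" s] by (simp add: lev)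
  also have "\<dots> \<le> ((1 / 3) ^ (2 ^ n) * ?\<beta>)\<^sup>2"
    using Suc.IH by (intro power_mono) auto
  also have "\<dots> = (1 / 3) ^ (2 ^ Suc n) * ?\<beta> * ?\<beta>"
    by (simp add: power2_eq_square power_mult[symmetric] power_add[symmetric] mult.commute mult_2)
  finally show ?case
    using \<beta> by (simp only: mult_le_cancel_right_pos)
qed

theorem fernique:
  assumes s: "s > 0" and small: "gauss_seq.prob (exceed s) \<le> 1 / 4" and t: "t \<ge> s"
  shows "gauss_seq.prob (exceed t) \<le> exp (- t\<^sup>2 / (24 * s\<^sup>2))"
proof -
  let ?l = "fernique_level s"
  obtain m where m: "t / s + (sqrt 2 + 1) < sqrt 2 ^ m"
    using real_arch_pow[of "sqrt 2"] by auto
  have "sqrt 2 ^ m \<le> (2 + sqrt 2) * sqrt 2 ^ m"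
    by simp
  with m have "t / s < (2 + sqrt 2) * sqrt 2 ^ m - (sqrt 2 + 1)"
    by linarith
  then have "?l m > t"
    using s by (simp add: fernique_level_def pos_divide_less_eq mult.commute)
  define n where "n = (LEAST n. ?l n > t)"
  have n1: "?l n > t"
    unfolding n_def using \<open>?l m > t\<close> by (rule LeastI)
  have n2: "?l k \<le> t" if "k < n" for k
    using not_less_Least[OF that[unfolded n_def]] by simp
  have "n \<noteq> 0"
    using n1 t by (intro notI) (simp add: fernique_level_def)
  then obtain k where k: "n = Suc k" by (cases n) auto
  have "?l n \<le> s * ((2 + sqrt 2) * sqrt 2 ^ n)"
    using s order_trans[of "-1" 0 "sqrt 2"] by (simp add: fernique_level_def)
  then have "t\<^sup>2 \<le> (s * ((2 + sqrt 2) * sqrt 2 ^ n))\<^sup>2"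
    using n1 s t by (intro power_mono) auto
  also have "\<dots> = s\<^sup>2 * (6 + 4 * sqrt 2) * 2 ^ n"
  proof -
    have "(sqrt 2 ^ n)\<^sup>2 = (2::real) ^ n"
      by (induction n) (simp_all add: power_mult_distrib)
    moreover have "(2 + sqrt 2)\<^sup>2 = 6 + 4 * sqrt (2::real)"
      by (simp add: power2_eq_square algebra_simps)
    ultimately show ?thesis
      by (simp add: power_mult_distrib)
  qed
  also have "\<dots> \<le> s\<^sup>2 * 12 * 2 ^ n"
  proof -
    have "sqrt 2 \<le> sqrt ((3/2)\<^sup>2)"
      by (intro real_sqrt_le_mono) (simp add: power2_eq_square)
    then have "6 + 4 * sqrt 2 \<le> (12::real)" by simp
    then show ?thesis
      by (intro mult_right_mono mult_left_mono) auto
  qed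
  finally have t2: "t\<^sup>2 / (24 * s\<^sup>2) \<le> 2 ^ k"
    using s by (simp add: k field_simps)
  have "exceed t \<subseteq> exceed (?l k)"
    using n2[of k] by (auto simp: exceed_def k intro: le_less_trans)
  then have "gauss_seq.prob (exceed t) \<le> gauss_seq.prob (exceed (?l k))"
    by (intro gauss_seq.finite_measure_mono) auto
  also have "\<dots> \<le> (1 / 3) ^ (2 ^ k) * gauss_seq.prob (- exceed s)"
    by (rule prob_exceed_level[OF small])
  also have "\<dots> \<le> (1 / 3) ^ (2 ^ k)"
    by (intro mult_left_le) auto
  also have "\<dots> \<le> exp (-1) ^ (2 ^ k)"
    using exp_le by (intro power_mono) (auto simp: exp_minus field_simps)
  also have "\<dots> = exp (- (2 ^ k))"
    by (simp add: exp_of_nat_mult[symmetric])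
  also have "\<dots> \<le> exp (- t\<^sup>2 / (24 * s\<^sup>2))"
    using t2 by simp
  finally show ?thesis .
qed

end

lemma (in prob_space) square_integrable_of_gaussian_tail:
  fixes X :: "'a \<Rightarrow> real"
  assumes [measurable]: "X \<in> borel_measurable M" and s: "s > 0" and c: "c > 0"
    and tail: "\<And>t. t \<ge> s \<Longrightarrow> prob {x \<in> space M. \<bar>X x\<bar> > t} \<le> exp (- c * t\<^sup>2)"
  shows "integrable M (\<lambda>x. (X x)\<^sup>2)"
proof -
  let ?T = "\<lambda>n::nat. {x \<in> space M. \<bar>X x\<bar> > real n}"
  have square_le: "ennreal ((X x)\<^sup>2) \<le> (\<Sum>n. ennreal (2 * real n + 1) * indicator (?T n) x)" if "x \<in> space M" for x
  proof -
    define m where "m = nat \<lceil>\<bar>X x\<bar>\<rceil>"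
    have m: "\<bar>X x\<bar> \<le> real m" "\<And>n. n < m \<Longrightarrow> real n < \<bar>X x\<bar>"
      unfolding m_def by linarith+
    have "(X x)\<^sup>2 \<le> (real m)\<^sup>2"
      using power_mono[OF m(1), of 2] by simp
    also have "(real m)\<^sup>2 = (\<Sum>n<m. 2 * real n + 1)"
      by (induction m) (auto simp: power2_eq_square algebra_simps)
    finally have "ennreal ((X x)\<^sup>2) \<le> ennreal (\<Sum>n<m. 2 * real n + 1)"
      by (rule ennreal_leI)
    also have "\<dots> = (\<Sum>n<m. ennreal (2 * real n + 1))"
      by (rule sum_ennreal[symmetric]) simp
    also have "\<dots> = (\<Sum>n<m. ennreal (2 * real n + 1) * indicator (?T n) x)"
      using m(2) that by (intro sum.cong refl) simp
    also have "\<dots> \<le> (\<Sum>n. ennreal (2 * real n + 1) * indicator (?T n) x)"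
      by (rule sum_le_suminf) auto
    finally show ?thesis .
  qed
  have summ: "summable (\<lambda>n. (2 * real n + 1) * prob (?T n))"
  proof (rule summable_comparison_test_ev)
    obtain N :: nat where N: "real N \<ge> s" using real_arch_simple by blast
    show "eventually (\<lambda>n. norm ((2 * real n + 1) * prob (?T n)) \<le> (6 / c\<^sup>2) * inverse (real n ^ 3)) sequentially"
      using eventually_ge_at_top[of "max 1 N"]
    proof eventually_elim
      case (elim n)
      then have n: "real n \<ge> s" "real n \<ge> 1" using N by linarith+
      define y where "y = c * (real n)\<^sup>2"
      have y: "y > 0" using n c by (simp add: y_def)
      have "y\<^sup>2 / 2 \<le> exp y"
        using exp_lower_Taylor_quadratic[of y] y by linarith
      then have "exp (- y) \<le> 2 / y\<^sup>2"
        using y by (simp add: exp_minus field_simps)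
      then have P: "prob (?T n) \<le> 2 / y\<^sup>2"
        using tail[OF n(1)] by (simp add: y_def)
      have "norm ((2 * real n + 1) * prob (?T n)) = (2 * real n + 1) * prob (?T n)"
        by simp
      also have "\<dots> \<le> (3 * real n) * (2 / y\<^sup>2)"
        using P n by (intro mult_mono) auto
      also have "\<dots> = (6 / c\<^sup>2) * inverse (real n ^ 3)"
        using n c by (simp add: y_def power_mult_distrib divide_simps) (simp add: power_numeral_reduce)
      finally show ?case .
    qed
    show "summable (\<lambda>n. (6 / c\<^sup>2) * inverse (real n ^ 3))"
      by (intro summable_mult inverse_power_summable) simp
  qed
  have "(\<integral>\<^sup>+x. ennreal ((X x)\<^sup>2) \<partial>M) \<le> (\<integral>\<^sup>+x. (\<Sum>n. ennreal (2 * real n + 1) * indicator (?T n) x) \<partial>M)"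
    by (rule nn_integral_mono) (rule square_le)
  also have "\<dots> = (\<Sum>n. \<integral>\<^sup>+x. ennreal (2 * real n + 1) * indicator (?T n) x \<partial>M)"
    by (rule nn_integral_suminf) measurable
  also have "(\<lambda>n. \<integral>\<^sup>+x. ennreal (2 * real n + 1) * indicator (?T n) x \<partial>M)
      = (\<lambda>n. ennreal ((2 * real n + 1) * prob (?T n)))"
  proof
    fix n
    have "(\<integral>\<^sup>+x. ennreal (2 * real n + 1) * indicator (?T n) x \<partial>M) = ennreal (2 * real n + 1) * emeasure M (?T n)"
      by (rule nn_integral_cmult_indicator) measurable
    then show "(\<integral>\<^sup>+x. ennreal (2 * real n + 1) * indicator (?T n) x \<partial>M) = ennreal ((2 * real n + 1) * prob (?T n))"
      by (simp only: emeasure_eq_measure, subst ennreal_mult) simp_all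
  qed
  also have "(\<Sum>n. ennreal ((2 * real n + 1) * prob (?T n))) = ennreal (\<Sum>n. (2 * real n + 1) * prob (?T n))"
    by (rule suminf_ennreal2[OF _ summ]) simp
  also have "\<dots> < \<infinity>"
    by simp
  finally have "(\<integral>\<^sup>+x. ennreal (norm ((X x)\<^sup>2)) \<partial>M) < \<infinity>"
    by simp
  then show ?thesis
    by (intro integrableI_bounded borel_measurable_power assms(1))
qed

lemma (in prob_space) prob_le_quarter_large:
  fixes X :: "'a \<Rightarrow> real"
  assumes [measurable]: "X \<in> borel_measurable M"
  obtains s where "s > 0" "prob {x \<in> space M. \<bar>X x\<bar> > s} \<le> 1 / 4"
proof -
  have [measurable]: "{x \<in> space M. \<bar>X x\<bar> > real n} \<in> events" for n
    by measurable
  have "(\<lambda>n. prob {x \<in> space M. \<bar>X x\<bar> > real n}) \<longlonglongrightarrow> prob (\<Inter>n. {x \<in> space M. \<bar>X x\<bar> > real n})"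
    by (rule finite_Lim_measure_decseq) (auto simp: decseq_def)
  moreover have "x \<notin> (\<Inter>n. {x \<in> space M. \<bar>X x\<bar> > real n})" for x
    using real_arch_simple[of "\<bar>X x\<bar>"] by (auto simp: not_less)
  then have "(\<Inter>n. {x \<in> space M. \<bar>X x\<bar> > real n}) = {}"
    by blast
  ultimately have "(\<lambda>n. prob {x \<in> space M. \<bar>X x\<bar> > real n}) \<longlonglongrightarrow> 0"
    by (simp only: measure_empty)
  then have "eventually (\<lambda>n. prob {x \<in> space M. \<bar>X x\<bar> > real n} < 1 / 4) sequentially"
    by (rule order_tendstoD) simp
  then have "eventually (\<lambda>n. prob {x \<in> space M. \<bar>X x\<bar> > real n} < 1 / 4 \<and> n \<ge> 1) sequentially"
    using eventually_ge_at_top[of 1] by eventually_elim simp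
  then obtain n where "prob {x \<in> space M. \<bar>X x\<bar> > real n} < 1 / 4" "n \<ge> 1"
    using eventually_happens' sequentially_bot by blast
  then show thesis by (intro that[of "real n"]) auto
qed

lemma gauss_linear_square_integrable:
  assumes G: "gauss_linear G b"
  shows "integrable gauss_seq (\<lambda>x. (G x)\<^sup>2)"
proof -
  interpret gauss_linear_family "UNIV :: unit set" "\<lambda>_. G" "\<lambda>_. b"
    by standard (auto simp: G)
  note [measurable] = gauss_linear_measurable[OF G]
  have e: "exceed t = {x. \<bar>G x\<bar> > t}" for t
    by (auto simp: exceed_def)
  obtain s where s: "s > 0" "gauss_seq.prob {x. \<bar>G x\<bar> > s} \<le> 1 / 4"
    using gauss_seq.prob_le_quarter_large[OF gauss_linear_measurable[OF G]] by auto
  show ?thesis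
  proof (rule gauss_seq.square_integrable_of_gaussian_tail[where c="1 / (24 * s\<^sup>2)" and s=s])
    show "gauss_seq.prob {x \<in> space gauss_seq. t < \<bar>G x\<bar>} \<le> exp (- (1 / (24 * s\<^sup>2)) * t\<^sup>2)" if "t \<ge> s" for t
      using fernique[OF s(1) _ that] s by (simp add: e)
  qed (use s in auto)
qed

lemma integral_gauss_seq2:
  fixes F :: "(nat \<Rightarrow> real) \<Rightarrow> 'b::{banach, second_countable_topology}"
  assumes [measurable]: "F \<in> borel_measurable gauss_seq"
  shows "(\<integral>z. F (fst z) \<partial>(gauss_seq \<Otimes>\<^sub>M gauss_seq)) = (\<integral>x. F x \<partial>gauss_seq)"
    "(\<integral>z. F (snd z) \<partial>(gauss_seq \<Otimes>\<^sub>M gauss_seq)) = (\<integral>x. F x \<partial>gauss_seq)"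
    "(\<integral>z. F (fst (rot_seq z)) \<partial>(gauss_seq \<Otimes>\<^sub>M gauss_seq)) = (\<integral>x. F x \<partial>gauss_seq)"
    "(\<integral>z. F (snd (rot_seq z)) \<partial>(gauss_seq \<Otimes>\<^sub>M gauss_seq)) = (\<integral>x. F x \<partial>gauss_seq)"
proof -
  let ?N = "gauss_seq \<Otimes>\<^sub>M gauss_seq"
  show 1: "(\<integral>z. F (fst z) \<partial>?N) = (\<integral>x. F x \<partial>gauss_seq)"
    by (subst (3) distr_gauss_seq2(1)[symmetric]) (simp add: integral_distr)
  show 2: "(\<integral>z. F (snd z) \<partial>?N) = (\<integral>x. F x \<partial>gauss_seq)"
    by (subst (3) distr_gauss_seq2(2)[symmetric]) (simp add: integral_distr)
  have "(\<integral>z. F (fst z) \<partial>distr ?N ?N rot_seq) = (\<integral>z. F (fst (rot_seq z)) \<partial>?N)"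
    "(\<integral>z. F (snd z) \<partial>distr ?N ?N rot_seq) = (\<integral>z. F (snd (rot_seq z)) \<partial>?N)"
    by (rule integral_distr; measurable)+
  then show "(\<integral>z. F (fst (rot_seq z)) \<partial>?N) = (\<integral>x. F x \<partial>gauss_seq)"
    "(\<integral>z. F (snd (rot_seq z)) \<partial>?N) = (\<integral>x. F x \<partial>gauss_seq)"
    by (simp_all add: distr_rot_seq 1 2)
qed

lemma gauss_linear_mean_zero:
  assumes G: "gauss_linear G b"
  shows "gauss_seq.expectation G = 0"
proof -
  let ?N = "gauss_seq \<Otimes>\<^sub>M gauss_seq"
  note Gm [measurable] = gauss_linear_measurable[OF G]
  have int: "integrable gauss_seq G"
    using gauss_seq.square_integrable_imp_integrable[OF Gm gauss_linear_square_integrable[OF G]] .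
  have int2: "integrable ?N (\<lambda>z. G (fst z))" "integrable ?N (\<lambda>z. G (snd z))"
    using int distr_gauss_seq2 by (subst integrable_distr_eq[symmetric, where N=gauss_seq]; simp)+
  have "gauss_seq.expectation G = (\<integral>z. G (snd (rot_seq z)) \<partial>?N)"
    by (simp add: integral_gauss_seq2)
  also have "\<dots> = (\<integral>z. (G (fst z) - G (snd z)) / sqrt 2 \<partial>?N)"
    using G by (intro integral_cong_AE) (auto simp: gauss_linear_def)
  also have "\<dots> = (gauss_seq.expectation G - gauss_seq.expectation G) / sqrt 2"
    using int2 by (simp add: integral_gauss_seq2)
  finally show ?thesis by simp
qed

lemma gauss_linear_char_sqrt2:
  assumes G: "gauss_linear G b"
  shows "char (distr gauss_seq borel G) t = (char (distr gauss_seq borel G) (t / sqrt 2))\<^sup>2"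
proof -
  let ?N = "gauss_seq \<Otimes>\<^sub>M gauss_seq"
  note Gm [measurable] = gauss_linear_measurable[OF G]
  have "char (distr gauss_seq borel G) t = (\<integral>x. iexp (t * G x) \<partial>gauss_seq)"
    by (simp add: char_def integral_distr)
  also have "\<dots> = (\<integral>z. iexp (t * G (fst (rot_seq z))) \<partial>?N)"
    by (rule integral_gauss_seq2(3)[symmetric]) measurable
  also have "\<dots> = (\<integral>z. iexp (t / sqrt 2 * G (fst z)) * iexp (t / sqrt 2 * G (snd z)) \<partial>?N)"
  proof (rule integral_cong_AE)
    have "AE z in ?N. G (fst (rot_seq z)) = (G (fst z) + G (snd z)) / sqrt 2"
      using G by (auto simp: gauss_linear_def)
    then show "AE z in ?N. iexp (t * G (fst (rot_seq z))) = iexp (t / sqrt 2 * G (fst z)) * iexp (t / sqrt 2 * G (snd z))"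
      by eventually_elim (simp add: exp_add[symmetric] algebra_simps add_divide_distrib)
  qed measurable
  also have "\<dots> = (\<integral>x. \<integral>y. iexp (t / sqrt 2 * G x) * iexp (t / sqrt 2 * G y) \<partial>gauss_seq \<partial>gauss_seq)"
    by (subst gauss_seq2.integral_fst'[symmetric])
       (auto intro!: gauss_seq2.P.integrable_const_bound[where B=1] simp: norm_mult)
  also have "\<dots> = (\<integral>x. iexp (t / sqrt 2 * G x) \<partial>gauss_seq) * (\<integral>x. iexp (t / sqrt 2 * G x) \<partial>gauss_seq)"
    by simp
  also have "(\<integral>x. iexp (t / sqrt 2 * G x) \<partial>gauss_seq) = char (distr gauss_seq borel G) (t / sqrt 2)"
    by (simp add: char_def integral_distr)
  finally show ?thesis by (simp add: power2_eq_square)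
qed

lemma indep_vars_PiM_coordinates:
  assumes "\<And>i. prob_space (N i)"
  shows "prob_space.indep_vars (PiM UNIV N) N (\<lambda>i x. x i) UNIV"
proof -
  interpret P: prob_space "PiM UNIV N" by (rule prob_space_PiM) (rule assms)
  have "distr (PiM UNIV N) (PiM UNIV N) (\<lambda>x. \<lambda>i\<in>UNIV. x i) = (\<Pi>\<^sub>M i\<in>UNIV. distr (PiM UNIV N) (N i) (\<lambda>x. x i))"
    using distr_PiM_component[where I=UNIV and M=N] assms by (simp add: restrict_UNIV)
  then show ?thesis
    by (subst P.indep_vars_iff_distr_eq_PiM) auto
qed

text \<open>Additivity along the rotation makes the law of \<open>G\<close> equal to that of the normalised sums of
  \<open>2\<^sup>n\<close> independent copies, so the central limit theorem identifies it.\<close>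
lemma gauss_linear_char:
  assumes G: "gauss_linear G b"
  shows "char (distr gauss_seq borel G) t = complex_of_real (exp (- (gauss_seq.expectation (\<lambda>x. (G x)\<^sup>2) * t\<^sup>2) / 2))"
proof -
  note Gm [measurable] = gauss_linear_measurable[OF G]
  define \<sigma> where "\<sigma> = sqrt (gauss_seq.expectation (\<lambda>x. (G x)\<^sup>2))"
  have \<sigma>2: "\<sigma>\<^sup>2 = gauss_seq.expectation (\<lambda>x. (G x)\<^sup>2)"
    by (simp add: \<sigma>_def)
  define \<nu> where "\<nu> = distr gauss_seq borel G"
  interpret \<nu>: real_distribution \<nu>
    unfolding \<nu>_def by (rule gauss_seq.real_distribution_distr) simp
  have "\<sigma> \<ge> 0" by (simp add: \<sigma>_def)
  then consider "\<sigma> = 0" | "\<sigma> > 0" by linarith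
  then show ?thesis
  proof cases
    case 1
    then have "AE x in gauss_seq. (G x)\<^sup>2 = 0"
      using integral_nonneg_eq_0_iff_AE[OF gauss_linear_square_integrable[OF G]] \<sigma>2 by simp
    then have "(\<integral>x. iexp (t * G x) \<partial>gauss_seq) = (\<integral>x. 1 \<partial>gauss_seq)"
      by (intro integral_cong_AE) auto
    then show ?thesis
      using 1 \<sigma>2 gauss_seq.prob_space by (simp add: char_def integral_distr)
  next
    case 2
    let ?P = "PiM (UNIV :: nat set) (\<lambda>_. \<nu>)"
    interpret P: prob_space ?P by (intro prob_space_PiM \<nu>.prob_space_axioms)
    have comp: "distr ?P borel (\<lambda>x. x i) = \<nu>" for i
      using distr_PiM_component[of UNIV "\<lambda>_. \<nu>" i] \<nu>.prob_space_axioms by (simp cong: distr_cong)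
    have [measurable]: "(\<lambda>x. x i) \<in> borel_measurable ?P" for i
      using measurable_component_singleton[of i UNIV "\<lambda>_. \<nu>"] by (simp cong: measurable_cong_sets)
    have sq: "integrable \<nu> (\<lambda>x. x\<^sup>2)" "\<nu>.expectation (\<lambda>x. x\<^sup>2) = \<sigma>\<^sup>2" "\<nu>.expectation (\<lambda>x. x) = 0"
      using gauss_linear_square_integrable[OF G] \<sigma>2 gauss_linear_mean_zero[OF G]
      by (auto simp: \<nu>_def integrable_distr_eq integral_distr)
    have mean: "P.expectation (\<lambda>x. x i) = 0" for i
    proof -
      have "P.expectation (\<lambda>x. x i) = (\<integral>y. y \<partial>distr ?P borel (\<lambda>x. x i))"
        by (rule integral_distr[symmetric]) measurable
      then show ?thesis by (simp only: comp sq)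
    qed
    have sqP: "P.expectation (\<lambda>x. (x i)\<^sup>2) = \<sigma>\<^sup>2" "integrable ?P (\<lambda>x. (x i)\<^sup>2)" for i
    proof -
      have "P.expectation (\<lambda>x. (x i)\<^sup>2) = (\<integral>y. y\<^sup>2 \<partial>distr ?P borel (\<lambda>x. x i))"
        by (rule integral_distr[symmetric]) measurable
      then show "P.expectation (\<lambda>x. (x i)\<^sup>2) = \<sigma>\<^sup>2" by (simp only: comp sq)
      have "integrable (distr ?P borel (\<lambda>x. x i)) (\<lambda>y. y\<^sup>2) = integrable ?P (\<lambda>x. (x i)\<^sup>2)"
        by (rule integrable_distr_eq) measurable
      then show "integrable ?P (\<lambda>x. (x i)\<^sup>2)" by (simp only: comp sq)
    qed
    have ind: "P.indep_vars (\<lambda>_. borel) (\<lambda>i x. x i) UNIV"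
    proof -
      have "P.indep_vars (\<lambda>_. \<nu>) (\<lambda>i x. x i) UNIV"
        by (rule indep_vars_PiM_coordinates) (rule \<nu>.prob_space_axioms)
      from P.indep_vars_compose2[OF this, of "\<lambda>_ y. y" "\<lambda>_. borel"]
      show ?thesis by (simp cong: measurable_cong_sets)
    qed
    have clt: "weak_conv_m (\<lambda>n. distr ?P borel (\<lambda>x. (\<Sum>i<n. x i) / sqrt (n * \<sigma>\<^sup>2))) std_normal_distribution"
      by (rule P.central_limit_theorem_zero_mean[where \<mu>=\<nu>]) (use ind mean sqP comp 2 in simp_all)
    have ch: "char (distr ?P borel (\<lambda>x. (\<Sum>i<n. x i) / r)) u = char \<nu> (u / r) ^ n" for n r u
    proof -
      have "char (distr ?P borel (\<lambda>x. (\<Sum>i<n. x i) / r)) u = char (distr ?P borel (\<lambda>x. \<Sum>i<n. x i)) (u / r)"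
        by (simp add: char_def integral_distr)
      also have "\<dots> = (\<Prod>i<n. char (distr ?P borel (\<lambda>x. x i)) (u / r))"
        by (rule P.char_distr_sum) (rule P.indep_vars_subset[OF ind subset_UNIV])
      finally show ?thesis by (simp add: comp)
    qed
    have scale: "char \<nu> u = char \<nu> (u / sqrt (2 ^ m)) ^ (2 ^ m)" for u m
    proof (induction m)
      case (Suc m)
      have "char \<nu> (u / sqrt (2 ^ m)) = (char \<nu> (u / sqrt (2 ^ m) / sqrt 2))\<^sup>2"
        unfolding \<nu>_def by (rule gauss_linear_char_sqrt2[OF G])
      then show ?case
        using Suc by (simp add: power_mult[symmetric] real_sqrt_mult mult.commute)
    qed simp
    have "(\<lambda>n. char (distr ?P borel (\<lambda>x. (\<Sum>i<n. x i) / sqrt (n * \<sigma>\<^sup>2))) u) \<longlonglongrightarrow> char std_normal_distribution u" for u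
      by (intro levy_continuity1 clt P.real_distribution_distr real_dist_normal_dist) measurable
    then have "(\<lambda>m. char (distr ?P borel (\<lambda>x. (\<Sum>i<2^m. x i) / sqrt ((2^m :: nat) * \<sigma>\<^sup>2))) u) \<longlonglongrightarrow> char std_normal_distribution u" for u
      by (rule filterlim_compose) (rule filterlim_subseq, simp add: strict_mono_def)
    moreover have "char (distr ?P borel (\<lambda>x. (\<Sum>i<2^m. x i) / sqrt ((2^m :: nat) * \<sigma>\<^sup>2))) u = char \<nu> (u / \<sigma>)" for u m
      using scale[of "u / \<sigma>" m] 2 by (simp add: ch real_sqrt_mult mult.commute)
    ultimately have "char std_normal_distribution u = char \<nu> (u / \<sigma>)" for u
      by (simp add: LIMSEQ_const_iff)
    from this[of "\<sigma> * t"] show ?thesis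
      using 2 by (simp add: char_std_normal_distribution \<nu>_def power_mult_distrib \<sigma>2)
  qed
qed

theorem gauss_linear_distr:
  assumes G: "gauss_linear G b"
  shows "distr gauss_seq borel G
       = distr std_normal_distribution borel (\<lambda>x. sqrt (gauss_seq.expectation (\<lambda>x. (G x)\<^sup>2)) * x)"
proof (rule Levy_uniqueness)
  note Gm [measurable] = gauss_linear_measurable[OF G]
  let ?s = "sqrt (gauss_seq.expectation (\<lambda>x. (G x)\<^sup>2))"
  show "real_distribution (distr gauss_seq borel G)"
    by (rule gauss_seq.real_distribution_distr) simp
  show "real_distribution (distr std_normal_distribution borel (\<lambda>x. ?s * x))"
    by (rule std_normal.real_distribution_distr) simp
  show "char (distr gauss_seq borel G) = char (distr std_normal_distribution borel (\<lambda>x. ?s * x))"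
  proof
    fix t
    have "char (distr std_normal_distribution borel (\<lambda>x. ?s * x)) t = char std_normal_distribution (t * ?s)"
      by (simp add: char_def integral_distr mult.assoc)
    also have "\<dots> = complex_of_real (exp (- (gauss_seq.expectation (\<lambda>x. (G x)\<^sup>2) * t\<^sup>2) / 2))"
      by (simp add: char_std_normal_distribution power_mult_distrib mult.commute)
    finally show "char (distr gauss_seq borel G) t = char (distr std_normal_distribution borel (\<lambda>x. ?s * x)) t"
      by (simp only: gauss_linear_char[OF G])
  qed
qed

lemma std_normal_tail_le:
  assumes "t \<ge> 0"
  shows "std_normal.prob {x. \<bar>x\<bar> > t} \<le> 2 * exp (- t\<^sup>2 / 2)"
proof -
  have upper: "emeasure std_normal_distribution {x. x > t} \<le> ennreal (exp (- t\<^sup>2 / 2))"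
  proof -
    have "emeasure std_normal_distribution {x. x > t}
        = (\<integral>\<^sup>+x. ennreal (std_normal_density x) * indicator {x. x > t} x \<partial>lborel)"
      by (simp add: emeasure_density)
    also have "\<dots> = (\<integral>\<^sup>+y. ennreal (std_normal_density (t + 1 * y)) * indicator {x. x > t} (t + 1 * y) \<partial>lborel)"
      by (subst nn_integral_real_affine[where c=1 and t=t]) auto
    also have "\<dots> \<le> (\<integral>\<^sup>+y. ennreal (exp (- t\<^sup>2 / 2)) * ennreal (std_normal_density y) \<partial>lborel)"
    proof (rule nn_integral_mono)
      fix y :: real
      show "ennreal (std_normal_density (t + 1 * y)) * indicator {x. x > t} (t + 1 * y)
          \<le> ennreal (exp (- t\<^sup>2 / 2)) * ennreal (std_normal_density y)"
      proof (cases "y > 0")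
        case True
        have "t\<^sup>2 + y\<^sup>2 \<le> (t + y)\<^sup>2"
          using True assms by (simp add: power2_sum)
        then have "- (t + y)\<^sup>2 / 2 \<le> - t\<^sup>2 / 2 + - y\<^sup>2 / 2"
          by linarith
        then have "exp (- (t + y)\<^sup>2 / 2) \<le> exp (- t\<^sup>2 / 2) * exp (- y\<^sup>2 / 2)"
          unfolding exp_add[symmetric] by simp
        then have "std_normal_density (t + y) \<le> exp (- t\<^sup>2 / 2) * std_normal_density y"
          unfolding std_normal_density_def by (simp add: divide_right_mono)
        then show ?thesis
          using True by (simp add: ennreal_mult'[symmetric] ennreal_leI)
      qed simp
    qed
    also have "\<dots> = ennreal (exp (- t\<^sup>2 / 2)) * emeasure std_normal_distribution (space std_normal_distribution)"
      by (simp add: nn_integral_cmult emeasure_density)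
    finally show ?thesis
      by (simp only: std_normal.emeasure_space_1 mult_1_right)
  qed
  have upper': "std_normal.prob {x. x > t} \<le> exp (- t\<^sup>2 / 2)"
    using upper by (simp add: std_normal.emeasure_eq_measure)
  have "std_normal.prob {x. x < - t} = measure (distr std_normal_distribution std_normal_distribution uminus) {x. x > t}"
    by (subst measure_distr) (auto simp: vimage_def intro!: arg_cong[where f=std_normal.prob])
  then have lower: "std_normal.prob {x. x < - t} \<le> exp (- t\<^sup>2 / 2)"
    using upper' by (simp add: distr_std_normal_uminus)
  have "std_normal.prob {x. \<bar>x\<bar> > t} \<le> std_normal.prob ({x. x > t} \<union> {x. x < - t})"
    by (intro std_normal.finite_measure_mono) auto
  also have "\<dots> \<le> std_normal.prob {x. x > t} + std_normal.prob {x. x < - t}"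
    by (rule measure_Un_le) auto
  finally show ?thesis
    using upper' lower by linarith
qed

lemma std_normal_tail_ge:
  assumes "t \<ge> 0"
  shows "std_normal.prob {x. \<bar>x\<bar> > t} \<ge> std_normal_density (t + 1)"
proof -
  have "ennreal (std_normal_density (t + 1)) = (\<integral>\<^sup>+x. ennreal (std_normal_density (t + 1)) * indicator {t<..t + 1} x \<partial>lborel)"
    by (simp add: nn_integral_cmult_indicator)
  also have "\<dots> \<le> (\<integral>\<^sup>+x. ennreal (std_normal_density x) * indicator {x. \<bar>x\<bar> > t} x \<partial>lborel)"
  proof (rule nn_integral_mono)
    fix x :: real
    have "std_normal_density (t + 1) \<le> std_normal_density x" if "t < x" "x \<le> t + 1"
    proof -
      have "x\<^sup>2 \<le> (t + 1)\<^sup>2" using that assms by (intro power_mono) auto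
      then show ?thesis
        unfolding std_normal_density_def by (intro mult_left_mono) auto
    qed
    then show "ennreal (std_normal_density (t + 1)) * indicator {t<..t + 1} x
        \<le> ennreal (std_normal_density x) * indicator {x. \<bar>x\<bar> > t} x"
      using assms by (auto simp: indicator_def intro!: ennreal_leI)
  qed
  also have "\<dots> = emeasure std_normal_distribution {x. \<bar>x\<bar> > t}"
    by (simp add: emeasure_density)
  finally show ?thesis
    by (simp add: std_normal.emeasure_eq_measure)
qed

lemma std_normal_half: "std_normal.prob {x. \<bar>x\<bar> > 1 / 2} > 1 / 4"
proof -
  have le: "std_normal_density x \<le> 1 / 2" for x
  proof -
    have "sqrt (2 * pi) \<ge> sqrt (2\<^sup>2)"
      using pi_ge_two by (intro real_sqrt_le_mono) (simp add: power2_eq_square)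
    then have "1 / sqrt (2 * pi) \<le> 1 / 2" by (simp add: field_simps)
    moreover have "exp (- x\<^sup>2 / 2) \<le> 1" by simp
    ultimately have "1 / sqrt (2 * pi) * exp (- x\<^sup>2 / 2) \<le> 1 / 2 * 1"
      by (intro mult_mono) auto
    then show ?thesis by (simp add: std_normal_density_def)
  qed
  have "emeasure std_normal_distribution {-1/2..1/2}
      = (\<integral>\<^sup>+x. ennreal (std_normal_density x) * indicator {-1/2..1/2} x \<partial>lborel)"
    by (simp add: emeasure_density)
  also have "\<dots> \<le> (\<integral>\<^sup>+x. ennreal (1 / 2) * indicator {-1/2..1/2::real} x \<partial>lborel)"
    by (intro nn_integral_mono mult_right_mono ennreal_leI le) simp
  also have "\<dots> = ennreal (1 / 2) * emeasure lborel {-1/2..1/2::real}"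
    by (rule nn_integral_cmult_indicator) simp
  also have "\<dots> = ennreal (1 / 2)"
    by simp
  finally have *: "std_normal.prob {-1/2..1/2} \<le> 1 / 2"
    unfolding std_normal.emeasure_eq_measure by (subst (asm) ennreal_le_iff) simp_all
  have "{x. \<bar>x\<bar> > 1 / 2} = space std_normal_distribution - {-1/2..1/2::real}"
    by (auto simp: abs_le_iff not_le[symmetric])
  then have "std_normal.prob {x. \<bar>x\<bar> > 1 / 2} = 1 - std_normal.prob {-1/2..1/2}"
    by (simp only: std_normal.prob_compl)  (subst std_normal.prob_compl, auto)
  with * show ?thesis by linarith
qed

lemma gauss_linear_tail:
  assumes G: "gauss_linear G b"
  defines "\<sigma> \<equiv> sqrt (gauss_seq.expectation (\<lambda>x. (G x)\<^sup>2))"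
  shows "gauss_seq.prob {x. \<bar>G x\<bar> > t} = std_normal.prob {x. \<bar>\<sigma> * x\<bar> > t}"
proof -
  note [measurable] = gauss_linear_measurable[OF G]
  have "gauss_seq.prob {x. \<bar>G x\<bar> > t} = measure (distr gauss_seq borel G) {y. \<bar>y\<bar> > t}"
    by (subst measure_distr) (auto simp: vimage_def)
  also have "\<dots> = measure (distr std_normal_distribution borel (\<lambda>x. \<sigma> * x)) {y. \<bar>y\<bar> > t}"
    by (simp only: gauss_linear_distr[OF G] \<sigma>_def)
  also have "\<dots> = std_normal.prob {x. \<bar>\<sigma> * x\<bar> > t}"
    by (subst measure_distr) (auto simp: vimage_def)
  finally show ?thesis .
qed

lemma gauss_linear_tail_le:
  assumes G: "gauss_linear G b" and v: "gauss_seq.expectation (\<lambda>x. (G x)\<^sup>2) \<le> v" "v > 0" and t: "t \<ge> 0"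
  shows "gauss_seq.prob {x. \<bar>G x\<bar> > t} \<le> 2 * exp (- t\<^sup>2 / (2 * v))"
proof -
  define \<sigma> where "\<sigma> = sqrt (gauss_seq.expectation (\<lambda>x. (G x)\<^sup>2))"
  have \<sigma>: "0 \<le> \<sigma>" "\<sigma> \<le> sqrt v"
    using v by (auto simp: \<sigma>_def)
  have "std_normal.prob {x. \<bar>\<sigma> * x\<bar> > t} \<le> std_normal.prob {x. \<bar>x\<bar> > t / sqrt v}"
  proof (intro std_normal.finite_measure_mono subsetI)
    fix x assume "x \<in> {x. \<bar>\<sigma> * x\<bar> > t}"
    then have "t < \<sigma> * \<bar>x\<bar>" using \<sigma> by (simp add: abs_mult)
    also have "\<dots> \<le> sqrt v * \<bar>x\<bar>" using \<sigma> by (intro mult_right_mono) auto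
    finally show "x \<in> {x. \<bar>x\<bar> > t / sqrt v}"
      using v by (simp add: pos_divide_less_eq mult.commute)
  qed auto
  also have "\<dots> \<le> 2 * exp (- (t / sqrt v)\<^sup>2 / 2)"
    using t v by (intro std_normal_tail_le) auto
  also have "(t / sqrt v)\<^sup>2 = t\<^sup>2 / v"
    using v by (simp add: power_divide)
  finally show ?thesis
    unfolding gauss_linear_tail[OF G] \<sigma>_def by (simp add: mult.commute)
qed

lemma gauss_linear_tail_ge:
  assumes G: "gauss_linear G b" and v: "0 < v" "v \<le> gauss_seq.expectation (\<lambda>x. (G x)\<^sup>2)" and t: "t \<ge> 0"
  shows "gauss_seq.prob {x. \<bar>G x\<bar> > t} \<ge> std_normal_density (t / sqrt v + 1)"
proof -
  define \<sigma> where "\<sigma> = sqrt (gauss_seq.expectation (\<lambda>x. (G x)\<^sup>2))"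
  have \<sigma>: "0 < sqrt v" "sqrt v \<le> \<sigma>"
    using v by (auto simp: \<sigma>_def)
  then have pos: "\<sigma> > 0" by linarith
  have "std_normal_density (t / sqrt v + 1) \<le> std_normal.prob {x. \<bar>x\<bar> > t / sqrt v}"
    using t v by (intro std_normal_tail_ge) auto
  also have "\<dots> \<le> std_normal.prob {x. \<bar>\<sigma> * x\<bar> > t}"
  proof (intro std_normal.finite_measure_mono subsetI)
    fix x assume "x \<in> {x. \<bar>x\<bar> > t / sqrt v}"
    then have "t < sqrt v * \<bar>x\<bar>" using \<sigma> by (simp add: pos_divide_less_eq mult.commute)
    also have "\<dots> \<le> \<sigma> * \<bar>x\<bar>" using \<sigma> by (intro mult_right_mono) auto
    finally show "x \<in> {x. \<bar>\<sigma> * x\<bar> > t}"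
      using pos by (simp add: abs_mult)
  qed auto
  finally show ?thesis
    unfolding gauss_linear_tail[OF G] \<sigma>_def .
qed

lemma gauss_linear_variance_le:
  assumes G: "gauss_linear G b" and s: "s > 0" "gauss_seq.prob {x. \<bar>G x\<bar> > s} \<le> 1 / 4"
  shows "gauss_seq.expectation (\<lambda>x. (G x)\<^sup>2) \<le> 4 * s\<^sup>2"
proof (rule ccontr)
  define \<sigma> where "\<sigma> = sqrt (gauss_seq.expectation (\<lambda>x. (G x)\<^sup>2))"
  assume "\<not> ?thesis"
  then have "sqrt ((2 * s)\<^sup>2) < \<sigma>"
    unfolding \<sigma>_def by (intro real_sqrt_less_mono) (simp add: power_mult_distrib)
  then have \<sigma>: "2 * s < \<sigma>" using s by (simp only: real_sqrt_abs)
  have "std_normal.prob {x. \<bar>x\<bar> > 1 / 2} \<le> std_normal.prob {x. \<bar>\<sigma> * x\<bar> > s}"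
  proof (intro std_normal.finite_measure_mono subsetI)
    fix x :: real assume "x \<in> {x. \<bar>x\<bar> > 1 / 2}"
    then have "2 * s * (1 / 2) < \<sigma> * \<bar>x\<bar>"
      using \<sigma> s by (intro mult_strict_mono) auto
    then show "x \<in> {x. \<bar>\<sigma> * x\<bar> > s}"
      using \<sigma> s by (simp add: abs_mult)
  qed auto
  then show False
    using s std_normal_half unfolding gauss_linear_tail[OF G] \<sigma>_def by linarith
qed

section \<open>Random variables that are linear in a Gaussian sequence\<close>

lemma (in prob_space) prob_tendsto_zero:
  assumes [measurable]: "\<And>n. A n \<in> events"
    and ev: "AE x in M. eventually (\<lambda>n. x \<notin> A n) sequentially"
  shows "(\<lambda>n. prob (A n)) \<longlonglongrightarrow> 0"
proof -
  have "(\<lambda>n. expectation (indicat_real (A n))) \<longlonglongrightarrow> expectation (\<lambda>_. 0)"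
  proof (rule integral_dominated_convergence[where w="\<lambda>_. 1"])
    show "AE x in M. (\<lambda>n. indicat_real (A n) x) \<longlonglongrightarrow> 0"
      using ev by eventually_elim (auto intro!: tendsto_eventually elim: eventually_mono)
  qed (auto simp: indicator_def)
  then show ?thesis by simp
qed

locale gauss_sequence = prob_space M for M :: "'w measure" +
  fixes X :: "'w \<Rightarrow> nat \<Rightarrow> real"
  assumes measurable_X [measurable]: "X \<in> M \<rightarrow>\<^sub>M gauss_seq"
    and distr_X: "distr M gauss_seq X = gauss_seq"
begin

definition glin :: "('w \<Rightarrow> real) \<Rightarrow> (nat \<Rightarrow> real) \<Rightarrow> bool" where
  "glin Y b \<longleftrightarrow> (\<exists>G. gauss_linear G b \<and> (AE \<omega> in M. Y \<omega> = G (X \<omega>)))"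

lemma glinE:
  assumes "glin Y b"
  obtains G where "gauss_linear G b" "AE \<omega> in M. Y \<omega> = G (X \<omega>)"
  using assms by (auto simp: glin_def)

lemma AE_gauss_seq_iff:
  assumes [measurable]: "Measurable.pred gauss_seq P"
  shows "(AE x in gauss_seq. P x) \<longleftrightarrow> (AE \<omega> in M. P (X \<omega>))"
proof -
  have "{x \<in> space gauss_seq. P x} \<in> sets gauss_seq" by measurable
  from AE_distr_iff[OF measurable_X this] show ?thesis
    by (simp only: distr_X)
qed

lemma glin_component: "glin (\<lambda>\<omega>. X \<omega> i) (\<lambda>k. if k = i then 1 else 0)"
  unfolding glin_def using gauss_linear_component[of i] by blast

lemma glin_zero: "glin (\<lambda>_. 0) (\<lambda>_. 0)"
  unfolding glin_def using gauss_linear_zero by blast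

lemma glin_scale:
  assumes "glin Y b"
  shows "glin (\<lambda>\<omega>. r * Y \<omega>) (\<lambda>k. r * b k)"
proof -
  obtain G where G: "gauss_linear G b" "AE \<omega> in M. Y \<omega> = G (X \<omega>)"
    using assms by (rule glinE)
  from G(2) have "AE \<omega> in M. r * Y \<omega> = r * G (X \<omega>)"
    by eventually_elim simp
  with gauss_linear_scale[OF G(1), of r] show ?thesis
    unfolding glin_def by (intro exI conjI)
qed

lemma glin_add:
  assumes "glin Y b" "glin Y' b'"
  shows "glin (\<lambda>\<omega>. Y \<omega> + Y' \<omega>) (\<lambda>k. b k + b' k)"
proof -
  obtain G where G: "gauss_linear G b" "AE \<omega> in M. Y \<omega> = G (X \<omega>)"
    using assms(1) by (rule glinE)
  obtain G' where G': "gauss_linear G' b'" "AE \<omega> in M. Y' \<omega> = G' (X \<omega>)"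
    using assms(2) by (rule glinE)
  from G(2) G'(2) have "AE \<omega> in M. Y \<omega> + Y' \<omega> = G (X \<omega>) + G' (X \<omega>)"
    by eventually_elim simp
  with gauss_linear_add[OF G(1) G'(1)] show ?thesis
    unfolding glin_def by (intro exI conjI)
qed

lemma glin_diff:
  assumes "glin Y b" "glin Y' b'"
  shows "glin (\<lambda>\<omega>. Y \<omega> - Y' \<omega>) (\<lambda>k. b k - b' k)"
  using glin_add[OF assms(1) glin_scale[OF assms(2), of "-1"]] by simp

lemma glin_sum:
  assumes "\<And>i. i \<in> I \<Longrightarrow> glin (Y i) (b i)"
  shows "glin (\<lambda>\<omega>. \<Sum>i\<in>I. Y i \<omega>) (\<lambda>k. \<Sum>i\<in>I. b i k)"
  using assms
proof (induction I rule: infinite_finite_induct)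
  case (insert i I)
  have "glin (\<lambda>\<omega>. Y i \<omega> + (\<Sum>i\<in>I. Y i \<omega>)) (\<lambda>k. b i k + (\<Sum>i\<in>I. b i k))"
    using insert by (intro glin_add) auto
  with insert(1,2) show ?case by simp
qed (simp_all add: glin_zero)

lemma glin_limit:
  assumes lin: "\<And>n. glin (Y n) (b n)" and lim: "AE \<omega> in M. (\<lambda>n. Y n \<omega>) \<longlonglongrightarrow> Z \<omega>"
  obtains d where "glin Z d" "\<And>k. (\<lambda>n. b n k) \<longlonglongrightarrow> d k"
proof -
  have "\<exists>G. gauss_linear G (b n) \<and> (AE \<omega> in M. Y n \<omega> = G (X \<omega>))" for n
    using lin[of n] unfolding glin_def .
  then have "\<exists>G. \<forall>n. gauss_linear (G n) (b n) \<and> (AE \<omega> in M. Y n \<omega> = G n (X \<omega>))"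
    by (intro choice allI)
  then obtain G where G: "\<And>n. gauss_linear (G n) (b n)" "\<And>n. AE \<omega> in M. Y n \<omega> = G n (X \<omega>)"
    by auto
  note [measurable] = gauss_linear_measurable[OF G(1)]
  define H where "H = (\<lambda>x. lim (\<lambda>n. G n x))"
  have H [measurable]: "H \<in> borel_measurable gauss_seq"
    unfolding H_def by measurable
  have "AE \<omega> in M. \<forall>n. Y n \<omega> = G n (X \<omega>)"
    unfolding AE_all_countable using G(2) by blast
  with lim have lim': "AE \<omega> in M. (\<lambda>n. G n (X \<omega>)) \<longlonglongrightarrow> Z \<omega>"
    by eventually_elim simp
  then have "AE \<omega> in M. Cauchy (\<lambda>n. G n (X \<omega>))"
    by eventually_elim (rule LIMSEQ_imp_Cauchy)
  then have "AE x in gauss_seq. Cauchy (\<lambda>n. G n x)"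
    by (subst AE_gauss_seq_iff) (unfold pred_def, rule sets_Collect_Cauchy, measurable)
  then have "AE x in gauss_seq. (\<lambda>n. G n x) \<longlonglongrightarrow> H x"
    by eventually_elim (simp add: H_def Cauchy_convergent_iff convergent_LIMSEQ_iff)
  from gauss_linear_limit[OF G(1) H this] obtain d
    where d: "gauss_linear H d" "\<And>k. (\<lambda>n. b n k) \<longlonglongrightarrow> d k" by blast
  have "AE \<omega> in M. Z \<omega> = H (X \<omega>)"
    using lim' by eventually_elim (simp add: H_def limI)
  with d that show thesis
    unfolding glin_def by blast
qed

lemma glin_zero_coeff:
  assumes "glin Y b" "AE \<omega> in M. Y \<omega> = 0"
  shows "b k = 0"
proof -
  obtain G where G: "gauss_linear G b" "AE \<omega> in M. Y \<omega> = G (X \<omega>)"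
    using assms(1) by (rule glinE)
  note [measurable] = gauss_linear_measurable[OF G(1)]
  from G(2) assms(2) have "AE \<omega> in M. G (X \<omega>) = 0"
    by eventually_elim simp
  then have zero: "AE x in gauss_seq. G x = 0"
    by (subst AE_gauss_seq_iff) auto
  have "AE x in gauss_seq. G (flip k x) = G x - 2 * b k * x k"
    using G(1) unfolding gauss_linear_def by blast
  with zero AE_measure_preserving[OF measurable_flip[of k] distr_flip zero] AE_std_normal_nonzero[of k]
  have "AE x in gauss_seq. b k = 0"
    by eventually_elim simp
  then show ?thesis by simp
qed

lemma
  assumes Y: "glin Y b" and [measurable]: "Y \<in> borel_measurable M"
    and G: "gauss_linear G b'" "AE \<omega> in M. Y \<omega> = G (X \<omega>)"
  shows glin_prob_eq: "prob {\<omega> \<in> space M. \<bar>Y \<omega>\<bar> > t} = gauss_seq.prob {x. \<bar>G x\<bar> > t}"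
    and glin_second_moment_eq: "expectation (\<lambda>\<omega>. (Y \<omega>)\<^sup>2) = gauss_seq.expectation (\<lambda>x. (G x)\<^sup>2)"
proof -
  note [measurable] = gauss_linear_measurable[OF G(1)]
  have "prob {\<omega> \<in> space M. \<bar>Y \<omega>\<bar> > t} = prob {\<omega> \<in> space M. \<bar>G (X \<omega>)\<bar> > t}"
    using G(2) by (intro finite_measure_eq_AE) auto
  also have "\<dots> = prob (X -` {x \<in> space gauss_seq. \<bar>G x\<bar> > t} \<inter> space M)"
    by (auto intro!: arg_cong[where f=prob])
  also have "\<dots> = measure (distr M gauss_seq X) {x \<in> space gauss_seq. \<bar>G x\<bar> > t}"
    by (rule measure_distr[symmetric]) measurable
  finally show "prob {\<omega> \<in> space M. \<bar>Y \<omega>\<bar> > t} = gauss_seq.prob {x. \<bar>G x\<bar> > t}"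
    by (simp add: distr_X)
  have "expectation (\<lambda>\<omega>. (Y \<omega>)\<^sup>2) = expectation (\<lambda>\<omega>. (G (X \<omega>))\<^sup>2)"
    using G(2) by (intro integral_cong_AE) auto
  also have "\<dots> = (\<integral>x. (G x)\<^sup>2 \<partial>distr M gauss_seq X)"
    by (rule integral_distr[symmetric]) measurable
  finally show "expectation (\<lambda>\<omega>. (Y \<omega>)\<^sup>2) = gauss_seq.expectation (\<lambda>x. (G x)\<^sup>2)"
    by (simp add: distr_X)
qed

lemma
  assumes Y: "glin Y b" and Ym: "Y \<in> borel_measurable M"
  shows glin_tail_le: "expectation (\<lambda>\<omega>. (Y \<omega>)\<^sup>2) \<le> v \<Longrightarrow> v > 0 \<Longrightarrow> t \<ge> 0
      \<Longrightarrow> prob {\<omega> \<in> space M. \<bar>Y \<omega>\<bar> > t} \<le> 2 * exp (- t\<^sup>2 / (2 * v))"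
    and glin_tail_ge: "0 < v \<Longrightarrow> v \<le> expectation (\<lambda>\<omega>. (Y \<omega>)\<^sup>2) \<Longrightarrow> t \<ge> 0
      \<Longrightarrow> std_normal_density (t / sqrt v + 1) \<le> prob {\<omega> \<in> space M. \<bar>Y \<omega>\<bar> > t}"
    and glin_variance_le: "s > 0 \<Longrightarrow> prob {\<omega> \<in> space M. \<bar>Y \<omega>\<bar> > s} \<le> 1 / 4
      \<Longrightarrow> expectation (\<lambda>\<omega>. (Y \<omega>)\<^sup>2) \<le> 4 * s\<^sup>2"
proof -
  obtain G where G: "gauss_linear G b" "AE \<omega> in M. Y \<omega> = G (X \<omega>)"
    using Y by (rule glinE)
  note eq = glin_prob_eq[OF Y Ym G] glin_second_moment_eq[OF Y Ym G]
  show "expectation (\<lambda>\<omega>. (Y \<omega>)\<^sup>2) \<le> v \<Longrightarrow> v > 0 \<Longrightarrow> t \<ge> 0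
      \<Longrightarrow> prob {\<omega> \<in> space M. \<bar>Y \<omega>\<bar> > t} \<le> 2 * exp (- t\<^sup>2 / (2 * v))"
    unfolding eq by (rule gauss_linear_tail_le[OF G(1)])
  show "0 < v \<Longrightarrow> v \<le> expectation (\<lambda>\<omega>. (Y \<omega>)\<^sup>2) \<Longrightarrow> t \<ge> 0
      \<Longrightarrow> std_normal_density (t / sqrt v + 1) \<le> prob {\<omega> \<in> space M. \<bar>Y \<omega>\<bar> > t}"
    unfolding eq by (rule gauss_linear_tail_ge[OF G(1)])
  show "s > 0 \<Longrightarrow> prob {\<omega> \<in> space M. \<bar>Y \<omega>\<bar> > s} \<le> 1 / 4
      \<Longrightarrow> expectation (\<lambda>\<omega>. (Y \<omega>)\<^sup>2) \<le> 4 * s\<^sup>2"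
    unfolding eq by (rule gauss_linear_variance_le[OF G(1)])
qed

lemma sets_exists_exceed:
  assumes "countable Q" and [measurable]: "\<And>q. q \<in> Q \<Longrightarrow> Y q \<in> borel_measurable M"
  shows "{\<omega> \<in> space M. \<exists>q\<in>Q. \<bar>Y q \<omega> :: real\<bar> > t} \<in> events"
proof -
  have "{\<omega> \<in> space M. \<exists>q\<in>Q. \<bar>Y q \<omega>\<bar> > t} = (\<Union>q\<in>Q. {\<omega> \<in> space M. \<bar>Y q \<omega>\<bar> > t})"
    by auto
  also have "\<dots> \<in> events"
    using assms(1) by (intro sets.countable_UN') auto
  finally show ?thesis .
qed

lemma glin_fernique:
  fixes Y :: "'q \<Rightarrow> 'w \<Rightarrow> real"
  assumes Q: "countable Q" and Y: "\<And>q. q \<in> Q \<Longrightarrow> glin (Y q) (b q)"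
    and Ym: "\<And>q. q \<in> Q \<Longrightarrow> Y q \<in> borel_measurable M"
    and s: "s > 0" "prob {\<omega> \<in> space M. \<exists>q\<in>Q. \<bar>Y q \<omega>\<bar> > s} \<le> 1 / 4" and t: "t \<ge> s"
  shows "prob {\<omega> \<in> space M. \<exists>q\<in>Q. \<bar>Y q \<omega>\<bar> > t} \<le> exp (- t\<^sup>2 / (24 * s\<^sup>2))"
proof -
  have "\<forall>q\<in>Q. \<exists>G. gauss_linear G (b q) \<and> (AE \<omega> in M. Y q \<omega> = G (X \<omega>))"
    using Y unfolding glin_def by blast
  then have "\<exists>G. \<forall>q\<in>Q. gauss_linear (G q) (b q) \<and> (AE \<omega> in M. Y q \<omega> = G q (X \<omega>))"
    by (rule bchoice)
  then obtain G where G: "\<And>q. q \<in> Q \<Longrightarrow> gauss_linear (G q) (b q)"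
      "\<And>q. q \<in> Q \<Longrightarrow> AE \<omega> in M. Y q \<omega> = G q (X \<omega>)"
    by auto
  interpret fam: gauss_linear_family Q G b
    by unfold_locales (use Q G(1) in auto)
  have ae: "AE \<omega> in M. \<forall>q\<in>Q. Y q \<omega> = G q (X \<omega>)"
    using G(2) by (subst AE_ball_countable[OF Q]) blast
  have eq: "prob {\<omega> \<in> space M. \<exists>q\<in>Q. \<bar>Y q \<omega>\<bar> > r} = gauss_seq.prob (fam.exceed r)" for r
  proof -
    have "prob {\<omega> \<in> space M. \<exists>q\<in>Q. \<bar>Y q \<omega>\<bar> > r} = prob (X -` fam.exceed r \<inter> space M)"
    proof (rule finite_measure_eq_AE)
      show "AE \<omega> in M. (\<omega> \<in> {\<omega> \<in> space M. \<exists>q\<in>Q. \<bar>Y q \<omega>\<bar> > r}) = (\<omega> \<in> X -` fam.exceed r \<inter> space M)"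
        using ae by eventually_elim (auto simp: fam.exceed_def)
      show "{\<omega> \<in> space M. \<exists>q\<in>Q. \<bar>Y q \<omega>\<bar> > r} \<in> events"
        by (rule sets_exists_exceed[OF Q Ym])
    qed measurable
    also have "\<dots> = measure (distr M gauss_seq X) (fam.exceed r)"
      by (rule measure_distr[symmetric]) measurable
    finally show ?thesis by (simp add: distr_X)
  qed
  show ?thesis
    using fam.fernique[OF s(1) _ t] s(2) by (simp add: eq)
qed

end

section \<open>Suprema of continuous Gaussian fields\<close>

locale discretization =
  fixes r :: "nat \<Rightarrow> 's::topological_space \<Rightarrow> 's"
  assumes finite_range: "finite (range (r n))"
    and sets_fibre: "{x. r n x = p} \<in> sets borel"
    and uniform: "continuous_on UNIV (g :: 's \<Rightarrow> real) \<Longrightarrow> uniform_limit UNIV (\<lambda>n x. g (r n x)) g sequentially"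
begin

definition net :: "'s set" where "net = (\<Union>n. range (r n))"

lemma countable_net: "countable net"
  unfolding net_def using finite_range by (intro countable_UN) (auto intro: countable_finite)

lemma in_net: "r n x \<in> net"
  by (auto simp: net_def)

lemma pointwise:
  assumes "continuous_on UNIV (g :: 's \<Rightarrow> real)"
  shows "(\<lambda>n. g (r n x)) \<longlonglongrightarrow> g x"
  using uniform[OF assms] by (rule tendsto_uniform_limitI) simp

lemma exceed_net_iff:
  assumes "continuous_on UNIV (g :: 's \<Rightarrow> real)"
  shows "(\<exists>q\<in>net. \<bar>g q\<bar> > t) \<longleftrightarrow> (\<exists>x. \<bar>g x\<bar> > t)"
proof
  assume "\<exists>x. \<bar>g x\<bar> > t"
  then obtain x where x: "\<bar>g x\<bar> > t" by blast
  have "(\<lambda>n. \<bar>g (r n x)\<bar>) \<longlonglongrightarrow> \<bar>g x\<bar>"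
    using pointwise[OF assms] by (rule tendsto_rabs)
  then have "eventually (\<lambda>n. \<bar>g (r n x)\<bar> > t) sequentially"
    using x by (rule order_tendstoD)
  then obtain n where "\<bar>g (r n x)\<bar> > t"
    using eventually_happens' sequentially_bot by blast
  then show "\<exists>q\<in>net. \<bar>g q\<bar> > t"
    using in_net by blast
qed blast

lemma bounded_of_continuous:
  assumes "continuous_on UNIV (g :: 's \<Rightarrow> real)"
  obtains K :: real where "\<And>x. \<bar>g x\<bar> \<le> K"
proof -
  have "eventually (\<lambda>n. \<forall>x\<in>UNIV. dist (g (r n x)) (g x) < 1) sequentially"
    using uniform_limitD[OF uniform[OF assms], of 1] by simp
  then obtain n where n: "\<And>x. dist (g (r n x)) (g x) < 1"
    using eventually_happens' sequentially_bot by blast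
  define K where "K = Max ((\<lambda>p. \<bar>g p\<bar>) ` range (r n))"
  have "\<bar>g (r n x)\<bar> \<le> K" for x
    unfolding K_def using finite_range by (intro Max_ge) auto
  then have "\<bar>g x\<bar> \<le> K + 1" for x
    using n[of x] by (smt (verit) dist_real_def)
  then show thesis using that by blast
qed

end

text \<open>The points in one atom of the algebra generated by the first \<open>n\<close> basic open sets get a
  common representative.\<close>
lemma discretization_exists:
  assumes comp: "compact (UNIV :: 's::topological_space set)"
    and B: "countable B" "topological_basis (B :: 's set set)"
  shows "\<exists>r :: nat \<Rightarrow> 's \<Rightarrow> 's. discretization r"
proof -
  have "B \<noteq> {}"
    using topological_basisE[OF B(2) open_UNIV UNIV_I] by blast
  define U where "U = from_nat_into B"
  have U: "range U = B"
    unfolding U_def using B(1) \<open>B \<noteq> {}\<close> by (rule range_from_nat_into[rotated])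
  have openU: "open (U i)" for i
    using U topological_basis_open[OF B(2)] by blast
  define code where "code n x = {i. i < n \<and> x \<in> U i}" for n and x :: 's
  define rep where "rep n T = (SOME y. code n y = T)" for n and T :: "nat set"
  define r where "r n x = rep n (code n x)" for n x
  have code_r: "code n (r n x) = code n x" for n x
    unfolding r_def rep_def by (rule someI) simp
  have codes: "code n x \<in> Pow {..<n}" for n x
    by (auto simp: code_def)
  have "discretization r"
  proof
    fix n
    have "range (r n) \<subseteq> rep n ` Pow {..<n}"
      using codes by (auto simp: r_def)
    then show "finite (range (r n))"
      by (rule finite_subset) auto
    fix p
    have atom: "{x. code n x = T} \<in> sets borel" if "T \<in> Pow {..<n}" for T
    proof -
      define A where "A i = (if i \<in> T then U i else - U i)" for i
      have "{x. code n x = T} = (\<Inter>i\<in>{..<n}. A i)"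
        using that by (auto simp: code_def A_def split: if_splits)
      moreover have A: "A i \<in> sets borel" for i
        using openU[of i] by (cases "i \<in> T") (simp_all add: A_def borel_comp)
      have "(\<Inter>i\<in>{..<n}. A i) \<in> sets borel"
        by (cases "n = 0") (auto intro!: sets.finite_INT A)
      ultimately show ?thesis by simp
    qed
    have "{x. r n x = p} = (\<Union>T\<in>{T \<in> Pow {..<n}. rep n T = p}. {x. code n x = T})"
      using codes by (auto simp: r_def)
    also have "\<dots> \<in> sets borel"
      using atom by (intro sets.finite_UN) auto
    finally show "{x. r n x = p} \<in> sets borel" .
  next
    fix g :: "'s \<Rightarrow> real" assume g: "continuous_on UNIV g"
    show "uniform_limit UNIV (\<lambda>n x. g (r n x)) g sequentially"
    proof (rule uniform_limitI)
      fix e :: real assume e: "e > 0"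
      define J where "J = {i. \<forall>x\<in>U i. \<forall>y\<in>U i. dist (g x) (g y) < e}"
      have "\<exists>i\<in>J. x \<in> U i" for x
      proof -
        have "open {y. dist (g y) (g x) < e / 2}"
          using continuous_on_dist[OF g continuous_on_const] by (intro open_Collect_less) auto
        moreover have "x \<in> {y. dist (g y) (g x) < e / 2}" using e by simp
        ultimately obtain V where V: "V \<in> B" "x \<in> V" "V \<subseteq> {y. dist (g y) (g x) < e / 2}"
          by (rule topological_basisE[OF B(2)])
        then obtain i where i: "U i = V" using U by blast
        have "i \<in> J"
          unfolding J_def
        proof (intro CollectI ballI)
          fix y z assume "y \<in> U i" "z \<in> U i"
          then have "dist (g y) (g x) < e / 2" "dist (g z) (g x) < e / 2"
            using V(3) i by auto
          then show "dist (g y) (g z) < e"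
            by (rule dist_triangle_half_l)
        qed
        with i V(2) show ?thesis by blast
      qed
      then have "UNIV \<subseteq> (\<Union>i\<in>J. U i)" by blast
      from compactE_image[OF comp openU this]
      obtain I where I: "I \<subseteq> J" "finite I" "UNIV \<subseteq> (\<Union>i\<in>I. U i)" .
      show "\<forall>\<^sub>F n in sequentially. \<forall>x\<in>UNIV. dist (g (r n x)) (g x) < e"
        using eventually_gt_at_top[of "Max (insert 0 I)"]
      proof eventually_elim
        case (elim n)
        show ?case
        proof
          fix x
          obtain i where i: "i \<in> I" "x \<in> U i" using I(3) by blast
          then have "i < n" using elim I(2) by (simp add: Max_less_iff)
          with i have "i \<in> code n x" by (simp add: code_def)
          then have "i \<in> code n (r n x)" by (simp only: code_r)
          then have "r n x \<in> U i" by (simp add: code_def)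
          with i I(1) show "dist (g (r n x)) (g x) < e"
            by (auto simp: J_def)
        qed
      qed
    qed
  qed
  then show ?thesis by blast
qed

locale gauss_field = gauss_sequence M X + discretization r
  for M :: "'w measure" and X and r :: "nat \<Rightarrow> 's::topological_space \<Rightarrow> 's" +
  fixes Z :: "'w \<Rightarrow> 's \<Rightarrow> real" and \<beta> :: "'s \<Rightarrow> nat \<Rightarrow> real"
  assumes field_measurable: "(\<lambda>\<omega>. Z \<omega> x) \<in> borel_measurable M"
    and field_glin: "glin (\<lambda>\<omega>. Z \<omega> x) (\<beta> x)"
    and field_continuous: "AE \<omega> in M. continuous_on UNIV (Z \<omega>)"
begin

definition exceedance :: "real \<Rightarrow> 'w set" where
  "exceedance t = {\<omega> \<in> space M. \<exists>q\<in>net. \<bar>Z \<omega> q\<bar> > t}"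

lemma sets_exceedance [measurable]: "exceedance t \<in> events"
  unfolding exceedance_def by (rule sets_exists_exceed[OF countable_net field_measurable])

lemma prob_exceedance_quarter:
  obtains s where "s > 0" "prob (exceedance s) \<le> 1 / 4"
proof -
  have "(\<lambda>n. prob (exceedance (real n))) \<longlonglongrightarrow> 0"
  proof (rule prob_tendsto_zero)
    show "AE \<omega> in M. eventually (\<lambda>n. \<omega> \<notin> exceedance (real n)) sequentially"
      using field_continuous
    proof eventually_elim
      case (elim \<omega>)
      obtain K where K: "\<And>x. \<bar>Z \<omega> x\<bar> \<le> K"
        using bounded_of_continuous[OF elim] by blast
      obtain n where n: "K \<le> real n" using real_arch_simple by blast
      have "\<bar>Z \<omega> x\<bar> \<le> real m" if "m \<ge> n" for x m
        using K[of x] n that by linarith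
      then show ?case
        by (intro eventually_sequentiallyI[of n]) (auto simp: exceedance_def not_less)
    qed
  qed measurable
  then have "eventually (\<lambda>n. prob (exceedance (real n)) < 1 / 4) sequentially"
    by (rule order_tendstoD) simp
  then have "eventually (\<lambda>n. prob (exceedance (real n)) < 1 / 4 \<and> n \<ge> 1) sequentially"
    using eventually_ge_at_top[of 1] by eventually_elim simp
  then obtain n where "prob (exceedance (real n)) < 1 / 4" "n \<ge> 1"
    using eventually_happens' sequentially_bot by blast
  then show thesis by (intro that[of "real n"]) auto
qed

lemma gaussian_tail:
  obtains \<kappa> s where "\<kappa> > 0" "\<And>t. t \<ge> s \<Longrightarrow> prob (exceedance t) \<le> exp (- \<kappa> * t\<^sup>2)"
proof -
  obtain s where s: "s > 0" "prob (exceedance s) \<le> 1 / 4"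
    using prob_exceedance_quarter .
  have "prob (exceedance t) \<le> exp (- (1 / (24 * s\<^sup>2)) * t\<^sup>2)" if "t \<ge> s" for t
    using glin_fernique[OF countable_net field_glin field_measurable s(1) s(2)[unfolded exceedance_def] that]
    by (simp add: exceedance_def)
  then show thesis
    using s by (intro that[of "1 / (24 * s\<^sup>2)" s]) auto
qed

lemma AE_net_exceed: "AE \<omega> in M. \<bar>Z \<omega> x\<bar> > t \<longrightarrow> \<omega> \<in> exceedance t"
  using field_continuous AE_space
proof eventually_elim
  case (elim \<omega>)
  then show ?case
    using exceed_net_iff[OF elim(1), of t] by (auto simp: exceedance_def)
qed

lemma prob_point_le: "prob {\<omega> \<in> space M. \<bar>Z \<omega> x\<bar> > t} \<le> prob (exceedance t)"
  using AE_net_exceed by (intro finite_measure_mono_AE) auto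

lemma variance_bounded:
  obtains K where "\<And>x. expectation (\<lambda>\<omega>. (Z \<omega> x)\<^sup>2) \<le> K"
proof -
  obtain s where s: "s > 0" "prob (exceedance s) \<le> 1 / 4"
    using prob_exceedance_quarter .
  have "expectation (\<lambda>\<omega>. (Z \<omega> x)\<^sup>2) \<le> 4 * s\<^sup>2" for x
    using s prob_point_le[where x=x and t=s]
    by (intro glin_variance_le[OF field_glin field_measurable]) auto
  then show thesis using that by blast
qed

lemma oscillation_small:
  assumes "\<delta> > 0"
  obtains n where "prob {\<omega> \<in> space M. \<exists>q\<in>net. \<bar>Z \<omega> q - Z \<omega> (r n q)\<bar> > \<delta>} \<le> 1 / 4"
proof -
  have "(\<lambda>n. prob {\<omega> \<in> space M. \<exists>q\<in>net. \<bar>Z \<omega> q - Z \<omega> (r n q)\<bar> > \<delta>}) \<longlonglongrightarrow> 0"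
  proof (rule prob_tendsto_zero)
    show "{\<omega> \<in> space M. \<exists>q\<in>net. \<bar>Z \<omega> q - Z \<omega> (r n q)\<bar> > \<delta>} \<in> events" for n
      by (intro sets_exists_exceed countable_net borel_measurable_diff field_measurable)
    show "AE \<omega> in M. eventually (\<lambda>n. \<omega> \<notin> {\<omega> \<in> space M. \<exists>q\<in>net. \<bar>Z \<omega> q - Z \<omega> (r n q)\<bar> > \<delta>}) sequentially"
      using field_continuous
    proof eventually_elim
      case (elim \<omega>)
      have "eventually (\<lambda>n. \<forall>x\<in>UNIV. dist (Z \<omega> (r n x)) (Z \<omega> x) < \<delta>) sequentially"
        using uniform_limitD[OF uniform[OF elim] assms] .
      then show ?case
        by eventually_elim (auto simp: dist_real_def abs_minus_commute not_less intro: less_imp_le)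
    qed
  qed
  then have "eventually (\<lambda>n. prob {\<omega> \<in> space M. \<exists>q\<in>net. \<bar>Z \<omega> q - Z \<omega> (r n q)\<bar> > \<delta>} < 1 / 4) sequentially"
    by (rule order_tendstoD) simp
  then obtain n where "prob {\<omega> \<in> space M. \<exists>q\<in>net. \<bar>Z \<omega> q - Z \<omega> (r n q)\<bar> > \<delta>} < 1 / 4"
    using eventually_happens' sequentially_bot by blast
  then show thesis using that less_imp_le by blast
qed

text \<open>The oscillation of the field around a fine finite net has a Gaussian tail with arbitrarily
  good rate, so only the variances on the net matter.\<close>
lemma sharp_tail_le:
  assumes v: "v > 0" "\<And>x. expectation (\<lambda>\<omega>. (Z \<omega> x)\<^sup>2) \<le> v" and \<epsilon>: "0 < \<epsilon>" "\<epsilon> < 1"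
  shows "\<forall>\<^sub>F t in at_top. prob (exceedance t) \<le> exp (- (1 - \<epsilon>) * (t\<^sup>2 / (2 * v)))"
proof -
  define \<eta> where "\<eta> = \<epsilon> / 4"
  have \<eta>: "0 < \<eta>" "\<eta> < 1" using \<epsilon> by (auto simp: \<eta>_def)
  define \<delta> where "\<delta> = \<eta> * sqrt (v / 12)"
  have \<delta>: "\<delta> > 0" using v \<eta> by (simp add: \<delta>_def)
  have \<delta>2: "24 * \<delta>\<^sup>2 = \<eta>\<^sup>2 * (2 * v)" using v by (simp add: \<delta>_def power_mult_distrib)
  obtain n where n: "prob {\<omega> \<in> space M. \<exists>q\<in>net. \<bar>Z \<omega> q - Z \<omega> (r n q)\<bar> > \<delta>} \<le> 1 / 4"
    using oscillation_small[OF \<delta>] .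
  define K where "K = 2 * real (card (range (r n))) + 1"
  have bound: "prob (exceedance t) \<le> K * exp (- (1 - \<epsilon> / 2) * (t\<^sup>2 / (2 * v)))" if t: "t \<ge> \<delta> / \<eta>" for t
  proof -
    let ?E = "exp (- (1 - \<epsilon> / 2) * (t\<^sup>2 / (2 * v)))"
    let ?D = "{\<omega> \<in> space M. \<exists>q\<in>net. \<bar>Z \<omega> q - Z \<omega> (r n q)\<bar> > \<eta> * t}"
    let ?P = "\<lambda>p. {\<omega> \<in> space M. \<bar>Z \<omega> p\<bar> > (1 - \<eta>) * t}"
    have t0: "t \<ge> 0" using t \<delta> \<eta> by (meson divide_pos_pos less_imp_le order_trans)
    have \<eta>t: "\<eta> * t \<ge> \<delta>" using t \<eta> by (simp add: pos_divide_le_eq mult.commute)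
    have sD: "?D \<in> events"
      by (intro sets_exists_exceed countable_net borel_measurable_diff field_measurable)
    have sP: "?P p \<in> events" for p
      using field_measurable[of p] by measurable
    have sU: "(\<Union>p\<in>range (r n). ?P p) \<in> events"
      by (rule sets.finite_UN[OF finite_range sP])
    have "prob ?D \<le> exp (- (\<eta> * t)\<^sup>2 / (24 * \<delta>\<^sup>2))"
      by (rule glin_fernique[OF countable_net glin_diff[OF field_glin field_glin]
            borel_measurable_diff[OF field_measurable field_measurable] \<delta> n \<eta>t])
    also have "- (\<eta> * t)\<^sup>2 / (24 * \<delta>\<^sup>2) = - (t\<^sup>2 / (2 * v))"
      unfolding \<delta>2 using \<eta> by (simp add: power_mult_distrib)
    also have "exp (- (t\<^sup>2 / (2 * v))) \<le> ?E"
    proof -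
      have "(1 - \<epsilon> / 2) * (t\<^sup>2 / (2 * v)) \<le> t\<^sup>2 / (2 * v)"
        using \<epsilon> v by (intro mult_left_le_one_le) auto
      then show ?thesis by (simp only: exp_le_cancel_iff mult_minus_left neg_le_iff_le)
    qed
    finally have D: "prob ?D \<le> ?E" .
    have P: "prob (?P p) \<le> 2 * ?E" for p
    proof -
      have "prob (?P p) \<le> 2 * exp (- ((1 - \<eta>) * t)\<^sup>2 / (2 * v))"
        using v \<eta> t0 by (intro glin_tail_le[OF field_glin field_measurable]) auto
      also have "- ((1 - \<eta>) * t)\<^sup>2 / (2 * v) = - (1 - \<eta>)\<^sup>2 * (t\<^sup>2 / (2 * v))"
        by (simp add: power_mult_distrib)
      also have "exp (- (1 - \<eta>)\<^sup>2 * (t\<^sup>2 / (2 * v))) \<le> ?E"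
      proof -
        have "1 - \<epsilon> / 2 \<le> (1 - \<eta>)\<^sup>2"
          unfolding \<eta>_def by (simp add: power2_eq_square algebra_simps)
        then have "(1 - \<epsilon> / 2) * (t\<^sup>2 / (2 * v)) \<le> (1 - \<eta>)\<^sup>2 * (t\<^sup>2 / (2 * v))"
          using v by (intro mult_right_mono) auto
        then show ?thesis by (simp only: exp_le_cancel_iff mult_minus_left neg_le_iff_le)
      qed
      finally show ?thesis by simp
    qed
    have "exceedance t \<subseteq> (\<Union>p\<in>range (r n). ?P p) \<union> ?D"
    proof
      fix \<omega> assume "\<omega> \<in> exceedance t"
      then obtain q where \<omega>: "\<omega> \<in> space M" and q: "q \<in> net" "\<bar>Z \<omega> q\<bar> > t"
        by (auto simp: exceedance_def)
      have "\<bar>Z \<omega> (r n q)\<bar> > (1 - \<eta>) * t" if "\<not> \<bar>Z \<omega> q - Z \<omega> (r n q)\<bar> > \<eta> * t"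
      proof -
        have "(1 - \<eta>) * t = t - \<eta> * t" by (simp add: algebra_simps)
        then show ?thesis using that q(2) by linarith
      qed
      then show "\<omega> \<in> (\<Union>p\<in>range (r n). ?P p) \<union> ?D"
        using \<omega> q(1) by blast
    qed
    then have "prob (exceedance t) \<le> prob ((\<Union>p\<in>range (r n). ?P p) \<union> ?D)"
      by (intro finite_measure_mono sets.Un sU sD)
    also have "\<dots> \<le> prob (\<Union>p\<in>range (r n). ?P p) + prob ?D"
      by (rule measure_Un_le[OF sU sD])
    also have "prob (\<Union>p\<in>range (r n). ?P p) \<le> (\<Sum>p\<in>range (r n). prob (?P p))"
      using sP by (intro measure_UNION_le finite_range) auto
    also have "(\<Sum>p\<in>range (r n). prob (?P p)) \<le> (\<Sum>p\<in>range (r n). 2 * ?E)"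
      by (intro sum_mono P)
    finally have "prob (exceedance t) \<le> (\<Sum>p\<in>range (r n). 2 * ?E) + ?E"
      using D by linarith
    also have "\<dots> = K * ?E"
      by (simp add: K_def algebra_simps)
    finally show ?thesis .
  qed
  have "filterlim (\<lambda>t::real. \<epsilon> / (4 * v) * t\<^sup>2) at_top at_top"
    using \<epsilon> v by (intro filterlim_tendsto_pos_mult_at_top[OF tendsto_const] filterlim_pow_at_top filterlim_ident) auto
  then have "eventually (\<lambda>t. \<epsilon> / (4 * v) * t\<^sup>2 \<ge> ln K) at_top"
    by (simp add: filterlim_at_top)
  with eventually_ge_at_top[of "\<delta> / \<eta>"] show ?thesis
  proof eventually_elim
    case (elim t)
    have K: "K > 0" unfolding K_def by (intro add_nonneg_pos) auto
    have "K \<le> exp (\<epsilon> / (4 * v) * t\<^sup>2)"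
      using elim(2) K by (metis exp_le_cancel_iff exp_ln)
    then have "K * exp (- (1 - \<epsilon> / 2) * (t\<^sup>2 / (2 * v))) \<le> exp (\<epsilon> / (4 * v) * t\<^sup>2) * exp (- (1 - \<epsilon> / 2) * (t\<^sup>2 / (2 * v)))"
      by (intro mult_right_mono) auto
    also have "\<dots> = exp (- (1 - \<epsilon>) * (t\<^sup>2 / (2 * v)))"
      unfolding exp_add[symmetric] using v by (simp add: field_simps)
    finally show ?case
      using bound[OF elim(1)] by linarith
  qed
qed

end

section \<open>Topology and area of the surface\<close>

lemma shrinking_neighbourhoods:
  fixes B :: "'s::topological_space set set" and x :: 's
  assumes B: "countable B" "topological_basis B"
  obtains V :: "nat \<Rightarrow> 's set" where "\<And>n. open (V n)" "\<And>n. x \<in> V n"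
    "\<And>(g :: 's \<Rightarrow> real) e. continuous_on UNIV g \<Longrightarrow> e > 0
       \<Longrightarrow> eventually (\<lambda>n. \<forall>y\<in>V n. \<bar>g y - g x\<bar> < e) sequentially"
proof -
  have "B \<noteq> {}"
    using topological_basisE[OF B(2) open_UNIV UNIV_I] by blast
  define U where "U = from_nat_into B"
  have U: "range U = B"
    unfolding U_def using B(1) \<open>B \<noteq> {}\<close> by (rule range_from_nat_into[rotated])
  have openU: "open (U i)" for i
    using U topological_basis_open[OF B(2)] by blast
  define V where "V n = (\<Inter>i\<in>{i. i < n \<and> x \<in> U i}. U i)" for n
  have "open (V n)" for n
    unfolding V_def by (intro open_INT ballI openU) auto
  moreover have "x \<in> V n" for n
    by (auto simp: V_def)
  moreover have "eventually (\<lambda>n. \<forall>y\<in>V n. \<bar>g y - g x\<bar> < e) sequentially"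
    if g: "continuous_on UNIV g" and e: "e > 0" for g :: "'s \<Rightarrow> real" and e
  proof -
    have "open {y. \<bar>g y - g x\<bar> < e}"
      using g by (intro open_Collect_less continuous_intros) auto
    moreover have "x \<in> {y. \<bar>g y - g x\<bar> < e}" using e by simp
    ultimately obtain W where W: "W \<in> B" "x \<in> W" "W \<subseteq> {y. \<bar>g y - g x\<bar> < e}"
      by (rule topological_basisE[OF B(2)])
    then obtain i where i: "U i = W" using U by blast
    have "V n \<subseteq> W" if "n > i" for n
      unfolding V_def using that i W(2) by auto
    with W(3) have "\<forall>y\<in>V n. \<bar>g y - g x\<bar> < e" if "n > i" for n
      using that by blast
    then show ?thesis
      using eventually_gt_at_top[of i] by (rule eventually_mono[rotated])
  qed
  ultimately show thesis by (rule that)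
qed

lemma is_chartD:
  assumes "is_chart c"
  shows "open (chart_dom c)" "open (coord c ` chart_dom c)"
    "continuous_on (chart_dom c) (coord c)" "continuous_on (coord c ` chart_dom c) (chart_inv c)"
    "x \<in> chart_dom c \<Longrightarrow> chart_inv c (coord c x) = x" "inj_on (coord c) (chart_dom c)"
proof -
  have h: "homeomorphism (chart_dom c) (coord c ` chart_dom c) (coord c) (chart_inv c)"
    using assms by (simp add: is_chart_def)
  show "open (chart_dom c)" "open (coord c ` chart_dom c)"
    using assms by (simp_all add: is_chart_def)
  show "continuous_on (chart_dom c) (coord c)" "continuous_on (coord c ` chart_dom c) (chart_inv c)"
    using h by (rule homeomorphism_cont1, rule homeomorphism_cont2)
  show "x \<in> chart_dom c \<Longrightarrow> chart_inv c (coord c x) = x"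
    using h by (rule homeomorphism_apply1)
  show "inj_on (coord c) (chart_dom c)"
    by (rule inj_on_inverseI[where g="chart_inv c"]) (rule homeomorphism_apply1[OF h])
qed

lemma chart_preimage_open:
  assumes "is_chart c" "open W"
  shows "open (chart_dom c \<inter> coord c -` W)"
  using is_chartD[OF assms(1)] assms(2) by (intro continuous_open_preimage)

lemma chart_image_open:
  assumes c: "is_chart c" and "open O'"
  shows "open (coord c ` (chart_dom c \<inter> O'))"
proof -
  have "coord c ` (chart_dom c \<inter> O') = coord c ` chart_dom c \<inter> chart_inv c -` O'"
    using is_chartD(5)[OF c] by force
  also have "open \<dots>"
    using is_chartD[OF c] assms(2) by (intro continuous_open_preimage)
  finally show ?thesis .
qed

lemma chart_image_preimage:
  assumes "W \<subseteq> coord c ` chart_dom c"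
  shows "coord c ` (chart_dom c \<inter> coord c -` W) = W"
  using assms by force

lemma atlas_chart_exists:
  assumes "smooth_atlas \<A>"
  obtains c where "c \<in> \<A>" "x \<in> chart_dom c" "is_chart c"
proof -
  have "x \<in> (\<Union>c\<in>\<A>. chart_dom c)" "\<forall>c\<in>\<A>. is_chart c"
    using assms unfolding smooth_atlas_def by auto
  then show thesis using that by blast
qed

lemma surface_countable_basis:
  fixes \<A> :: "'s::topological_space chart set"
  assumes comp: "compact (UNIV :: 's set)" and \<A>: "smooth_atlas \<A>"
  obtains B :: "'s set set" where "countable B" "topological_basis B"
proof -
  have ch: "is_chart c" if "c \<in> \<A>" for c
    using \<A> that unfolding smooth_atlas_def by blast
  have cov: "UNIV \<subseteq> (\<Union>c\<in>\<A>. chart_dom c)"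
    using \<A> unfolding smooth_atlas_def by simp
  from compactE_image[OF comp is_chartD(1)[OF ch] cov]
  obtain C where C: "C \<subseteq> \<A>" "finite C" "UNIV \<subseteq> (\<Union>c\<in>C. chart_dom c)" .
  obtain W :: "(real^2) set set" where W: "countable W" "topological_basis W"
    using ex_countable_basis by blast
  define B where "B = (\<lambda>(c, w). chart_dom c \<inter> coord c -` w) ` (C \<times> W)"
  have "countable B"
    unfolding B_def using C(2) W(1) by (intro countable_image countable_SIGMA) (auto intro: countable_finite)
  moreover have "topological_basis B"
  proof (rule topological_basisI)
    fix b assume "b \<in> B"
    then obtain c w where "c \<in> C" "w \<in> W" "b = chart_dom c \<inter> coord c -` w"
      by (auto simp: B_def)
    with C(1) show "open b"
      by (simp only:) (intro chart_preimage_open ch topological_basis_open[OF W(2)]; blast)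
  next
    fix O' :: "'s set" and x assume O': "open O'" "x \<in> O'"
    obtain c where c: "c \<in> C" "x \<in> chart_dom c" using C(3) by blast
    then have chc: "is_chart c" using ch C(1) by blast
    have "coord c x \<in> coord c ` (chart_dom c \<inter> O')" using c O' by blast
    from topological_basisE[OF W(2) chart_image_open[OF chc O'(1)] this]
    obtain w where w: "w \<in> W" "coord c x \<in> w" "w \<subseteq> coord c ` (chart_dom c \<inter> O')" .
    have "chart_dom c \<inter> coord c -` w \<subseteq> O'"
    proof
      fix y assume y: "y \<in> chart_dom c \<inter> coord c -` w"
      then have "coord c y \<in> coord c ` (chart_dom c \<inter> O')"
        using w(3) by blast
      then obtain z where z: "z \<in> chart_dom c" "z \<in> O'" "coord c y = coord c z"
        by blast
      have "y = z"
        using is_chartD(6)[OF chc] z(3) _ z(1) by (rule inj_onD) (use y in blast)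
      with z(2) show "y \<in> O'" by simp
    qed
    moreover have "chart_dom c \<inter> coord c -` w \<in> B"
      unfolding B_def by (rule image_eqI[where x="(c, w)"]) (simp_all add: c(1) w(1))
    moreover have "x \<in> chart_dom c \<inter> coord c -` w"
      using c(2) w(2) by simp
    ultimately show "\<exists>B'\<in>B. x \<in> B' \<and> B' \<subseteq> O'"
      by (intro bexI conjI)
  qed
  ultimately show thesis by (rule that)
qed

lemma Ck_on_imp_continuous_on: "Ck_on k S u \<Longrightarrow> continuous_on S u"
  by (cases k) (auto intro: differentiable_imp_continuous_on)

lemma det_pos_of_posdef:
  fixes G :: "real^2^2"
  assumes sym: "transpose G = G" and pos: "\<And>v. v \<noteq> 0 \<Longrightarrow> v \<bullet> (G *v v) > 0"
  shows "det G > 0"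
proof -
  have s: "G $ 2 $ 1 = G $ 1 $ 2"
    using arg_cong[OF sym, of "\<lambda>A. A $ 1 $ 2"] by (simp add: transpose_def)
  have q: "v \<bullet> (G *v v) = G$1$1 * (v$1)\<^sup>2 + 2 * G$1$2 * v$1 * v$2 + G$2$2 * (v$2)\<^sup>2" for v
    by (simp add: inner_vec_def matrix_vector_mult_def UNIV_2 s power2_eq_square algebra_simps)
  have "axis 1 1 \<noteq> (0 :: real^2)"
    by (simp add: axis_eq_0_iff)
  from pos[OF this] have g11: "G$1$1 > 0"
    unfolding q by (simp add: axis_def)
  define v :: "real^2" where "v = vector [- G$1$2, G$1$1]"
  have "v $ 2 \<noteq> 0" using g11 by (simp add: v_def)
  then have "v \<noteq> 0" by auto
  from pos[OF this] have "0 < G$1$1 * (G$1$1 * G$2$2 - (G$1$2)\<^sup>2)"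
    unfolding q by (simp add: v_def power2_eq_square algebra_simps)
  then have "0 < G$1$1 * G$2$2 - (G$1$2)\<^sup>2"
    using g11 by (simp add: zero_less_mult_iff)
  then show ?thesis
    by (simp add: det_2 s power2_eq_square)
qed

lemma area_density:
  assumes g: "riemannian_metric \<A> g" and c: "c \<in> \<A>"
  shows "continuous_on (coord c ` chart_dom c) (\<lambda>x. sqrt (det (g c x)))"
    "x \<in> coord c ` chart_dom c \<Longrightarrow> sqrt (det (g c x)) > 0"
proof -
  from g have "\<forall>c\<in>\<A>. \<forall>i j. Ck_on 2 (coord c ` chart_dom c) (\<lambda>x. g c x $ i $ j)"
    unfolding riemannian_metric_def by (rule conjunct1)
  with c have "continuous_on (coord c ` chart_dom c) (\<lambda>x. g c x $ i $ j)" for i j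
    by (intro Ck_on_imp_continuous_on[of 2]) blast
  then show "continuous_on (coord c ` chart_dom c) (\<lambda>x. sqrt (det (g c x)))"
    unfolding det_2 by (intro continuous_on_real_sqrt continuous_on_diff continuous_on_mult)
  assume x: "x \<in> coord c ` chart_dom c"
  from g have "\<forall>c\<in>\<A>. \<forall>x\<in>coord c ` chart_dom c.
      transpose (g c x) = g c x \<and> (\<forall>v. v \<noteq> 0 \<longrightarrow> v \<bullet> (g c x *v v) > 0)"
    unfolding riemannian_metric_def by (elim conjE)
  from this[rule_format, OF c x] have "det (g c x) > 0"
    by (intro det_pos_of_posdef) auto
  then show "sqrt (det (g c x)) > 0" by simp
qed

lemma emeasure_lborel_cball_pos: "e > 0 \<Longrightarrow> emeasure lborel (cball (y :: real^2) e) > 0"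
  using content_cball_pos[of e y] by (metis measure_def enn2real_positive_iff)

lemma riemannian_areaD:
  assumes "riemannian_area \<A> g \<mu>" "c \<in> \<A>" "B \<in> sets borel" "B \<subseteq> chart_dom c"
  shows "emeasure \<mu> B = (\<integral>\<^sup>+x\<in>coord c ` B. ennreal (sqrt (det (g c x))) \<partial>lborel)"
  using assms(1)[unfolded riemannian_area_def, THEN conjunct2, rule_format, OF assms(2-4)] .

lemma area_open_pos:
  fixes \<A> :: "'s::topological_space chart set"
  assumes \<A>: "smooth_atlas \<A>" and g: "riemannian_metric \<A> g" and \<mu>: "riemannian_area \<A> g \<mu>"
    and U: "open U" "U \<noteq> {}"
  shows "emeasure \<mu> U > 0"
proof -
  obtain x where x: "x \<in> U" using U by blast
  obtain c where c: "c \<in> \<A>" "x \<in> chart_dom c" "is_chart c"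
    using atlas_chart_exists[OF \<A>] .
  let ?S = "coord c ` (chart_dom c \<inter> U)"
  have "coord c x \<in> ?S" using c x by blast
  with open_contains_cball_eq[OF chart_image_open[OF c(3) U(1)], THEN spec]
  have "\<exists>e>0. cball (coord c x) e \<subseteq> ?S" by (rule iffD1)
  then obtain e where e: "e > 0" "cball (coord c x) e \<subseteq> ?S"
    by (elim exE conjE)
  let ?K = "cball (coord c x) e"
  have "continuous_on ?K (\<lambda>x. sqrt (det (g c x)))"
    by (rule continuous_on_subset[OF area_density(1)[OF g c(1)]]) (use e(2) in blast)
  moreover have "?K \<noteq> {}" using e by simp
  ultimately obtain z where z: "z \<in> ?K" "\<And>y. y \<in> ?K \<Longrightarrow> sqrt (det (g c z)) \<le> sqrt (det (g c y))"
    using continuous_attains_inf[OF compact_cball, of "coord c x" e "\<lambda>x. sqrt (det (g c x))"] by blast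
  have m: "sqrt (det (g c z)) > 0"
    using area_density(2)[OF g c(1)] z(1) e(2) by blast
  have B: "chart_dom c \<inter> U \<in> sets borel"
    using is_chartD(1)[OF c(3)] U(1) by simp
  have "0 < ennreal (sqrt (det (g c z))) * emeasure lborel ?K"
    using m emeasure_lborel_cball_pos[OF e(1), of "coord c x"] by (simp add: ennreal_zero_less_mult_iff)
  also have "\<dots> = (\<integral>\<^sup>+y. ennreal (sqrt (det (g c z))) * indicator ?K y \<partial>lborel)"
    by (rule nn_integral_cmult_indicator[symmetric]) simp
  also have "\<dots> \<le> (\<integral>\<^sup>+y\<in>?S. ennreal (sqrt (det (g c y))) \<partial>lborel)"
    using z(2) e(2) by (intro nn_integral_mono) (auto simp: indicator_def intro!: ennreal_leI)
  also have "\<dots> = emeasure \<mu> (chart_dom c \<inter> U)"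
    by (rule riemannian_areaD[OF \<mu> c(1) B, symmetric]) simp
  also have "\<dots> \<le> emeasure \<mu> U"
    using \<mu> U(1) unfolding riemannian_area_def by (intro emeasure_mono) auto
  finally show ?thesis .
qed

lemma area_finite:
  fixes \<A> :: "'s::topological_space chart set"
  assumes comp: "compact (UNIV :: 's set)" and \<A>: "smooth_atlas \<A>"
    and g: "riemannian_metric \<A> g" and \<mu>: "riemannian_area \<A> g \<mu>"
  shows "finite_measure \<mu>"
proof -
  have sets: "sets \<mu> = sets borel"
    using \<mu> by (simp add: riemannian_area_def)
  have "\<exists>V. open V \<and> x \<in> V \<and> emeasure \<mu> V < \<infinity>" for x
  proof -
    obtain c where c: "c \<in> \<A>" "x \<in> chart_dom c" "is_chart c"
      using atlas_chart_exists[OF \<A>] .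
    have "coord c x \<in> coord c ` chart_dom c" using c by blast
    with open_contains_cball_eq[OF is_chartD(2)[OF c(3)], THEN spec]
    have "\<exists>e>0. cball (coord c x) e \<subseteq> coord c ` chart_dom c" by (rule iffD1)
    then obtain e where e: "e > 0" "cball (coord c x) e \<subseteq> coord c ` chart_dom c"
      by (elim exE conjE)
    let ?K = "cball (coord c x) e" and ?W = "ball (coord c x) e"
    define V where "V = chart_dom c \<inter> coord c -` ?W"
    have "continuous_on ?K (\<lambda>x. sqrt (det (g c x)))"
      using area_density(1)[OF g c(1)] e(2) by (rule continuous_on_subset)
    moreover have "?K \<noteq> {}" using e by simp
    ultimately obtain z where z: "z \<in> ?K" "\<And>y. y \<in> ?K \<Longrightarrow> sqrt (det (g c y)) \<le> sqrt (det (g c z))"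
      using continuous_attains_sup[OF compact_cball, of "coord c x" e "\<lambda>x. sqrt (det (g c x))"] by blast
    have V: "open V" "x \<in> V"
      unfolding V_def using chart_preimage_open[OF c(3) open_ball] c(2) e(1) by auto
    have im: "coord c ` V = ?W"
      unfolding V_def using e(2) by (intro chart_image_preimage) (meson ball_subset_cball order_trans)
    have "emeasure \<mu> V = (\<integral>\<^sup>+y\<in>coord c ` V. ennreal (sqrt (det (g c y))) \<partial>lborel)"
      by (rule riemannian_areaD[OF \<mu> c(1) borel_open[OF V(1)]]) (simp add: V_def)
    also have "\<dots> \<le> (\<integral>\<^sup>+y. ennreal (sqrt (det (g c z))) * indicator ?K y \<partial>lborel)"
      unfolding im using z(2) by (intro nn_integral_mono) (auto simp: indicator_def intro!: ennreal_leI)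
    also have "\<dots> = ennreal (sqrt (det (g c z))) * emeasure lborel ?K"
      by (rule nn_integral_cmult_indicator) simp
    also have "\<dots> < \<infinity>"
      using emeasure_lborel_cball_finite[of "coord c x" e] by (simp add: ennreal_mult_less_top)
    finally show ?thesis using V by blast
  qed
  then have "\<exists>V. \<forall>x. open (V x) \<and> x \<in> V x \<and> emeasure \<mu> (V x) < \<infinity>"
    by (intro choice allI)
  then obtain V where V: "\<And>x. open (V x)" "\<And>x. x \<in> V x" "\<And>x. emeasure \<mu> (V x) < \<infinity>"
    by auto
  have "UNIV \<subseteq> (\<Union>x\<in>UNIV. V x)" using V(2) by blast
  from compactE_image[OF comp V(1) this]
  obtain I where I: "finite I" "UNIV \<subseteq> (\<Union>x\<in>I. V x)" .
  have "emeasure \<mu> (space \<mu>) \<le> emeasure \<mu> (\<Union>x\<in>I. V x)"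
    using I V(1) sets by (intro emeasure_mono) (auto intro!: sets.finite_UN)
  also have "\<dots> \<le> (\<Sum>x\<in>I. emeasure \<mu> (V x))"
    using I(1) V(1) sets by (intro emeasure_subadditive_finite) auto
  also have "\<dots> < \<infinity>"
    using I(1) V(3) by (induction I rule: finite_induct) (auto simp: less_top)
  finally show ?thesis
    by (intro finite_measureI) (auto simp: less_top)
qed

lemma Ck_on_const: "Ck_on k S (\<lambda>_. a)"
proof (induction k arbitrary: a)
  case (Suc k)
  have "partial i (\<lambda>_. a) = (\<lambda>_. 0)" for i
    by (simp add: partial_def fun_eq_iff)
  with Suc show ?case by simp
qed simp

lemma laplacian_const: "laplacian \<A> g (\<lambda>_. a) p = 0"
proof -
  have p: "partial i (\<lambda>_. b) = (\<lambda>_. 0)" for i b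
    by (simp add: partial_def fun_eq_iff)
  show ?thesis
    unfolding laplacian_def coord_laplacian_def Let_def comp_def by (simp add: p)
qed

section \<open>Expansions in an orthonormal basis\<close>

lemma L2_function_add:
  assumes u: "L2_function \<mu> u" and v: "L2_function \<mu> v"
  shows "L2_function \<mu> (\<lambda>x. u x + v x)"
  unfolding L2_function_def
proof
  have [measurable]: "u \<in> borel_measurable \<mu>" "v \<in> borel_measurable \<mu>"
    using u v by (auto simp: L2_function_def)
  show "(\<lambda>x. u x + v x) \<in> borel_measurable \<mu>" by measurable
  show "integrable \<mu> (\<lambda>x. (u x + v x)\<^sup>2)"
  proof (rule Bochner_Integration.integrable_bound[where f="\<lambda>x. 2 * (u x)\<^sup>2 + 2 * (v x)\<^sup>2"])
    show "integrable \<mu> (\<lambda>x. 2 * (u x)\<^sup>2 + 2 * (v x)\<^sup>2)"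
      using u v by (simp add: L2_function_def)
    have "(a + b)\<^sup>2 \<le> 2 * a\<^sup>2 + 2 * b\<^sup>2" for a b :: real
      using sum_squares_bound[of a b] by (simp add: power2_sum)
    then show "AE x in \<mu>. norm ((u x + v x)\<^sup>2) \<le> norm (2 * (u x)\<^sup>2 + 2 * (v x)\<^sup>2)"
      by simp
  qed measurable
qed

lemma L2_function_scale:
  assumes "L2_function \<mu> u"
  shows "L2_function \<mu> (\<lambda>x. a * u x)"
  using assms by (auto simp: L2_function_def power_mult_distrib)

lemma L2_function_zero: "L2_function \<mu> (\<lambda>_. 0)"
  by (simp add: L2_function_def)

lemma L2_function_sum:
  assumes "\<And>i. i \<in> I \<Longrightarrow> L2_function \<mu> (u i)"
  shows "L2_function \<mu> (\<lambda>x. \<Sum>i\<in>I. u i x)"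
  using assms
  by (induction I rule: infinite_finite_induct) (simp_all add: L2_function_zero L2_function_add)

lemma L2_function_diff:
  assumes "L2_function \<mu> u" "L2_function \<mu> v"
  shows "L2_function \<mu> (\<lambda>x. u x - v x)"
  using L2_function_add[OF assms(1) L2_function_scale[OF assms(2), of "-1"]] by simp

lemma L2_integrable_mult:
  assumes u: "L2_function \<mu> u" and v: "L2_function \<mu> v"
  shows "integrable \<mu> (\<lambda>x. u x * v x)"
proof (rule Bochner_Integration.integrable_bound[where f="\<lambda>x. (u x)\<^sup>2 + (v x)\<^sup>2"])
  show "integrable \<mu> (\<lambda>x. (u x)\<^sup>2 + (v x)\<^sup>2)"
    using u v by (simp add: L2_function_def)
  show "(\<lambda>x. u x * v x) \<in> borel_measurable \<mu>"
    using u v by (auto simp: L2_function_def)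
  have "\<bar>a * b\<bar> \<le> a\<^sup>2 + b\<^sup>2" for a b :: real
  proof -
    have "2 * (\<bar>a\<bar> * \<bar>b\<bar>) \<le> a\<^sup>2 + b\<^sup>2"
      using sum_squares_bound[of "\<bar>a\<bar>" "\<bar>b\<bar>"] by simp
    moreover have "0 \<le> \<bar>a\<bar> * \<bar>b\<bar>" by simp
    ultimately show ?thesis unfolding abs_mult by linarith
  qed
  then show "AE x in \<mu>. norm (u x * v x) \<le> norm ((u x)\<^sup>2 + (v x)\<^sup>2)"
    by simp
qed

lemma L2_Cauchy_Schwarz:
  assumes u: "L2_function \<mu> u" and v: "L2_function \<mu> v"
  shows "(LINT x|\<mu>. u x * v x)\<^sup>2 \<le> (LINT x|\<mu>. (u x)\<^sup>2) * (LINT x|\<mu>. (v x)\<^sup>2)"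
proof -
  define A B C where "A = (LINT x|\<mu>. (u x)\<^sup>2)" and "B = (LINT x|\<mu>. u x * v x)" and "C = (LINT x|\<mu>. (v x)\<^sup>2)"
  have i: "integrable \<mu> (\<lambda>x. (u x)\<^sup>2)" "integrable \<mu> (\<lambda>x. (v x)\<^sup>2)" "integrable \<mu> (\<lambda>x. u x * v x)"
    using u v L2_integrable_mult[OF u v] by (auto simp: L2_function_def)
  have q: "0 \<le> A * t\<^sup>2 - 2 * B * t + C" for t
  proof -
    have "0 \<le> (LINT x|\<mu>. (t * u x - v x)\<^sup>2)" by simp
    also have "(\<lambda>x. (t * u x - v x)\<^sup>2) = (\<lambda>x. t\<^sup>2 * (u x)\<^sup>2 - (2 * t) * (u x * v x) + (v x)\<^sup>2)"
      by (auto simp: power2_eq_square algebra_simps)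
    also have "(LINT x|\<mu>. t\<^sup>2 * (u x)\<^sup>2 - (2 * t) * (u x * v x) + (v x)\<^sup>2) = t\<^sup>2 * A - (2 * t) * B + C"
      unfolding A_def B_def C_def using i
      by (simp add: Bochner_Integration.integral_add Bochner_Integration.integral_diff)
    finally show ?thesis by (simp add: algebra_simps)
  qed
  have A: "A \<ge> 0" by (simp add: A_def)
  have "B\<^sup>2 \<le> A * C"
  proof (cases "A = 0")
    case True
    have "B = 0"
    proof (rule ccontr)
      assume "B \<noteq> 0"
      with q[of "(C + 1) / (2 * B)"] True show False by simp
    qed
    then show ?thesis using True by simp
  next
    case False
    have "A * (B / A)\<^sup>2 = B\<^sup>2 / A" "2 * B * (B / A) = 2 * (B\<^sup>2 / A)"
      using False by (simp_all add: power2_eq_square)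
    with q[of "B / A"] have "B\<^sup>2 / A \<le> C" by linarith
    then show ?thesis using A False by (simp add: pos_divide_le_eq mult.commute)
  qed
  then show ?thesis by (simp add: A_def B_def C_def)
qed

lemma tendsto_zero_of_square:
  fixes a :: "nat \<Rightarrow> real"
  assumes "(\<lambda>n. (a n)\<^sup>2) \<longlonglongrightarrow> 0"
  shows "a \<longlonglongrightarrow> 0"
  using tendsto_real_sqrt[OF assms] by (simp add: tendsto_rabs_zero_iff)

lemma L2_inner_tendsto_zero:
  assumes u: "L2_function \<mu> u" and e: "\<And>n. L2_function \<mu> (e n)"
    and lim: "(\<lambda>n. LINT x|\<mu>. (e n x)\<^sup>2) \<longlonglongrightarrow> 0"
  shows "(\<lambda>n. LINT x|\<mu>. u x * e n x) \<longlonglongrightarrow> 0"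
proof -
  have "(\<lambda>n. (LINT x|\<mu>. (u x)\<^sup>2) * (LINT x|\<mu>. (e n x)\<^sup>2)) \<longlonglongrightarrow> (LINT x|\<mu>. (u x)\<^sup>2) * 0"
    by (intro tendsto_mult tendsto_const lim)
  then have bound: "(\<lambda>n. (LINT x|\<mu>. (u x)\<^sup>2) * (LINT x|\<mu>. (e n x)\<^sup>2)) \<longlonglongrightarrow> 0"
    by (simp only: mult_zero_right)
  have "(\<lambda>n. (LINT x|\<mu>. u x * e n x)\<^sup>2) \<longlonglongrightarrow> 0"
    by (rule tendsto_sandwich[OF always_eventually always_eventually tendsto_const bound])
      (auto intro: L2_Cauchy_Schwarz[OF u e])
  then show ?thesis
    by (rule tendsto_zero_of_square)
qed

locale orthonormal_basis =
  fixes \<mu> :: "'s measure" and \<phi> :: "nat \<Rightarrow> 's \<Rightarrow> real"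
  assumes basis: "orthonormal_basis_L2 \<mu> \<phi>"
begin

lemma basis_L2: "L2_function \<mu> (\<phi> j)"
  using basis by (simp add: orthonormal_basis_L2_def)

lemma orthonormal: "(LINT x|\<mu>. \<phi> i x * \<phi> j x) = (if i = j then 1 else 0)"
  using basis by (simp add: orthonormal_basis_L2_def)

definition remainder :: "('s \<Rightarrow> real) \<Rightarrow> nat \<Rightarrow> 's \<Rightarrow> real" where
  "remainder u n x = u x - (\<Sum>j<n. (LINT y|\<mu>. u y * \<phi> j y) * \<phi> j x)"

lemma remainder_L2: "L2_function \<mu> u \<Longrightarrow> L2_function \<mu> (remainder u n)"
  unfolding remainder_def by (intro L2_function_diff L2_function_sum L2_function_scale basis_L2)

lemma remainder_tendsto:
  assumes "L2_function \<mu> u"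
  shows "(\<lambda>n. LINT x|\<mu>. (remainder u n x)\<^sup>2) \<longlonglongrightarrow> 0"
  using basis assms unfolding orthonormal_basis_L2_def remainder_def by blast

lemma remainder_inner:
  assumes u: "L2_function \<mu> u" and v: "L2_function \<mu> v"
  shows "(LINT x|\<mu>. v x * remainder u n x)
    = (LINT x|\<mu>. v x * u x) - (\<Sum>j<n. (LINT y|\<mu>. u y * \<phi> j y) * (LINT x|\<mu>. v x * \<phi> j x))"
proof -
  have "(\<lambda>x. v x * remainder u n x) = (\<lambda>x. v x * u x - (\<Sum>j<n. (LINT y|\<mu>. u y * \<phi> j y) * (v x * \<phi> j x)))"
    by (auto simp: remainder_def right_diff_distrib sum_distrib_left algebra_simps)
  then show ?thesis
    using L2_integrable_mult[OF v u] L2_integrable_mult[OF v basis_L2]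
    by (simp add: Bochner_Integration.integral_diff Bochner_Integration.integral_sum)
qed

lemma parseval:
  assumes u: "L2_function \<mu> u" and v: "L2_function \<mu> v"
  shows "(\<lambda>n. \<Sum>j<n. (LINT y|\<mu>. u y * \<phi> j y) * (LINT x|\<mu>. v x * \<phi> j x)) \<longlonglongrightarrow> (LINT x|\<mu>. v x * u x)"
proof -
  have "(\<lambda>n. LINT x|\<mu>. v x * remainder u n x) \<longlonglongrightarrow> 0"
    by (rule L2_inner_tendsto_zero[OF v remainder_L2[OF u] remainder_tendsto[OF u]])
  then have "(\<lambda>n. (LINT x|\<mu>. v x * u x) - (LINT x|\<mu>. v x * remainder u n x)) \<longlonglongrightarrow> (LINT x|\<mu>. v x * u x) - 0"
    by (intro tendsto_diff tendsto_const)
  then show ?thesis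
    by (simp add: remainder_inner[OF u v])
qed

lemma coefficients_tendsto_zero:
  assumes u: "L2_function \<mu> u"
  shows "(\<lambda>n. LINT x|\<mu>. u x * \<phi> n x) \<longlonglongrightarrow> 0"
proof -
  have eq: "(LINT x|\<mu>. \<phi> n x * remainder u n x) = (LINT x|\<mu>. u x * \<phi> n x)" for n
    unfolding remainder_inner[OF u basis_L2]
    by (simp add: orthonormal mult.commute)
  have "(LINT x|\<mu>. u x * \<phi> n x)\<^sup>2 \<le> (LINT x|\<mu>. (remainder u n x)\<^sup>2)" for n
    using L2_Cauchy_Schwarz[OF basis_L2[of n] remainder_L2[OF u, of n]] orthonormal[of n n]
    by (simp add: eq power2_eq_square)
  then have "(\<lambda>n. (LINT x|\<mu>. u x * \<phi> n x)\<^sup>2) \<longlonglongrightarrow> 0"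
    by (intro tendsto_sandwich[OF _ _ tendsto_const remainder_tendsto[OF u]] always_eventually allI) auto
  then show ?thesis
    by (rule tendsto_zero_of_square)
qed

lemma orthogonal_imp_first:
  assumes u: "L2_function \<mu> u" and orth: "\<And>k. k \<ge> 1 \<Longrightarrow> (LINT x|\<mu>. u x * \<phi> k x) = 0"
  shows "(LINT x|\<mu>. (u x - (LINT x|\<mu>. u x * \<phi> 0 x) * \<phi> 0 x)\<^sup>2) = 0"
proof -
  have "remainder u (Suc n) x = u x - (LINT x|\<mu>. u x * \<phi> 0 x) * \<phi> 0 x" for n x
    unfolding remainder_def sum.lessThan_Suc_shift using orth by simp
  then have "(\<lambda>n. LINT x|\<mu>. (u x - (LINT x|\<mu>. u x * \<phi> 0 x) * \<phi> 0 x)\<^sup>2) \<longlonglongrightarrow> 0"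
    using LIMSEQ_Suc[OF remainder_tendsto[OF u]] by simp
  then show ?thesis
    by (simp add: LIMSEQ_const_iff)
qed

end

section \<open>The conformal factor and its Laplacian as Gaussian fields\<close>

lemma gauss_linear_coeff_prob:
  assumes G: "gauss_linear G b" and b: "b k \<noteq> 0"
  shows "gauss_seq.prob {x. \<bar>G x\<bar> > \<bar>b k\<bar> / 2} \<ge> 1 / 8"
proof -
  note [measurable] = gauss_linear_measurable[OF G]
  let ?A = "{x \<in> space gauss_seq. \<bar>G x\<bar> > \<bar>b k\<bar> / 2}"
  let ?A' = "{x \<in> space gauss_seq. \<bar>G (flip k x)\<bar> > \<bar>b k\<bar> / 2}"
  let ?B = "{x \<in> space gauss_seq. \<bar>x k\<bar> > 1 / 2}"
  have "gauss_seq.prob ?B = measure (distr gauss_seq borel (\<lambda>x. x k)) {y. \<bar>y\<bar> > 1 / 2}"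
    by (subst measure_distr) (auto simp: vimage_def)
  then have B: "gauss_seq.prob ?B > 1 / 4"
    using std_normal_half by (simp only: distr_gauss_seq_component)
  have "?A' = flip k -` ?A \<inter> space gauss_seq"
    by auto
  then have "gauss_seq.prob ?A' = measure (distr gauss_seq gauss_seq (flip k)) ?A"
    by (simp only:) (rule measure_distr[symmetric], measurable)
  then have A': "gauss_seq.prob ?A' = gauss_seq.prob ?A"
    by (simp only: distr_flip)
  have "AE x in gauss_seq. G (flip k x) = G x - 2 * b k * x k"
    using G unfolding gauss_linear_def by blast
  then have "AE x in gauss_seq. x \<in> ?B \<longrightarrow> x \<in> ?A \<union> ?A'"
  proof eventually_elim
    case (elim x)
    show ?case
    proof
      assume "x \<in> ?B"
      then have "\<bar>b k\<bar> * (1 / 2) < \<bar>b k\<bar> * \<bar>x k\<bar>"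
        using b by (intro mult_strict_left_mono) auto
      moreover have "\<bar>b k\<bar> * \<bar>x k\<bar> = \<bar>b k * x k\<bar>" by (simp add: abs_mult)
      moreover have "2 * (b k * x k) = G x - G (flip k x)" using elim by simp
      ultimately show "x \<in> ?A \<union> ?A'" by auto
    qed
  qed
  then have "gauss_seq.prob ?B \<le> gauss_seq.prob (?A \<union> ?A')"
    by (intro gauss_seq.finite_measure_mono_AE) measurable
  also have "\<dots> \<le> gauss_seq.prob ?A + gauss_seq.prob ?A'"
    by (rule measure_Un_le) measurable
  finally show ?thesis
    using B A' by simp
qed

locale laplace_field =
  gauss_sequence M X + discretization r + area: finite_measure \<mu> + orthonormal_basis \<mu> \<phi>
  for M :: "'w measure" and X and r :: "nat \<Rightarrow> 's::topological_space \<Rightarrow> 's"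
    and \<mu> :: "'s measure" and \<phi> :: "nat \<Rightarrow> 's \<Rightarrow> real" +
  fixes lam c :: "nat \<Rightarrow> real" and f h :: "'w \<Rightarrow> 's \<Rightarrow> real"
  assumes sets_area: "sets \<mu> = sets borel"
    and area_pos: "open U \<Longrightarrow> U \<noteq> {} \<Longrightarrow> emeasure \<mu> U > 0"
    and neighbourhoods: "\<exists>V. (\<forall>n. open (V n)) \<and> (\<forall>n. x \<in> V n) \<and>
       (\<forall>(g :: 's \<Rightarrow> real) e. continuous_on UNIV g \<longrightarrow> e > 0
         \<longrightarrow> eventually (\<lambda>n. \<forall>y\<in>V n. \<bar>g y - g x\<bar> < e) sequentially)"
    and basis_continuous: "continuous_on UNIV (\<phi> j)"
    and f_measurable: "(\<lambda>\<omega>. f \<omega> x) \<in> borel_measurable M"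
    and h_measurable: "(\<lambda>\<omega>. h \<omega> x) \<in> borel_measurable M"
    and f_continuous: "AE \<omega> in M. continuous_on UNIV (f \<omega>)"
    and h_continuous: "AE \<omega> in M. continuous_on UNIV (h \<omega>)"
    and f_expansion: "AE \<omega> in M. (\<lambda>j. X \<omega> j * c (Suc j) * \<phi> (Suc j) x) sums (- f \<omega> x)"
    and h_coefficients: "AE \<omega> in M. \<forall>j. (LINT x|\<mu>. h \<omega> x * \<phi> j x) = - lam j * (LINT x|\<mu>. f \<omega> x * \<phi> j x)"
    and h_mean: "AE \<omega> in M. (LINT x|\<mu>. h \<omega> x) = 0"
begin

lemma continuous_measurable:
  assumes "continuous_on UNIV (g :: 's \<Rightarrow> real)"
  shows "g \<in> borel_measurable \<mu>"
  using borel_measurable_continuous_onI[OF assms] by (simp add: measurable_cong_sets[OF sets_area refl])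

lemma continuous_integrable:
  assumes "continuous_on UNIV (g :: 's \<Rightarrow> real)"
  shows "integrable \<mu> g"
proof -
  obtain K where "\<And>x. \<bar>g x\<bar> \<le> K"
    using bounded_of_continuous[OF assms] by blast
  then show ?thesis
    using continuous_measurable[OF assms] by (intro area.integrable_const_bound[where B=K]) auto
qed

lemma continuous_L2:
  assumes "continuous_on UNIV (g :: 's \<Rightarrow> real)"
  shows "L2_function \<mu> g"
  unfolding L2_function_def
  using continuous_measurable[OF assms] continuous_integrable[OF continuous_on_power[OF assms, of 2]] by blast

lemma indicator_integrable:
  assumes "B \<in> sets borel"
  shows "integrable \<mu> (indicat_real B)"
  using assms sets_area by (intro area.integrable_const_bound[where B=1]) (auto simp: indicator_def)

lemma indicator_L2:
  assumes "B \<in> sets borel"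
  shows "L2_function \<mu> (indicat_real B)"
proof -
  have "(\<lambda>x. (indicat_real B x)\<^sup>2) = indicat_real B"
    by (auto simp: indicator_def)
  then show ?thesis
    using assms sets_area indicator_integrable[OF assms]
    by (simp add: L2_function_def)
qed

lemma continuous_zero_of_integral_square:
  assumes g: "continuous_on UNIV (g :: 's \<Rightarrow> real)" and z: "(LINT x|\<mu>. (g x)\<^sup>2) = 0"
  shows "g x = 0"
proof (rule ccontr)
  assume "g x \<noteq> 0"
  define U where "U = {y. g y \<noteq> 0}"
  have U: "open U" "U \<noteq> {}"
    unfolding U_def using g \<open>g x \<noteq> 0\<close> by (auto intro!: open_Collect_neq)
  have "integrable \<mu> (\<lambda>x. (g x)\<^sup>2)"
    by (intro continuous_integrable continuous_on_power g)
  then have "AE y in \<mu>. (g y)\<^sup>2 = 0"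
    using z by (subst (asm) integral_nonneg_eq_0_iff_AE) auto
  then have "AE y in \<mu>. y \<notin> U"
    by (simp add: U_def)
  moreover have "U \<in> sets \<mu>"
    using U(1) sets_area by simp
  ultimately have "emeasure \<mu> U = 0"
    by (subst (asm) AE_iff_measurable[OF _ refl]) (auto simp: sets_area sets_eq_imp_space_eq[OF sets_area])
  then show False
    using area_pos[OF U] by simp
qed

lemma riemann_sums:
  fixes g v :: "'s \<Rightarrow> real"
  assumes g: "continuous_on UNIV g" and v: "continuous_on UNIV v"
  shows "(\<lambda>n. \<Sum>p\<in>range (r n). g p * (LINT x|\<mu>. indicat_real {x. r n x = p} x * v x)) \<longlonglongrightarrow> (LINT x|\<mu>. g x * v x)"
proof -
  note [measurable] = continuous_measurable[OF g] continuous_measurable[OF v]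
  have ind: "L2_function \<mu> (indicat_real {x. r n x = p})" for n p
    by (rule indicator_L2[OF sets_fibre])
  have int: "integrable \<mu> (\<lambda>x. g p * (indicat_real {x. r n x = p} x * v x))" for n p
    using L2_integrable_mult[OF ind continuous_L2[OF v]] by (rule integrable_mult_right)
  have pt: "g (r n x) * v x = (\<Sum>p\<in>range (r n). g p * (indicat_real {x. r n x = p} x * v x))" for n x
  proof -
    have "(\<Sum>p\<in>range (r n). g p * (indicat_real {x. r n x = p} x * v x)) = (\<Sum>p\<in>{r n x}. g p * (indicat_real {x. r n x = p} x * v x))"
      using finite_range by (intro sum.mono_neutral_right) (auto simp: indicator_def)
    then show ?thesis by simp
  qed
  have meas: "(\<lambda>x. g (r n x) * v x) \<in> borel_measurable \<mu>" for n
    unfolding pt using int by (intro borel_measurable_sum borel_measurable_integrable)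
  obtain K where K: "\<And>x. \<bar>g x\<bar> \<le> K" using bounded_of_continuous[OF g] by blast
  obtain L where L: "\<And>x. \<bar>v x\<bar> \<le> L" using bounded_of_continuous[OF v] by blast
  have "(\<lambda>n. LINT x|\<mu>. g (r n x) * v x) \<longlonglongrightarrow> (LINT x|\<mu>. g x * v x)"
  proof (rule integral_dominated_convergence[where w="\<lambda>_. K * L"])
    show "AE x in \<mu>. (\<lambda>n. g (r n x) * v x) \<longlonglongrightarrow> g x * v x"
      by (intro AE_I2 tendsto_mult tendsto_const pointwise[OF g])
    have "\<bar>g y * v x\<bar> \<le> K * L" for x y
      unfolding abs_mult using K[of y] L[of x] abs_ge_zero[of "g y"] by (intro mult_mono) linarith+
    then show "AE x in \<mu>. norm (g (r n x) * v x) \<le> K * L" for n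
      by simp
  qed (use meas in simp_all)
  moreover have "(LINT x|\<mu>. g (r n x) * v x) = (\<Sum>p\<in>range (r n). g p * (LINT x|\<mu>. indicat_real {x. r n x = p} x * v x))" for n
    unfolding pt using int by (simp add: Bochner_Integration.integral_sum)
  ultimately show ?thesis by simp
qed

lemma integral_glin:
  fixes Z :: "'w \<Rightarrow> 's \<Rightarrow> real"
  assumes Z: "\<And>x. glin (\<lambda>\<omega>. Z \<omega> x) (\<beta> x)" "AE \<omega> in M. continuous_on UNIV (Z \<omega>)"
    and \<beta>: "\<And>k. continuous_on UNIV (\<lambda>x. \<beta> x k)" and v: "continuous_on UNIV v"
  shows "glin (\<lambda>\<omega>. LINT x|\<mu>. Z \<omega> x * v x) (\<lambda>k. LINT x|\<mu>. \<beta> x k * v x)"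
proof -
  define A where "A n p = (LINT x|\<mu>. indicat_real {x. r n x = p} x * v x)" for n p
  have "glin (\<lambda>\<omega>. \<Sum>p\<in>range (r n). A n p * Z \<omega> p) (\<lambda>k. \<Sum>p\<in>range (r n). A n p * \<beta> p k)" for n
    by (intro glin_sum glin_scale Z(1))
  then have sums: "glin (\<lambda>\<omega>. \<Sum>p\<in>range (r n). Z \<omega> p * A n p) (\<lambda>k. \<Sum>p\<in>range (r n). \<beta> p k * A n p)" for n
    by (simp add: mult.commute)
  have "AE \<omega> in M. (\<lambda>n. \<Sum>p\<in>range (r n). Z \<omega> p * A n p) \<longlonglongrightarrow> (LINT x|\<mu>. Z \<omega> x * v x)"
    using Z(2) unfolding A_def by eventually_elim (rule riemann_sums[OF _ v])
  from glin_limit[OF sums this] obtain d where d: "glin (\<lambda>\<omega>. LINT x|\<mu>. Z \<omega> x * v x) d"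
    "\<And>k. (\<lambda>n. \<Sum>p\<in>range (r n). \<beta> p k * A n p) \<longlonglongrightarrow> d k" by blast
  have "d k = (LINT x|\<mu>. \<beta> x k * v x)" for k
    using LIMSEQ_unique[OF d(2) riemann_sums[OF \<beta> v, folded A_def]] .
  then have "d = (\<lambda>k. LINT x|\<mu>. \<beta> x k * v x)" by blast
  with d(1) show ?thesis by simp
qed

lemma f_glin: "glin (\<lambda>\<omega>. f \<omega> x) (\<lambda>k. - (c (Suc k) * \<phi> (Suc k) x))"
proof -
  define a where "a j = - (c (Suc j) * \<phi> (Suc j) x)" for j
  have sums: "glin (\<lambda>\<omega>. \<Sum>j<n. a j * X \<omega> j) (\<lambda>k. \<Sum>j<n. a j * (if k = j then 1 else 0))" for n
    by (intro glin_sum glin_scale glin_component)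
  have "AE \<omega> in M. (\<lambda>n. \<Sum>j<n. a j * X \<omega> j) \<longlonglongrightarrow> f \<omega> x"
    using f_expansion[of x]
  proof eventually_elim
    case (elim \<omega>)
    from tendsto_minus[OF elim[unfolded sums_def]] show ?case
      by (simp add: a_def sum_negf[symmetric] mult_ac)
  qed
  from glin_limit[OF sums this] obtain d where d: "glin (\<lambda>\<omega>. f \<omega> x) d"
    "\<And>k. (\<lambda>n. \<Sum>j<n. a j * (if k = j then 1 else 0)) \<longlonglongrightarrow> d k" by blast
  have "d k = a k" for k
  proof -
    have "(\<Sum>j<n. a j * (if k = j then 1 else 0)) = a k" if "n > k" for n
      using that by (simp add: if_distrib[where f="\<lambda>y. a _ * y"] sum.delta cong: if_cong)
    then have "eventually (\<lambda>n. (\<Sum>j<n. a j * (if k = j then 1 else 0)) = a k) sequentially"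
      using eventually_gt_at_top[of k] by (rule eventually_mono[rotated])
    then have "(\<lambda>n. \<Sum>j<n. a j * (if k = j then 1 else 0)) \<longlonglongrightarrow> a k"
      by (rule tendsto_eventually)
    with d(2) show ?thesis by (rule LIMSEQ_unique)
  qed
  then have "d = (\<lambda>k. - (c (Suc k) * \<phi> (Suc k) x))"
    by (auto simp: a_def)
  with d(1) show ?thesis by simp
qed

lemma f_integral_glin:
  assumes "continuous_on UNIV v"
  shows "glin (\<lambda>\<omega>. LINT x|\<mu>. f \<omega> x * v x) (\<lambda>k. - (c (Suc k) * (LINT x|\<mu>. v x * \<phi> (Suc k) x)))"
proof -
  have "glin (\<lambda>\<omega>. LINT x|\<mu>. f \<omega> x * v x) (\<lambda>k. LINT x|\<mu>. - (c (Suc k) * \<phi> (Suc k) x) * v x)"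
    by (rule integral_glin[OF f_glin f_continuous _ assms]) (intro continuous_intros basis_continuous)
  moreover have "(LINT x|\<mu>. - (c (Suc k) * \<phi> (Suc k) x) * v x) = - (c (Suc k) * (LINT x|\<mu>. v x * \<phi> (Suc k) x))" for k
  proof -
    have "(\<lambda>x. - (c (Suc k) * \<phi> (Suc k) x) * v x) = (\<lambda>x. - c (Suc k) * (v x * \<phi> (Suc k) x))"
      by (auto simp: mult_ac)
    then show ?thesis by simp
  qed
  ultimately show ?thesis by simp
qed

lemma h_average_glin:
  assumes B: "B \<in> sets borel"
  shows "\<exists>d. glin (\<lambda>\<omega>. LINT x|\<mu>. h \<omega> x * indicat_real B x) d"
proof -
  define a where "a j = (LINT x|\<mu>. indicat_real B x * \<phi> j x) * - lam j" for j
  have "\<exists>b. \<forall>j. glin (\<lambda>\<omega>. LINT x|\<mu>. f \<omega> x * \<phi> j x) (b j)"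
    using f_integral_glin[OF basis_continuous] by (intro choice) blast
  then obtain b where b: "\<And>j. glin (\<lambda>\<omega>. LINT x|\<mu>. f \<omega> x * \<phi> j x) (b j)" by blast
  have sums: "glin (\<lambda>\<omega>. \<Sum>j<n. a j * (LINT x|\<mu>. f \<omega> x * \<phi> j x)) (\<lambda>k. \<Sum>j<n. a j * b j k)" for n
    by (intro glin_sum glin_scale b)
  have "AE \<omega> in M. (\<lambda>n. \<Sum>j<n. a j * (LINT x|\<mu>. f \<omega> x * \<phi> j x)) \<longlonglongrightarrow> (LINT x|\<mu>. h \<omega> x * indicat_real B x)"
    using h_continuous h_coefficients
  proof eventually_elim
    case (elim \<omega>)
    from parseval[OF indicator_L2[OF B] continuous_L2[OF elim(1)]]
    show ?case
      by (simp add: a_def elim(2) mult.assoc)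
  qed
  from glin_limit[OF sums this] show ?thesis by blast
qed

lemma h_glin: "\<exists>d. glin (\<lambda>\<omega>. h \<omega> x) d"
proof -
  obtain V where V: "\<And>n. open (V n)" "\<And>n. x \<in> V n"
    "\<And>(g :: 's \<Rightarrow> real) e. continuous_on UNIV g \<Longrightarrow> e > 0
         \<Longrightarrow> eventually (\<lambda>n. \<forall>y\<in>V n. \<bar>g y - g x\<bar> < e) sequentially"
    using neighbourhoods[of x] by blast
  have m: "measure \<mu> (V n) > 0" for n
  proof -
    have "emeasure \<mu> (V n) > 0" using V(1,2)[of n] by (intro area_pos) auto
    then show ?thesis by (simp add: area.emeasure_eq_measure)
  qed
  have "\<exists>d. \<forall>n. glin (\<lambda>\<omega>. LINT x|\<mu>. h \<omega> x * indicat_real (V n) x) (d n)"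
    using h_average_glin[OF borel_open[OF V(1)]] by (intro choice) blast
  then obtain d where d: "\<And>n. glin (\<lambda>\<omega>. LINT x|\<mu>. h \<omega> x * indicat_real (V n) x) (d n)" by blast
  have sums: "glin (\<lambda>\<omega>. 1 / measure \<mu> (V n) * (LINT x|\<mu>. h \<omega> x * indicat_real (V n) x)) (\<lambda>k. 1 / measure \<mu> (V n) * d n k)" for n
    by (intro glin_scale d)
  have "AE \<omega> in M. (\<lambda>n. 1 / measure \<mu> (V n) * (LINT x|\<mu>. h \<omega> x * indicat_real (V n) x)) \<longlonglongrightarrow> h \<omega> x"
    using h_continuous
  proof eventually_elim
    case (elim \<omega>)
    have VL2: "L2_function \<mu> (indicat_real (V n))" for n
      by (rule indicator_L2[OF borel_open[OF V(1)]])
    show ?case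
    proof (rule LIMSEQ_I)
      fix e :: real assume e: "e > 0"
      have "eventually (\<lambda>n. \<forall>y\<in>V n. \<bar>h \<omega> y - h \<omega> x\<bar> < e / 2) sequentially"
        using V(3)[OF elim, of "e / 2"] e by simp
      then obtain N where N: "\<And>n y. n \<ge> N \<Longrightarrow> y \<in> V n \<Longrightarrow> \<bar>h \<omega> y - h \<omega> x\<bar> < e / 2"
        unfolding eventually_sequentially by blast
      have "norm (1 / measure \<mu> (V n) * (LINT x|\<mu>. h \<omega> x * indicat_real (V n) x) - h \<omega> x) < e" if n: "n \<ge> N" for n
      proof -
        let ?m = "measure \<mu> (V n)"
        have int: "integrable \<mu> (\<lambda>y. h \<omega> y * indicat_real (V n) y)"
          by (rule L2_integrable_mult[OF continuous_L2[OF elim] VL2])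
        have intV: "integrable \<mu> (indicat_real (V n))"
          by (rule indicator_integrable[OF borel_open[OF V(1)]])
        have lint: "(LINT y|\<mu>. indicat_real (V n) y) = ?m"
          using sets_area V(1)[of n] by (simp add: sets_eq_imp_space_eq[OF sets_area])
        have "(LINT y|\<mu>. (h \<omega> y - h \<omega> x) * indicat_real (V n) y) = (LINT y|\<mu>. h \<omega> y * indicat_real (V n) y) - h \<omega> x * ?m"
          unfolding left_diff_distrib using int intV lint
          by (simp add: Bochner_Integration.integral_diff)
        moreover have "\<bar>LINT y|\<mu>. (h \<omega> y - h \<omega> x) * indicat_real (V n) y\<bar> \<le> (LINT y|\<mu>. e / 2 * indicat_real (V n) y)"
        proof -
          have "\<bar>LINT y|\<mu>. (h \<omega> y - h \<omega> x) * indicat_real (V n) y\<bar> \<le> (LINT y|\<mu>. \<bar>(h \<omega> y - h \<omega> x) * indicat_real (V n) y\<bar>)"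
            by (rule integral_abs_bound)
          also have "\<dots> \<le> (LINT y|\<mu>. e / 2 * indicat_real (V n) y)"
          proof (rule integral_mono)
            show "integrable \<mu> (\<lambda>y. \<bar>(h \<omega> y - h \<omega> x) * indicat_real (V n) y\<bar>)"
              unfolding left_diff_distrib using int intV by (intro integrable_abs Bochner_Integration.integrable_diff integrable_mult_right)
            show "integrable \<mu> (\<lambda>y. e / 2 * indicat_real (V n) y)"
              using intV by (rule integrable_mult_right)
            fix y
            show "\<bar>(h \<omega> y - h \<omega> x) * indicat_real (V n) y\<bar> \<le> e / 2 * indicat_real (V n) y"
              using N[OF n, of y] by (cases "y \<in> V n") (auto intro: less_imp_le)
          qed
          finally show ?thesis .
        qed
        ultimately have "\<bar>(LINT y|\<mu>. h \<omega> y * indicat_real (V n) y) - h \<omega> x * ?m\<bar> \<le> e / 2 * ?m"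
          using lint by simp
        moreover have "1 / ?m * (LINT y|\<mu>. h \<omega> y * indicat_real (V n) y) - h \<omega> x
            = ((LINT y|\<mu>. h \<omega> y * indicat_real (V n) y) - h \<omega> x * ?m) / ?m"
          using m[of n] by (simp add: diff_divide_distrib)
        ultimately have "\<bar>1 / ?m * (LINT y|\<mu>. h \<omega> y * indicat_real (V n) y) - h \<omega> x\<bar> \<le> e / 2"
          using m[of n] by (simp add: abs_divide pos_divide_le_eq)
        then show ?thesis using e by simp
      qed
      then show "\<exists>N. \<forall>n\<ge>N. norm (1 / measure \<mu> (V n) * (LINT x|\<mu>. h \<omega> x * indicat_real (V n) x) - h \<omega> x) < e"
        by blast
    qed
  qed
  from glin_limit[OF sums this] show ?thesis by blast
qed

end

context laplace_field
begin

lemma f_integral_zero_imp: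
  assumes c_pos: "\<And>j. j \<ge> 1 \<Longrightarrow> c j > 0" and v: "continuous_on UNIV v"
    and zero: "AE \<omega> in M. (LINT x|\<mu>. f \<omega> x * v x) = 0"
  shows "v x = (LINT x|\<mu>. v x * \<phi> 0 x) * \<phi> 0 x"
proof -
  have orth: "(LINT x|\<mu>. v x * \<phi> k x) = 0" if "k \<ge> 1" for k
  proof -
    obtain i where i: "k = Suc i" using \<open>k \<ge> 1\<close> by (cases k) auto
    have "- (c (Suc i) * (LINT x|\<mu>. v x * \<phi> (Suc i) x)) = 0"
      by (rule glin_zero_coeff[OF f_integral_glin[OF v] zero])
    then show ?thesis using c_pos[OF that] by (simp add: i)
  qed
  have "v x - (LINT x|\<mu>. v x * \<phi> 0 x) * \<phi> 0 x = 0"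
    by (rule continuous_zero_of_integral_square[OF _ orthogonal_imp_first[OF continuous_L2[OF v] orth]])
       (intro continuous_intros v basis_continuous)
  then show ?thesis by simp
qed

text \<open>If all the \<open>c j\<close> were equal, \<open>f\<close> would be a multiple of white noise, which is not a
  square integrable function.\<close>
lemma coefficients_not_constant:
  assumes "\<gamma> > 0" "\<And>j. j \<ge> 1 \<Longrightarrow> c j = \<gamma>"
  shows False
proof -
  let ?b = "\<lambda>n k. - (c (Suc k) * (LINT x|\<mu>. \<phi> n x * \<phi> (Suc k) x))"
  have "\<exists>G. gauss_linear G (?b n) \<and> (AE \<omega> in M. (LINT x|\<mu>. f \<omega> x * \<phi> n x) = G (X \<omega>))" for n
    using f_integral_glin[OF basis_continuous] unfolding glin_def .
  then have "\<exists>G. \<forall>n. gauss_linear (G n) (?b n) \<and> (AE \<omega> in M. (LINT x|\<mu>. f \<omega> x * \<phi> n x) = G n (X \<omega>))"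
    by (intro choice allI)
  then obtain G where G: "\<And>n. gauss_linear (G n) (?b n)"
    "\<And>n. AE \<omega> in M. (LINT x|\<mu>. f \<omega> x * \<phi> n x) = G n (X \<omega>)"
    by auto
  note [measurable] = gauss_linear_measurable[OF G(1)]
  have "AE \<omega> in M. \<forall>n. (LINT x|\<mu>. f \<omega> x * \<phi> n x) = G n (X \<omega>)"
    unfolding AE_all_countable using G(2) by blast
  with f_continuous have lim: "AE \<omega> in M. (\<lambda>n. G n (X \<omega>)) \<longlonglongrightarrow> 0"
  proof eventually_elim
    case (elim \<omega>)
    then show ?case
      using coefficients_tendsto_zero[OF continuous_L2[OF elim(1)]] by simp
  qed
  let ?A = "\<lambda>n. {\<omega> \<in> space M. \<bar>G n (X \<omega>)\<bar> > \<gamma> / 2}"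
  have "(\<lambda>n. prob (?A n)) \<longlonglongrightarrow> 0"
  proof (rule prob_tendsto_zero)
    show "AE \<omega> in M. eventually (\<lambda>n. \<omega> \<notin> ?A n) sequentially"
      using lim
    proof eventually_elim
      case (elim \<omega>)
      have "eventually (\<lambda>n. dist (G n (X \<omega>)) 0 < \<gamma> / 2) sequentially"
        using elim assms(1) by (intro tendstoD) auto
      then show ?case
        by eventually_elim (auto simp: dist_real_def)
    qed
  qed measurable
  then have "eventually (\<lambda>n. prob (?A n) < 1 / 8) sequentially"
    by (rule order_tendstoD) simp
  then have "eventually (\<lambda>n. prob (?A n) < 1 / 8 \<and> n \<ge> 1) sequentially"
    using eventually_ge_at_top[of 1] by eventually_elim simp
  then obtain n where n: "prob (?A n) < 1 / 8" "n \<ge> 1"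
    using eventually_happens' sequentially_bot by blast
  then obtain i where i: "n = Suc i" by (cases n) auto
  have b: "?b n i = - \<gamma>"
    using assms(2)[of n] n(2) by (simp add: i orthonormal)
  have "glin (\<lambda>\<omega>. G n (X \<omega>)) (?b n)"
    unfolding glin_def using G(1)[of n] by (intro exI[of _ "G n"]) auto
  then have "prob (?A n) = gauss_seq.prob {x. \<bar>G n x\<bar> > \<gamma> / 2}"
    by (rule glin_prob_eq[OF _ _ G(1)[of n]]) auto
  moreover have "gauss_seq.prob {x. \<bar>G n x\<bar> > \<bar>?b n i\<bar> / 2} \<ge> 1 / 8"
    by (rule gauss_linear_coeff_prob[OF G(1)]) (use b assms(1) in simp)
  ultimately show False
    using n(1) assms(1) unfolding b by simp
qed

lemma nondegenerate:
  assumes R: "continuous_on UNIV R" and lam_pos: "\<And>j. j \<ge> 1 \<Longrightarrow> lam j > 0"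
    and c_eq: "\<And>j. j \<ge> 1 \<Longrightarrow> c j = F (lam j)" and c_pos: "\<And>j. j \<ge> 1 \<Longrightarrow> c j > 0"
    and zero: "\<And>x. AE \<omega> in M. h \<omega> x + R x * f \<omega> x = 0"
  shows False
proof -
  have "AE \<omega> in M. \<forall>q\<in>net. h \<omega> q + R q * f \<omega> q = 0"
    by (subst AE_ball_countable[OF countable_net]) (use zero in blast)
  with f_continuous h_continuous
  have hf: "AE \<omega> in M. continuous_on UNIV (f \<omega>) \<and> continuous_on UNIV (h \<omega>) \<and> (\<forall>x. h \<omega> x = - (R x * f \<omega> x))"
  proof eventually_elim
    case (elim \<omega>)
    have g: "continuous_on UNIV (\<lambda>x. h \<omega> x + R x * f \<omega> x)"
      using elim(1,2) R by (intro continuous_intros)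
    have "\<not> (\<exists>q\<in>net. \<bar>h \<omega> q + R q * f \<omega> q\<bar> > 0)"
      using elim(3) by simp
    then have "\<not> (\<exists>x. \<bar>h \<omega> x + R x * f \<omega> x\<bar> > 0)"
      unfolding exceed_net_iff[OF g] .
    then have "h \<omega> x = - (R x * f \<omega> x)" for x
      by (simp add: eq_neg_iff_add_eq_0)
    with elim show ?case by blast
  qed
  have int: "integrable \<mu> (\<lambda>x. u x * v x)"
    if "continuous_on UNIV u" "continuous_on UNIV v" for u v :: "'s \<Rightarrow> real"
    using that by (intro continuous_integrable continuous_on_mult)
  obtain C where C: "\<And>x. R x = C * \<phi> 0 x"
  proof -
    have "AE \<omega> in M. (LINT x|\<mu>. f \<omega> x * R x) = 0"
      using hf h_mean
    proof eventually_elim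
      case (elim \<omega>)
      then have "(LINT x|\<mu>. h \<omega> x) = (LINT x|\<mu>. - (f \<omega> x * R x))"
        by (intro Bochner_Integration.integral_cong) (auto simp: mult.commute)
      with elim show ?case by simp
    qed
    from f_integral_zero_imp[OF c_pos R this] show thesis using that by blast
  qed
  have D: "(R x - lam j) * \<phi> j x = (LINT x|\<mu>. (R x - lam j) * \<phi> j x * \<phi> 0 x) * \<phi> 0 x" for j x
  proof (rule f_integral_zero_imp[OF c_pos])
    show "continuous_on UNIV (\<lambda>x. (R x - lam j) * \<phi> j x)"
      by (intro continuous_intros R basis_continuous)
    show "AE \<omega> in M. (LINT x|\<mu>. f \<omega> x * ((R x - lam j) * \<phi> j x)) = 0"
      using hf h_coefficients
    proof eventually_elim
      case (elim \<omega>)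
      have "(LINT x|\<mu>. f \<omega> x * ((R x - lam j) * \<phi> j x)) = (LINT x|\<mu>. - (h \<omega> x * \<phi> j x) - lam j * (f \<omega> x * \<phi> j x))"
        using elim(1) by (intro Bochner_Integration.integral_cong) (auto simp: algebra_simps)
      also have "\<dots> = - (LINT x|\<mu>. h \<omega> x * \<phi> j x) - lam j * (LINT x|\<mu>. f \<omega> x * \<phi> j x)"
        using int[OF conjunct1[OF elim(1)] basis_continuous[of j]]
          int[OF conjunct1[OF conjunct2[OF elim(1)]] basis_continuous[of j]]
        by (subst Bochner_Integration.integral_diff) simp_all
      also have "\<dots> = 0"
        using elim(2) by simp
      finally show ?case .
    qed
  qed
  define E where "E = (LINT x|\<mu>. (R x - lam 0) * \<phi> 0 x * \<phi> 0 x) + lam 0"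
  have E: "R x * \<phi> 0 x = E * \<phi> 0 x" for x
    using D[of x 0] by (simp add: E_def algebra_simps)
  have vanish: "(R x - lam j) * \<phi> j x = 0" if "j \<ge> 1" for j x
  proof -
    have "(\<lambda>x. (R x - lam j) * \<phi> j x * \<phi> 0 x) = (\<lambda>x. (E - lam j) * (\<phi> j x * \<phi> 0 x))"
    proof
      fix x
      have "(R x - lam j) * \<phi> j x * \<phi> 0 x = (R x * \<phi> 0 x) * \<phi> j x - lam j * (\<phi> j x * \<phi> 0 x)"
        by (simp add: algebra_simps)
      then show "(R x - lam j) * \<phi> j x * \<phi> 0 x = (E - lam j) * (\<phi> j x * \<phi> 0 x)"
        by (simp add: E algebra_simps)
    qed
    then have "(LINT x|\<mu>. (R x - lam j) * \<phi> j x * \<phi> 0 x) = 0"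
      using orthonormal[of j 0] that by simp
    then show ?thesis using D[of x j] by simp
  qed
  have "lam j = E" if j: "j \<ge> 1" for j
  proof -
    have "\<exists>x. \<phi> j x \<noteq> 0"
    proof (rule ccontr)
      assume "\<not> ?thesis"
      then show False using orthonormal[of j j] by simp
    qed
    then obtain x where x: "\<phi> j x \<noteq> 0" by blast
    then have Rx: "R x = lam j" using vanish[OF j, of x] by simp
    then have "\<phi> 0 x \<noteq> 0" using lam_pos[OF j] C[of x] by auto
    then show ?thesis using E[of x] Rx by simp
  qed
  then have "c j = F E" if "j \<ge> 1" for j
    using c_eq[OF that] that by simp
  with c_pos[of 1] show False
    using coefficients_not_constant[of "F E"] by simp
qed

end

section \<open>The asymptotics of the curvature\<close>

lemma exp_linear_error:
  fixes y :: real
  assumes "\<bar>y\<bar> \<le> 1"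
  shows "\<bar>exp y - 1 - y\<bar> \<le> y\<^sup>2" "\<bar>exp y - 1\<bar> \<le> 2 * \<bar>y\<bar>"
proof -
  have ge: "1 + y \<le> exp y" by (rule exp_ge_add_one_self)
  have le: "exp y \<le> 1 + y + y\<^sup>2"
  proof (cases "y \<ge> 0")
    case True
    then show ?thesis using assms by (intro exp_bound) auto
  next
    case False
    have "1 + (- y) + (- y)\<^sup>2 / 2 \<le> exp (- y)"
      using False by (intro exp_lower_Taylor_quadratic) auto
    then have p: "1 - y + y\<^sup>2 / 2 \<le> exp (- y)" by simp
    have pos: "1 - y + y\<^sup>2 / 2 > 0" using False by (intro add_pos_nonneg) auto
    have "1 \<le> (1 - y + y\<^sup>2 / 2) * (1 + y + y\<^sup>2)"
    proof -
      have "(1 - y + y\<^sup>2 / 2) * (1 + y + y\<^sup>2) = 1 + y\<^sup>2 / 2 + y\<^sup>2 * (y\<^sup>2 - y) / 2"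
        by (simp add: power2_eq_square field_simps)
      moreover have "0 \<le> y\<^sup>2 * (y\<^sup>2 - y)"
        using False by (intro mult_nonneg_nonneg) (auto intro: order_trans[of y 0])
      ultimately show ?thesis by simp
    qed
    also have "\<dots> \<le> exp (- y) * (1 + y + y\<^sup>2)"
      using p assms by (intro mult_right_mono) auto
    finally have "exp y * 1 \<le> exp y * (exp (- y) * (1 + y + y\<^sup>2))"
      by (intro mult_left_mono) auto
    also have "\<dots> = 1 + y + y\<^sup>2"
      by (simp add: mult.assoc[symmetric] exp_add[symmetric] del: exp_minus)
    finally show ?thesis by simp
  qed
  show "\<bar>exp y - 1 - y\<bar> \<le> y\<^sup>2" using ge le by linarith
  have "y\<^sup>2 \<le> \<bar>y\<bar>"
    using assms mult_left_le[of "\<bar>y\<bar>" "\<bar>y\<bar>"] by (simp add: power2_eq_square abs_mult[symmetric])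
  then show "\<bar>exp y - 1\<bar> \<le> 2 * \<bar>y\<bar>" using ge le by linarith
qed

lemma curvature_linearisation:
  fixes a p q R T K :: real
  assumes "a \<ge> 0" "\<bar>p\<bar> \<le> T" "\<bar>q\<bar> \<le> T" "\<bar>R\<bar> \<le> K" "a * T \<le> 1"
  shows "\<bar>(exp (- (a * p)) * (R - a * q) - R) + a * (q + R * p)\<bar> \<le> (K + 2) * (a * T)\<^sup>2"
proof -
  define y where "y = - (a * p)"
  have y: "\<bar>y\<bar> \<le> a * T"
    using assms by (simp add: y_def abs_mult mult_left_mono)
  then have y1: "\<bar>y\<bar> \<le> 1" using assms by linarith
  have "(exp (- (a * p)) * (R - a * q) - R) + a * (q + R * p) = (exp y - 1 - y) * R - (a * q) * (exp y - 1)"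
    by (simp add: y_def algebra_simps)
  then have "\<bar>(exp (- (a * p)) * (R - a * q) - R) + a * (q + R * p)\<bar> \<le> \<bar>exp y - 1 - y\<bar> * \<bar>R\<bar> + \<bar>a * q\<bar> * \<bar>exp y - 1\<bar>"
    by (simp only: abs_mult[symmetric] abs_triangle_ineq4)
  also have "\<dots> \<le> (a * T)\<^sup>2 * K + (a * T) * (2 * (a * T))"
  proof (intro add_mono mult_mono)
    show "\<bar>exp y - 1 - y\<bar> \<le> (a * T)\<^sup>2"
      using exp_linear_error(1)[OF y1] power_mono[OF y, of 2] by simp
    show "\<bar>exp y - 1\<bar> \<le> 2 * (a * T)"
      using exp_linear_error(2)[OF y1] y by linarith
    show "\<bar>a * q\<bar> \<le> a * T"
      using assms by (simp add: abs_mult mult_left_mono)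
  qed (use assms y in auto)
  also have "\<dots> = (K + 2) * (a * T)\<^sup>2"
    by (simp add: power2_eq_square algebra_simps)
  finally show ?thesis .
qed

lemma small_au_limits:
  shows "filterlim fst (at_right 0) small_au" "filterlim snd (at_right 0) small_au"
    "filterlim (\<lambda>(a, u). u / a) at_top small_au"
proof -
  have "small_au \<le> at_right 0 \<times>\<^sub>F at_right 0" by (simp add: small_au_def)
  then show "filterlim fst (at_right 0) small_au" "filterlim snd (at_right 0) small_au"
    by (auto intro: filterlim_mono filterlim_fst filterlim_snd)
  show "filterlim (\<lambda>(a, u). u / a) at_top small_au"
    unfolding small_au_def filterlim_iff_le_filtercomap by simp
qed

lemma eventually_small_au:
  assumes "\<delta> > 0"
  shows "\<forall>\<^sub>F (a, u) in small_au. a > 0 \<and> u > 0 \<and> u < \<delta>"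
proof -
  have "eventually (\<lambda>x::real. x > 0) (at_right 0)" by (rule eventually_at_right_less)
  from filterlim_iff[THEN iffD1, OF small_au_limits(1), rule_format, OF this]
  have 1: "eventually (\<lambda>z. fst z > 0) small_au" .
  have "eventually (\<lambda>x::real. x > 0 \<and> x < \<delta>) (at_right 0)"
    using assms by (auto simp: eventually_at_right_field)
  from filterlim_iff[THEN iffD1, OF small_au_limits(2), rule_format, OF this]
  have "eventually (\<lambda>z. snd z > 0 \<and> snd z < \<delta>) small_au" .
  with 1 show ?thesis by eventually_elim auto
qed

lemma eventually_small_au_ratio:
  assumes "eventually P at_top"
  shows "\<forall>\<^sub>F (a, u) in small_au. P (u / a)"
  using filterlim_iff[THEN iffD1, OF small_au_limits(3), rule_format, OF assms]
  by (simp add: case_prod_beta')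

lemma ln_asymp_equiv_of_bounds:
  fixes P s :: "'a \<Rightarrow> real"
  assumes s: "filterlim s at_top Fl" and K: "K1 > 0" "K2 > 0"
    and bnd: "\<And>\<epsilon>. 0 < \<epsilon> \<Longrightarrow> \<epsilon> < 1 \<Longrightarrow> eventually (\<lambda>z. K1 * exp (- (1 + \<epsilon>) * s z) \<le> P z \<and> P z \<le> K2 * exp (- (1 - \<epsilon>) * s z)) Fl"
  shows "(\<lambda>z. ln (P z)) \<sim>[Fl] (\<lambda>z. - s z)"
proof (rule asymp_equivI')
  show "((\<lambda>z. ln (P z) / (- s z)) \<longlongrightarrow> 1) Fl"
  proof (rule tendstoI)
    fix e :: real assume "e > 0"
    define \<epsilon> where "\<epsilon> = min (e / 3) (1 / 2)"
    have \<epsilon>: "0 < \<epsilon>" "\<epsilon> < 1" "2 * \<epsilon> < e" using \<open>e > 0\<close> by (auto simp: \<epsilon>_def)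
    have "eventually (\<lambda>z. s z \<ge> max 1 (max (\<bar>ln K1\<bar> / \<epsilon>) (\<bar>ln K2\<bar> / \<epsilon>))) Fl"
      using s unfolding filterlim_at_top by (rule spec)
    with bnd[OF \<epsilon>(1,2)] show "eventually (\<lambda>z. dist (ln (P z) / (- s z)) 1 < e) Fl"
    proof eventually_elim
      case (elim z)
      have sz: "s z > 0" "\<bar>ln K1\<bar> \<le> \<epsilon> * s z" "\<bar>ln K2\<bar> \<le> \<epsilon> * s z"
        using elim(2) \<epsilon> by (auto simp: pos_divide_le_eq mult.commute)
      have "0 < K1 * exp (- (1 + \<epsilon>) * s z)" using K by simp
      then have P: "P z > 0" using elim(1) by linarith
      have "ln (K1 * exp (- (1 + \<epsilon>) * s z)) \<le> ln (P z)"
        using elim(1) K P by (subst ln_le_cancel_iff) auto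
      then have l: "ln K1 - (1 + \<epsilon>) * s z \<le> ln (P z)"
        using K by (simp add: ln_mult algebra_simps)
      have "ln (P z) \<le> ln (K2 * exp (- (1 - \<epsilon>) * s z))"
        using elim(1) K P by (subst ln_le_cancel_iff) auto
      then have u: "ln (P z) \<le> ln K2 - (1 - \<epsilon>) * s z"
        using K by (simp add: ln_mult algebra_simps)
      have "\<bar>ln (P z) + s z\<bar> \<le> 2 * \<epsilon> * s z"
        using l u sz(2,3) by (simp add: abs_le_iff algebra_simps)
      then have "\<bar>ln (P z) + s z\<bar> / s z \<le> 2 * \<epsilon>"
        using sz(1) by (simp add: pos_divide_le_eq)
      moreover have "ln (P z) / (- s z) - 1 = - ((ln (P z) + s z) / s z)"
        using sz(1) by (simp add: add_divide_distrib)
      then have "dist (ln (P z) / (- s z)) 1 = \<bar>ln (P z) + s z\<bar> / s z"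
        using sz(1) by (simp only: dist_real_def abs_minus_cancel abs_divide abs_of_pos)
      ultimately show ?case using \<epsilon>(3) by linarith
    qed
  qed
qed

lemma small_parameter_exists:
  fixes \<epsilon> :: real
  assumes "\<epsilon> > 0"
  obtains \<eta> where "0 < \<eta>" "\<eta> < 1" "1 - \<epsilon> \<le> (1 - \<eta>) ^ 3" "((1 + \<eta>) / (1 - \<eta>) + \<eta>)\<^sup>2 \<le> 1 + \<epsilon>"
proof -
  have "((\<lambda>\<eta>::real. (1 - \<eta>) ^ 3) \<longlongrightarrow> (1 - 0) ^ 3) (at_right 0)"
    by (intro tendsto_intros)
  then have 1: "eventually (\<lambda>\<eta>::real. (1 - \<eta>) ^ 3 > 1 - \<epsilon>) (at_right 0)"
    by (rule order_tendstoD(1)) (use assms in simp)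
  have "((\<lambda>\<eta>::real. ((1 + \<eta>) / (1 - \<eta>) + \<eta>)\<^sup>2) \<longlongrightarrow> ((1 + 0) / (1 - 0) + 0)\<^sup>2) (at_right 0)"
    by (intro tendsto_intros) auto
  then have 2: "eventually (\<lambda>\<eta>::real. ((1 + \<eta>) / (1 - \<eta>) + \<eta>)\<^sup>2 < 1 + \<epsilon>) (at_right 0)"
    by (rule order_tendstoD(2)) (use assms in simp)
  have "eventually (\<lambda>\<eta>::real. 0 < \<eta> \<and> \<eta> < 1) (at_right 0)"
    unfolding eventually_at_right_field by (intro exI[of _ 1]) auto
  with 1 2 have "eventually (\<lambda>\<eta>::real. 0 < \<eta> \<and> \<eta> < 1 \<and> 1 - \<epsilon> \<le> (1 - \<eta>) ^ 3 \<and> ((1 + \<eta>) / (1 - \<eta>) + \<eta>)\<^sup>2 \<le> 1 + \<epsilon>) (at_right 0)"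
    by eventually_elim auto
  from eventually_happens'[OF trivial_limit_at_right_real this] show thesis
    using that by blast
qed

lemma measure_completion_cong_AE:
  assumes E: "E \<in> sets M" and S: "S \<subseteq> space M" and ae: "AE x in M. x \<in> E \<longleftrightarrow> x \<in> S"
  shows "measure (completion M) S = measure M E"
proof -
  have ae': "AE x in completion M. x \<in> E \<longleftrightarrow> x \<in> S"
    using ae by (rule AE_completion)
  have S': "S \<in> sets (completion M)"
    by (rule completion.in_sets_AE[OF ae']) (use E S in simp_all)
  have "measure (completion M) E = measure (completion M) S"
    by (rule measure_eq_AE[OF ae' _ S']) (use E in simp)
  then show ?thesis
    using E by simp
qed

lemma curvature_log_asymptotics:
  fixes f h w :: "'w \<Rightarrow> 's::topological_space \<Rightarrow> real" and R :: "'s \<Rightarrow> real"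
  assumes f: "gauss_field M X r f \<beta>f" and h: "gauss_field M X r h \<beta>h" and w: "gauss_field M X r w \<beta>w"
    and w_eq: "\<And>\<omega> x. w \<omega> x = h \<omega> x + R x * f \<omega> x"
    and R: "continuous_on UNIV R" and \<sigma>: "\<sigma> > 0"
    and var_le: "\<And>x. prob_space.expectation M (\<lambda>\<omega>. (w \<omega> x)\<^sup>2) \<le> \<sigma>\<^sup>2"
    and var_ge: "\<And>v. v < \<sigma>\<^sup>2 \<Longrightarrow> \<exists>x. v < prob_space.expectation M (\<lambda>\<omega>. (w \<omega> x)\<^sup>2)"
  shows "(\<lambda>(a, u). ln (measure (completion M) {\<omega> \<in> space M.
      sup_norm (\<lambda>x. exp (- (a * f \<omega> x)) * (R x - a * h \<omega> x) - R x) > ereal u}))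
    \<sim>[small_au] (\<lambda>(a, u). - (u\<^sup>2 / (2 * a\<^sup>2 * \<sigma>\<^sup>2)))"
proof -
  interpret F: gauss_field M X r f \<beta>f by (rule f)
  interpret H: gauss_field M X r h \<beta>h by (rule h)
  interpret W: gauss_field M X r w \<beta>w by (rule w)
  define \<rho> where "\<rho> a \<omega> x = exp (- (a * f \<omega> x)) * (R x - a * h \<omega> x) - R x" for a \<omega> x
  define E where "E a u = {\<omega> \<in> space M. \<exists>q\<in>F.net. \<bar>\<rho> a \<omega> q\<bar> > u}" for a u
  have sets_E: "E a u \<in> sets M" for a u
  proof -
    have "(\<lambda>\<omega>. \<rho> a \<omega> q) \<in> borel_measurable M" for q
      using F.field_measurable[of q] H.field_measurable[of q] unfolding \<rho>_def by measurable
    then show ?thesis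
      unfolding E_def by (rule F.sets_exists_exceed[OF F.countable_net])
  qed
  have meas_eq: "measure (completion M) {\<omega> \<in> space M. sup_norm (\<rho> a \<omega>) > ereal u} = F.prob (E a u)" for a u
  proof (rule measure_completion_cong_AE[OF sets_E])
    show "AE \<omega> in M. \<omega> \<in> E a u \<longleftrightarrow> \<omega> \<in> {\<omega> \<in> space M. sup_norm (\<rho> a \<omega>) > ereal u}"
      using F.field_continuous H.field_continuous
    proof eventually_elim
      case (elim \<omega>)
      have cont: "continuous_on UNIV (\<rho> a \<omega>)"
        unfolding \<rho>_def using elim R by (intro continuous_intros)
      have "sup_norm (\<rho> a \<omega>) > ereal u \<longleftrightarrow> (\<exists>x. \<bar>\<rho> a \<omega> x\<bar> > u)"
        by (simp add: sup_norm_def less_SUP_iff)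
      also have "\<dots> \<longleftrightarrow> (\<exists>q\<in>F.net. \<bar>\<rho> a \<omega> q\<bar> > u)"
        by (rule F.exceed_net_iff[OF cont, symmetric])
      finally show ?case by (simp add: E_def)
    qed
  qed auto
  define s where "s = (\<lambda>(a, u). u\<^sup>2 / (2 * a\<^sup>2 * \<sigma>\<^sup>2) :: real)"
  define P where "P = (\<lambda>(a, u). F.prob (E a u))"
  obtain K where "\<And>x. \<bar>R x\<bar> \<le> K" using F.bounded_of_continuous[OF R] by blast
  then have K: "\<bar>R x\<bar> \<le> K" "K \<ge> 0" for x
    using abs_ge_zero order_trans by blast+
  obtain \<kappa>f sf where tf: "\<kappa>f > 0" "\<And>t. t \<ge> sf \<Longrightarrow> F.prob (F.exceedance t) \<le> exp (- \<kappa>f * t\<^sup>2)"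
    using F.gaussian_tail by blast
  obtain \<kappa>h sh where th: "\<kappa>h > 0" "\<And>t. t \<ge> sh \<Longrightarrow> F.prob (H.exceedance t) \<le> exp (- \<kappa>h * t\<^sup>2)"
    using H.gaussian_tail by blast
  define \<kappa>0 where "\<kappa>0 = min \<kappa>f \<kappa>h"
  have s_lim: "filterlim s at_top small_au"
  proof -
    have "filterlim (\<lambda>y::real. 1 / (2 * \<sigma>\<^sup>2) * y\<^sup>2) at_top at_top"
      using \<sigma> by (intro filterlim_tendsto_pos_mult_at_top[OF tendsto_const] filterlim_pow_at_top filterlim_ident) auto
    from filterlim_compose[OF this small_au_limits(3)]
    show ?thesis by (simp add: s_def case_prod_beta' power_divide mult_ac)
  qed
  have bounds: "eventually (\<lambda>z. 1 / 6 * exp (- (1 + \<epsilon>) * s z) \<le> P z \<and> P z \<le> 3 * exp (- (1 - \<epsilon>) * s z)) small_au"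
    if \<epsilon>: "0 < \<epsilon>" "\<epsilon> < 1" for \<epsilon>
  proof -
    obtain \<eta> where \<eta>: "0 < \<eta>" "\<eta> < 1" "1 - \<epsilon> \<le> (1 - \<eta>) ^ 3" "((1 + \<eta>) / (1 - \<eta>) + \<eta>)\<^sup>2 \<le> 1 + \<epsilon>"
      using small_parameter_exists[OF \<epsilon>(1)] by blast
    define \<kappa> where "\<kappa> = sqrt (\<eta> / (K + 2))"
    have \<kappa>2: "\<kappa>\<^sup>2 = \<eta> / (K + 2)" using \<eta> K(2) by (simp add: \<kappa>_def)
    have \<kappa>: "0 < \<kappa>" "\<kappa> \<le> 1"
      using \<eta> K(2) by (auto simp: \<kappa>_def field_simps)
    define B where "B T = F.exceedance T \<union> H.exceedance T" for T
    have sets_B: "B T \<in> sets M" for T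
      unfolding B_def by measurable
    have lin: "\<bar>\<rho> a \<omega> q + a * w \<omega> q\<bar> \<le> \<eta> * u"
      if au: "0 < a" "0 < u" "u < 1" and \<omega>: "\<omega> \<in> space M" "\<omega> \<notin> B (\<kappa> * sqrt u / a)" and q: "q \<in> F.net" for a u \<omega> q
    proof -
      let ?T = "\<kappa> * sqrt u / a"
      have fh: "\<bar>f \<omega> q\<bar> \<le> ?T" "\<bar>h \<omega> q\<bar> \<le> ?T"
        using \<omega> q by (auto simp: B_def F.exceedance_def H.exceedance_def not_less)
      have aT: "a * ?T = \<kappa> * sqrt u" using au by simp
      have "a * ?T \<le> 1"
        unfolding aT using \<kappa> au by (intro mult_le_one) auto
      then have "\<bar>\<rho> a \<omega> q + a * w \<omega> q\<bar> \<le> (K + 2) * (a * ?T)\<^sup>2"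
        unfolding \<rho>_def w_eq using au fh K(1) by (intro curvature_linearisation) auto
      also have "\<dots> = \<eta> * u"
        unfolding aT power_mult_distrib \<kappa>2 using au K(2) by simp
      finally show ?thesis .
    qed
    have upper: "P (a, u) \<le> F.prob (W.exceedance ((1 - \<eta>) * (u / a))) + F.prob (B (\<kappa> * sqrt u / a))"
      if au: "0 < a" "0 < u" "u < 1" for a u
    proof -
      have "E a u \<subseteq> W.exceedance ((1 - \<eta>) * (u / a)) \<union> B (\<kappa> * sqrt u / a)"
      proof
        fix \<omega> assume "\<omega> \<in> E a u"
        then obtain q where \<omega>: "\<omega> \<in> space M" and q: "q \<in> F.net" "\<bar>\<rho> a \<omega> q\<bar> > u" by (auto simp: E_def)
        have "(1 - \<eta>) * (u / a) < \<bar>w \<omega> q\<bar>" if "\<omega> \<notin> B (\<kappa> * sqrt u / a)"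
        proof -
          have "u - \<eta> * u < \<bar>a * w \<omega> q\<bar>" using lin[OF au \<omega> that q(1)] q(2) by linarith
          then have "(1 - \<eta>) * u < \<bar>w \<omega> q\<bar> * a" using au by (simp add: abs_mult algebra_simps)
          then show ?thesis using au by (simp add: pos_divide_less_eq)
        qed
        then show "\<omega> \<in> W.exceedance ((1 - \<eta>) * (u / a)) \<union> B (\<kappa> * sqrt u / a)"
          using \<omega> q(1) unfolding W.exceedance_def by blast
      qed
      then have "P (a, u) \<le> F.prob (W.exceedance ((1 - \<eta>) * (u / a)) \<union> B (\<kappa> * sqrt u / a))"
        unfolding P_def prod.case by (rule F.finite_measure_mono) (intro sets.Un W.sets_exceedance sets_B)
      also have "\<dots> \<le> F.prob (W.exceedance ((1 - \<eta>) * (u / a))) + F.prob (B (\<kappa> * sqrt u / a))"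
        by (intro measure_Un_le W.sets_exceedance sets_B)
      finally show ?thesis .
    qed
    have lower: "F.prob (W.exceedance ((1 + \<eta>) * (u / a))) \<le> P (a, u) + F.prob (B (\<kappa> * sqrt u / a))"
      if au: "0 < a" "0 < u" "u < 1" for a u
    proof -
      have "W.exceedance ((1 + \<eta>) * (u / a)) \<subseteq> E a u \<union> B (\<kappa> * sqrt u / a)"
      proof
        fix \<omega> assume "\<omega> \<in> W.exceedance ((1 + \<eta>) * (u / a))"
        then obtain q where \<omega>: "\<omega> \<in> space M" and q: "q \<in> F.net" "\<bar>w \<omega> q\<bar> > (1 + \<eta>) * (u / a)"
          by (auto simp: W.exceedance_def)
        have "u < \<bar>\<rho> a \<omega> q\<bar>" if "\<omega> \<notin> B (\<kappa> * sqrt u / a)"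
        proof -
          have "(1 + \<eta>) * u < \<bar>w \<omega> q\<bar> * a" using q(2) au by (simp add: pos_divide_less_eq)
          then have "u + \<eta> * u < \<bar>a * w \<omega> q\<bar>" using au by (simp add: abs_mult algebra_simps)
          then show ?thesis using lin[OF au \<omega> that q(1)] by linarith
        qed
        then show "\<omega> \<in> E a u \<union> B (\<kappa> * sqrt u / a)"
          using \<omega> q(1) unfolding E_def by blast
      qed
      then have "F.prob (W.exceedance ((1 + \<eta>) * (u / a))) \<le> F.prob (E a u \<union> B (\<kappa> * sqrt u / a))"
        by (rule F.finite_measure_mono) (intro sets.Un sets_E sets_B)
      also have "\<dots> \<le> F.prob (E a u) + F.prob (B (\<kappa> * sqrt u / a))"
        by (intro measure_Un_le sets_E sets_B)
      finally show ?thesis by (simp add: P_def)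
    qed
    have \<kappa>0: "\<kappa>0 > 0" using tf th by (simp add: \<kappa>0_def)
    define \<delta> where "\<delta> = min 1 (2 * \<kappa>0 * \<kappa>\<^sup>2 * \<sigma>\<^sup>2 / 3)"
    have \<delta>: "\<delta> > 0" using \<kappa>0 \<kappa> \<sigma> by (simp add: \<delta>_def)
    have tailB: "F.prob (B (\<kappa> * sqrt u / a)) \<le> 2 * exp (- 3 * s (a, u))"
      if au: "0 < a" "0 < u" "u < \<delta>" and ratio: "u / a \<ge> max sf sh / \<kappa>" and pos: "u / a \<ge> 0" for a u
    proof -
      let ?T = "\<kappa> * sqrt u / a"
      have u1: "u < 1" "u * 3 \<le> 2 * \<kappa>0 * \<kappa>\<^sup>2 * \<sigma>\<^sup>2" using au by (auto simp: \<delta>_def)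
      have "max sf sh \<le> \<kappa> * (u / a)"
        using ratio \<kappa> by (simp add: pos_divide_le_eq mult.commute)
      also have "\<dots> \<le> ?T"
      proof -
        have "u * u \<le> u * 1" using u1 au by (intro mult_left_mono) auto
        then have "u \<le> sqrt u" by (intro real_le_rsqrt) (simp add: power2_eq_square)
        then show ?thesis using \<kappa> au by (simp add: divide_right_mono mult_left_mono)
      qed
      finally have T: "sf \<le> ?T" "sh \<le> ?T" by auto
      have "?T\<^sup>2 = \<kappa>\<^sup>2 * u / a\<^sup>2"
        using au by (simp add: power_divide power_mult_distrib)
      moreover have "3 * s (a, u) \<le> \<kappa>0 * (\<kappa>\<^sup>2 * u / a\<^sup>2)"
      proof -
        have "u * 3 * u \<le> 2 * \<kappa>0 * \<kappa>\<^sup>2 * \<sigma>\<^sup>2 * u"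
          using u1(2) au by (intro mult_right_mono) auto
        then have "u * 3 * u / (2 * a\<^sup>2 * \<sigma>\<^sup>2) \<le> 2 * \<kappa>0 * \<kappa>\<^sup>2 * \<sigma>\<^sup>2 * u / (2 * a\<^sup>2 * \<sigma>\<^sup>2)"
          by (intro divide_right_mono) auto
        moreover have "u * 3 * u / (2 * a\<^sup>2 * \<sigma>\<^sup>2) = 3 * s (a, u)"
          by (simp add: s_def power2_eq_square)
        moreover have "2 * \<kappa>0 * \<kappa>\<^sup>2 * \<sigma>\<^sup>2 * u / (2 * a\<^sup>2 * \<sigma>\<^sup>2) = \<kappa>0 * (\<kappa>\<^sup>2 * u / a\<^sup>2)"
          using \<sigma> au by (simp add: field_simps)
        ultimately show ?thesis by linarith
      qed
      ultimately have e: "3 * s (a, u) \<le> \<kappa>0 * ?T\<^sup>2" by simp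
      have "\<kappa>0 * ?T\<^sup>2 \<le> \<kappa>f * ?T\<^sup>2" "\<kappa>0 * ?T\<^sup>2 \<le> \<kappa>h * ?T\<^sup>2"
        by (intro mult_right_mono; simp add: \<kappa>0_def)+
      with e have "exp (- \<kappa>f * ?T\<^sup>2) \<le> exp (- 3 * s (a, u))" "exp (- \<kappa>h * ?T\<^sup>2) \<le> exp (- 3 * s (a, u))"
        by (simp_all only: exp_le_cancel_iff mult_minus_left neg_le_iff_le)
      moreover have "F.prob (B ?T) \<le> F.prob (F.exceedance ?T) + F.prob (H.exceedance ?T)"
        unfolding B_def by (intro measure_Un_le F.sets_exceedance H.sets_exceedance)
      ultimately show ?thesis
        using tf(2)[OF T(1)] th(2)[OF T(2)] by linarith
    qed
    obtain x0 where x0: "((1 - \<eta>) * \<sigma>)\<^sup>2 < F.expectation (\<lambda>\<omega>. (w \<omega> x0)\<^sup>2)"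
    proof -
      have "((1 - \<eta>) * \<sigma>)\<^sup>2 < (1 * \<sigma>)\<^sup>2"
        using \<eta> \<sigma> by (intro power_strict_mono mult_strict_right_mono) auto
      then show thesis using var_ge[of "((1 - \<eta>) * \<sigma>)\<^sup>2"] that by auto
    qed
    have "filterlim (\<lambda>t::real. (1 - \<eta>) * t) at_top at_top"
      using \<eta> by (intro filterlim_tendsto_pos_mult_at_top[OF tendsto_const _ filterlim_ident]) auto
    from filterlim_iff[THEN iffD1, OF this, rule_format, OF W.sharp_tail_le[OF _ var_le \<eta>(1,2)]]
    have sharp: "\<forall>\<^sub>F t in at_top. F.prob (W.exceedance ((1 - \<eta>) * t)) \<le> exp (- (1 - \<eta>) * (((1 - \<eta>) * t)\<^sup>2 / (2 * \<sigma>\<^sup>2)))"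
      using \<sigma> by simp
    have large: "\<forall>\<^sub>F t in at_top. t \<ge> max sf sh / \<kappa> \<and> t \<ge> \<sigma> / \<eta> \<and> t \<ge> (0::real)"
      by (intro eventually_conj eventually_ge_at_top)
    have s_large: "eventually (\<lambda>z. s z \<ge> ln 12) small_au"
      using s_lim unfolding filterlim_at_top by (rule spec)
    show ?thesis
      using eventually_small_au[OF \<delta>] eventually_small_au_ratio[OF sharp] eventually_small_au_ratio[OF large] s_large
    proof eventually_elim
      case (elim z)
      obtain a u where z: "z = (a, u)" by (cases z)
      have au: "0 < a" "0 < u" "u < \<delta>" "u < 1"
        using elim(1) by (auto simp: z \<delta>_def)
      have sh': "F.prob (W.exceedance ((1 - \<eta>) * (u / a))) \<le> exp (- (1 - \<eta>) * (((1 - \<eta>) * (u / a))\<^sup>2 / (2 * \<sigma>\<^sup>2)))"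
        using elim(2) by (simp add: z)
      have la: "u / a \<ge> max sf sh / \<kappa>" "u / a \<ge> \<sigma> / \<eta>" "u / a \<ge> 0"
        using elim(3) by (simp_all add: z)
      define S where "S = s (a, u)"
      have S: "S \<ge> ln 12" "S = (u / a)\<^sup>2 / (2 * \<sigma>\<^sup>2)"
        using elim(4) by (simp_all add: S_def s_def z power_divide mult_ac)
      have S0: "S \<ge> 0" unfolding S(2) by simp
      have B: "F.prob (B (\<kappa> * sqrt u / a)) \<le> 2 * exp (- 3 * S)"
        unfolding S_def by (rule tailB[OF au(1-3) la(1,3)])
      have up: "P (a, u) \<le> 3 * exp (- (1 - \<epsilon>) * S)"
      proof -
        have "(1 - \<eta>) * (((1 - \<eta>) * (u / a))\<^sup>2 / (2 * \<sigma>\<^sup>2)) = (1 - \<eta>) ^ 3 * S"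
          by (simp add: S(2) power_mult_distrib power2_eq_square power3_eq_cube)
        moreover have "(1 - \<epsilon>) * S \<le> (1 - \<eta>) ^ 3 * S"
          using \<eta>(3) S0 by (rule mult_right_mono)
        ultimately have "exp (- (1 - \<eta>) * (((1 - \<eta>) * (u / a))\<^sup>2 / (2 * \<sigma>\<^sup>2))) \<le> exp (- (1 - \<epsilon>) * S)"
          by (simp only: exp_le_cancel_iff mult_minus_left neg_le_iff_le)
        moreover have "(1 - \<epsilon>) * S \<le> 3 * S"
          using \<epsilon> S0 by (intro mult_right_mono) auto
        then have "exp (- 3 * S) \<le> exp (- (1 - \<epsilon>) * S)"
          by (simp only: exp_le_cancel_iff mult_minus_left neg_le_iff_le)
        ultimately show ?thesis
          using upper[OF au(1,2,4)] sh' B by linarith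
      qed
      have low: "1 / 6 * exp (- (1 + \<epsilon>) * S) \<le> P (a, u)"
      proof -
        define y where "y = u / a / \<sigma>"
        have y: "y\<^sup>2 / 2 = S"
          by (simp add: y_def S(2) power_divide power_mult_distrib)
        have "\<sigma> / \<eta> \<le> y * \<sigma>" using la(2) \<sigma> by (simp add: y_def)
        then have ey: "1 \<le> \<eta> * y" using \<eta> \<sigma> by (simp add: field_simps)
        let ?z = "(1 + \<eta>) * (u / a) / ((1 - \<eta>) * \<sigma>) + 1"
        have "(1 + \<eta>) * (u / a) / ((1 - \<eta>) * \<sigma>) = (1 + \<eta>) / (1 - \<eta>) * y"
          by (simp add: y_def)
        then have z1: "?z \<le> ((1 + \<eta>) / (1 - \<eta>) + \<eta>) * y"
          using ey by (simp add: distrib_right)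
        have z0: "0 \<le> ?z"
          using \<eta> \<sigma> au by (intro add_nonneg_nonneg divide_nonneg_nonneg mult_nonneg_nonneg) auto
        have "?z\<^sup>2 \<le> (((1 + \<eta>) / (1 - \<eta>) + \<eta>) * y)\<^sup>2"
          using z1 z0 by (rule power_mono)
        also have "\<dots> = ((1 + \<eta>) / (1 - \<eta>) + \<eta>)\<^sup>2 * y\<^sup>2"
          by (rule power_mult_distrib)
        also have "\<dots> \<le> (1 + \<epsilon>) * y\<^sup>2"
          using \<eta>(4) by (intro mult_right_mono) auto
        finally have "?z\<^sup>2 \<le> (1 + \<epsilon>) * y\<^sup>2" .
        then have "?z\<^sup>2 / 2 \<le> (1 + \<epsilon>) * S"
          unfolding y[symmetric] by (simp add: divide_right_mono)
        then have ez: "exp (- (1 + \<epsilon>) * S) \<le> exp (- ?z\<^sup>2 / 2)"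
          by (simp only: exp_le_cancel_iff mult_minus_left minus_divide_left[symmetric] neg_le_iff_le)
        have "sqrt (2 * pi) \<le> sqrt (3\<^sup>2)"
          using pi_less_4 by (intro real_sqrt_le_mono) (simp add: power2_eq_square)
        then have "1 / 3 \<le> 1 / sqrt (2 * pi)"
          by (intro divide_left_mono) auto
        then have "1 / 3 * exp (- (1 + \<epsilon>) * S) \<le> std_normal_density ?z"
          unfolding std_normal_density_def using ez by (intro mult_mono) auto
        also have "\<dots> \<le> F.prob {\<omega> \<in> space M. \<bar>w \<omega> x0\<bar> > (1 + \<eta>) * (u / a)}"
        proof -
          have sq: "sqrt (((1 - \<eta>) * \<sigma>)\<^sup>2) = (1 - \<eta>) * \<sigma>" using \<eta> \<sigma> by simp
          have "0 < ((1 - \<eta>) * \<sigma>)\<^sup>2" using \<eta> \<sigma> by simp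
          from F.glin_tail_ge[OF W.field_glin W.field_measurable this less_imp_le[OF x0], of "(1 + \<eta>) * (u / a)"]
          show ?thesis unfolding sq using \<eta> au by simp
        qed
        also have "\<dots> \<le> F.prob (W.exceedance ((1 + \<eta>) * (u / a)))"
          by (rule W.prob_point_le)
        also have "\<dots> \<le> P (a, u) + 2 * exp (- 3 * S)"
          using lower[OF au(1,2,4)] B by linarith
        finally have main: "1 / 3 * exp (- (1 + \<epsilon>) * S) \<le> P (a, u) + 2 * exp (- 3 * S)" .
        have "2 * exp (- 3 * S) \<le> 1 / 6 * exp (- (1 + \<epsilon>) * S)"
        proof -
          have "exp (- S) \<le> exp (- ln 12)" using S(1) by simp
          then have "exp (- S) \<le> 1 / 12" by (simp add: exp_minus inverse_eq_divide)
          then have "exp (- S) * exp (- 2 * S) \<le> 1 / 12 * exp (- 2 * S)"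
            by (intro mult_right_mono) auto
          moreover have "exp (- S) * exp (- 2 * S) = exp (- 3 * S)"
            by (simp add: exp_add[symmetric])
          moreover have "(1 + \<epsilon>) * S \<le> 2 * S"
            using \<epsilon> S0 by (intro mult_right_mono) auto
          then have "exp (- 2 * S) \<le> exp (- (1 + \<epsilon>) * S)"
            by (simp only: exp_le_cancel_iff mult_minus_left neg_le_iff_le)
          ultimately show ?thesis by linarith
        qed
        with main show ?thesis by linarith
      qed
      show ?case
        using up low by (simp add: z S_def)
    qed
  qed
  have "(\<lambda>z. ln (P z)) \<sim>[small_au] (\<lambda>z. - s z)"
    by (rule ln_asymp_equiv_of_bounds[OF s_lim _ _ bounds]) auto
  moreover have "(\<lambda>z. ln (P z)) = (\<lambda>(a, u). ln (measure (completion M) {\<omega> \<in> space M. sup_norm (\<rho> a \<omega>) > ereal u}))"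
    by (auto simp: P_def meas_eq)
  moreover have "(\<lambda>z. - s z) = (\<lambda>(a, u). - (u\<^sup>2 / (2 * a\<^sup>2 * \<sigma>\<^sup>2)))"
    by (auto simp: s_def)
  ultimately show ?thesis
    by (simp only: \<rho>_def[abs_def])
qed

lemma (in gauss_sequence) glin_square_integrable:
  assumes Y: "glin Y b" and [measurable]: "Y \<in> borel_measurable M"
  shows "integrable M (\<lambda>\<omega>. (Y \<omega>)\<^sup>2)"
proof -
  obtain G where G: "gauss_linear G b" "AE \<omega> in M. Y \<omega> = G (X \<omega>)"
    using Y by (rule glinE)
  note [measurable] = gauss_linear_measurable[OF G(1)]
  have "integrable (distr M gauss_seq X) (\<lambda>x. (G x)\<^sup>2)"
    unfolding distr_X by (rule gauss_linear_square_integrable[OF G(1)])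
  then have "integrable M (\<lambda>\<omega>. (G (X \<omega>))\<^sup>2)"
    by (subst (asm) integrable_distr_eq) auto
  moreover have "AE \<omega> in M. (G (X \<omega>))\<^sup>2 = (Y \<omega>)\<^sup>2"
    using G(2) by eventually_elim simp
  ultimately show ?thesis
    by (subst (asm) integrable_cong_AE) auto
qed

lemma gauss_sequence_of_indep:
  assumes M: "prob_space M" and indep: "prob_space.indep_vars M (\<lambda>_. borel) \<xi> {1..}"
    and distr: "\<And>j. j \<ge> 1 \<Longrightarrow> distributed M lborel (\<xi> j) std_normal_density"
  shows "gauss_sequence M (\<lambda>\<omega> j. \<xi> (Suc j) \<omega>)"
proof -
  interpret prob_space M by (rule M)
  have rv: "\<xi> (Suc j) \<in> borel_measurable M" for j
    using distributed_measurable[OF distr[of "Suc j"]] by simp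
  have law: "distr M borel (\<xi> (Suc j)) = std_normal_distribution" for j
  proof -
    have "distr M borel (\<xi> (Suc j)) = distr M lborel (\<xi> (Suc j))"
      by (rule distr_cong) auto
    also have "\<dots> = std_normal_distribution"
      by (rule distributed_distr_eq_density[OF distr]) simp
    finally show ?thesis .
  qed
  let ?I = "{1::nat..}" and ?S = "\<lambda>_::nat. std_normal_distribution"
  have rv1: "\<xi> i \<in> borel_measurable M" and law1: "distr M borel (\<xi> i) = std_normal_distribution" if "i \<in> ?I" for i
    using that rv[of "i - 1"] law[of "i - 1"] by simp_all
  have "distr M (PiM ?I (\<lambda>_. borel)) (\<lambda>\<omega>. \<lambda>i\<in>?I. \<xi> i \<omega>) = PiM ?I (\<lambda>i. distr M borel (\<xi> i))"
    using indep rv1 by (subst (asm) indep_vars_iff_distr_eq_PiM') auto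
  also have "\<dots> = PiM ?I ?S"
    using law1 by (intro PiM_cong) auto
  finally have joint: "distr M (PiM ?I (\<lambda>_. borel)) (\<lambda>\<omega>. \<lambda>i\<in>?I. \<xi> i \<omega>) = PiM ?I ?S" .
  have shift: "(\<lambda>x. \<lambda>n\<in>UNIV. x (Suc n)) \<in> PiM ?I (\<lambda>_. borel) \<rightarrow>\<^sub>M PiM UNIV (\<lambda>_::nat. borel :: real measure)"
    by (intro measurable_restrict measurable_component_singleton) simp
  have \<xi>: "(\<lambda>\<omega>. \<lambda>i\<in>?I. \<xi> i \<omega>) \<in> M \<rightarrow>\<^sub>M PiM ?I (\<lambda>_. borel)"
    by (intro measurable_restrict rv1)
  have sI: "sets (PiM UNIV (\<lambda>_::nat. borel :: real measure)) = sets (PiM UNIV ?S)"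
    by (intro sets_PiM_cong) auto
  have "distr M (PiM UNIV (\<lambda>_. borel)) (\<lambda>\<omega> j. \<xi> (Suc j) \<omega>)
      = distr (distr M (PiM ?I (\<lambda>_. borel)) (\<lambda>\<omega>. \<lambda>i\<in>?I. \<xi> i \<omega>)) (PiM UNIV (\<lambda>_. borel)) (\<lambda>x. \<lambda>n\<in>UNIV. x (Suc n))"
    by (subst distr_distr[OF shift \<xi>]) (simp add: comp_def restrict_UNIV)
  also have "\<dots> = distr (PiM ?I ?S) (PiM UNIV ?S) (\<lambda>x. \<lambda>n\<in>UNIV. x (Suc n))"
    unfolding joint by (rule distr_cong[OF refl sI]) simp
  also have "\<dots> = PiM UNIV ?S"
    by (rule distr_PiM_reindex) (auto simp: std_normal.prob_space_axioms)
  finally have 1: "distr M (PiM UNIV (\<lambda>_. borel)) (\<lambda>\<omega> j. \<xi> (Suc j) \<omega>) = gauss_seq"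
    by (simp only: gauss_seq_def)
  have "(\<lambda>\<omega> j. \<xi> (Suc j) \<omega>) \<in> M \<rightarrow>\<^sub>M PiM UNIV (\<lambda>_. borel)"
    using rv by (intro measurable_PiM_single') (auto simp: space_PiM)
  then have 2: "(\<lambda>\<omega> j. \<xi> (Suc j) \<omega>) \<in> M \<rightarrow>\<^sub>M gauss_seq"
    by (simp add: measurable_cong_sets[OF refl sets_gauss_seq])
  have "distr M gauss_seq (\<lambda>\<omega> j. \<xi> (Suc j) \<omega>) = distr M (PiM UNIV (\<lambda>_. borel)) (\<lambda>\<omega> j. \<xi> (Suc j) \<omega>)"
    by (rule distr_cong) (simp_all add: sets_gauss_seq)
  with 1 2 show ?thesis
    by unfold_locales simp_all
qed

lemma Ck_surface_imp_continuous:
  assumes \<A>: "smooth_atlas \<A>" and u: "Ck_surface k \<A> u"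
  shows "continuous_on UNIV u"
proof -
  have ch: "is_chart d" if "d \<in> \<A>" for d
    using \<A> that unfolding smooth_atlas_def by blast
  have "continuous_on (chart_dom d) u" if d: "d \<in> \<A>" for d
  proof -
    have "continuous_on (coord d ` chart_dom d) (u \<circ> chart_inv d)"
      using u d unfolding Ck_surface_def by (intro Ck_on_imp_continuous_on[of k]) blast
    with is_chartD(3)[OF ch[OF d]] have "continuous_on (chart_dom d) ((u \<circ> chart_inv d) \<circ> coord d)"
      by (rule continuous_on_compose)
    then show ?thesis
      by (rule continuous_on_eq) (simp add: is_chartD(5)[OF ch[OF d]])
  qed
  then have "continuous_on (\<Union>d\<in>\<A>. chart_dom d) u"
    using is_chartD(1)[OF ch] by (intro continuous_on_open_UN)
  moreover have "(\<Union>d\<in>\<A>. chart_dom d) = UNIV"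
    using \<A> unfolding smooth_atlas_def by simp
  ultimately show ?thesis by simp
qed

theorem theorem5p2:
  fixes \<A> :: "'s::t2_space chart set"
    and g0 :: "'s metric_coeffs"
    and \<mu> :: "'s measure"
    and R0 :: "'s \<Rightarrow> real"
    and \<phi> :: "nat \<Rightarrow> 's \<Rightarrow> real"
    and lam c :: "nat \<Rightarrow> real"
    and F :: "real \<Rightarrow> real"
    and M :: "'w measure"
    and \<xi> :: "nat \<Rightarrow> 'w \<Rightarrow> real"
    and f h w :: "'w \<Rightarrow> 's \<Rightarrow> real"
    and R1 :: "real \<Rightarrow> 'w \<Rightarrow> 's \<Rightarrow> real"
    and sigma_w :: real
  assumes surface: "compact_orientable_surface \<A>"
    and metric: "riemannian_metric \<A> g0"
    and area: "riemannian_area \<A> g0 \<mu>"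
    and R0_eq: "R0 = scalar_curvature \<A> g0"
    and R0_cont: "continuous_on UNIV R0"
    and basis: "laplace_eigenbasis \<A> g0 \<mu> \<phi> lam"
    and F_antimono: "\<exists>T. antimono_on {T..} F"
    and F_lim: "(F \<longlongrightarrow> 0) at_top"
    and c_eq: "\<And>j. j \<ge> 1 \<Longrightarrow> c j = F (lam j)"
    and c_pos: "\<And>j. j \<ge> 1 \<Longrightarrow> c j > 0"
    and prob: "prob_space M"
    and gauss_indep: "prob_space.indep_vars M (\<lambda>_. borel) \<xi> {1..}"
    and gauss_distr: "\<And>j. j \<ge> 1 \<Longrightarrow> distributed M lborel (\<xi> j) std_normal_density"
    and f_rv: "\<And>x. (\<lambda>\<omega>. f \<omega> x) \<in> borel_measurable M"
    and f_series: "\<And>x. AE \<omega> in M.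
          (\<lambda>j. \<xi> (Suc j) \<omega> * c (Suc j) * \<phi> (Suc j) x) sums (- f \<omega> x)"
    and h_rv: "\<And>x. (\<lambda>\<omega>. h \<omega> x) \<in> borel_measurable M"
    and h_laplacian: "AE \<omega> in M. is_laplacian_of \<A> g0 \<mu> (f \<omega>) (h \<omega>)"
    and w_eq: "\<And>\<omega> x. w \<omega> x = h \<omega> x + R0 x * f \<omega> x"
    and f_cont: "AE \<omega> in M. continuous_on UNIV (f \<omega>)"
    and h_cont: "AE \<omega> in M. continuous_on UNIV (h \<omega>)"
    and w_cont: "AE \<omega> in M. continuous_on UNIV (w \<omega>)"
    and R1_eq: "\<And>a \<omega>. R1 a \<omega> =
          conformal_scalar_curvature R0 (\<lambda>x. a * f \<omega> x) (\<lambda>x. a * h \<omega> x)"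
    and sigma_w_nonneg: "sigma_w \<ge> 0"
    and sigma_w_sq: "sigma_w\<^sup>2 = (SUP x. prob_space.expectation M (\<lambda>\<omega>. (w \<omega> x)\<^sup>2))"
  shows "(\<lambda>(a, u). ln (measure (completion M)
            {\<omega> \<in> space M. sup_norm (\<lambda>x. R1 a \<omega> x - R0 x) > ereal u}))
         \<sim>[small_au] (\<lambda>(a, u). - (u\<^sup>2 / (2 * a\<^sup>2 * sigma_w\<^sup>2)))"
proof -
  have comp: "compact (UNIV :: 's set)" and atlas: "smooth_atlas \<A>"
    using surface unfolding compact_orientable_surface_def by simp_all
  obtain B :: "'s set set" where B: "countable B" "topological_basis B"
    using surface_countable_basis[OF comp atlas] .
  obtain r :: "nat \<Rightarrow> 's \<Rightarrow> 's" where r: "discretization r"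
    using discretization_exists[OF comp B] by blast
  define X where "X = (\<lambda>\<omega> j. \<xi> (Suc j) \<omega>)"
  have X: "gauss_sequence M X"
    unfolding X_def by (rule gauss_sequence_of_indep[OF prob gauss_indep gauss_distr])
  have onb: "orthonormal_basis_L2 \<mu> \<phi>"
    and phi: "\<And>j. Ck_surface 2 \<A> (\<phi> j)" "\<And>j x. - laplacian \<A> g0 (\<phi> j) x = lam j * \<phi> j x"
    and lam: "0 < lam 1" "\<And>j. j \<ge> 1 \<Longrightarrow> lam j \<le> lam (Suc j)"
    using basis unfolding laplace_eigenbasis_def by auto
  have lam_pos: "lam j > 0" if "j \<ge> 1" for j
    using that by (induction j rule: dec_induct) (use lam in \<open>auto intro: less_le_trans\<close>)
  have one: "Ck_surface 2 \<A> (\<lambda>_. 1)"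
    unfolding Ck_surface_def comp_def by (intro ballI Ck_on_const)
  have lap: "AE \<omega> in M. (\<forall>j. (LINT x|\<mu>. h \<omega> x * \<phi> j x) = - lam j * (LINT x|\<mu>. f \<omega> x * \<phi> j x))
      \<and> (LINT x|\<mu>. h \<omega> x) = 0"
    using h_laplacian
  proof eventually_elim
    case (elim \<omega>)
    then have green: "(LINT x|\<mu>. h \<omega> x * \<psi> x) = (LINT x|\<mu>. f \<omega> x * laplacian \<A> g0 \<psi> x)"
      if "Ck_surface 2 \<A> \<psi>" for \<psi>
      using that unfolding is_laplacian_of_def by blast
    have "(LINT x|\<mu>. h \<omega> x * \<phi> j x) = - lam j * (LINT x|\<mu>. f \<omega> x * \<phi> j x)" for j
    proof -
      have l: "laplacian \<A> g0 (\<phi> j) x = - lam j * \<phi> j x" for x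
        using phi(2)[of j x] by simp
      have "(\<lambda>x. f \<omega> x * (- lam j * \<phi> j x)) = (\<lambda>x. - lam j * (f \<omega> x * \<phi> j x))"
        by (auto simp: mult_ac)
      then show ?thesis
        using green[OF phi(1)[of j]] by (simp add: l)
    qed
    moreover have "(LINT x|\<mu>. h \<omega> x) = 0"
      using green[OF one] by (simp add: laplacian_const)
    ultimately show ?case by blast
  qed
  have nb: "\<exists>V. (\<forall>n. open (V n)) \<and> (\<forall>n. x \<in> V n) \<and>
       (\<forall>(g :: 's \<Rightarrow> real) e. continuous_on UNIV g \<longrightarrow> e > 0
         \<longrightarrow> eventually (\<lambda>n. \<forall>y\<in>V n. \<bar>g y - g x\<bar> < e) sequentially)" for x
    by (rule shrinking_neighbourhoods[OF B, of x]) blast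
  interpret L: laplace_field M X r \<mu> \<phi> lam c f h
  proof (intro laplace_field.intro laplace_field_axioms.intro orthonormal_basis.intro)
    show "gauss_sequence M X" "discretization r" "orthonormal_basis_L2 \<mu> \<phi>"
      by (rule X, rule r, rule onb)
    show "finite_measure \<mu>"
      by (rule area_finite[OF comp atlas metric area])
    show "sets \<mu> = sets borel"
      using area by (simp add: riemannian_area_def)
    show "emeasure \<mu> U > 0" if "open U" "U \<noteq> {}" for U
      by (rule area_open_pos[OF atlas metric area that])
    show "continuous_on UNIV (\<phi> j)" for j
      by (rule Ck_surface_imp_continuous[OF atlas phi(1)])
    show "AE \<omega> in M. (\<lambda>j. X \<omega> j * c (Suc j) * \<phi> (Suc j) x) sums (- f \<omega> x)" for x
      unfolding X_def by (rule f_series)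
    show "AE \<omega> in M. \<forall>j. (LINT x|\<mu>. h \<omega> x * \<phi> j x) = - lam j * (LINT x|\<mu>. f \<omega> x * \<phi> j x)"
      "AE \<omega> in M. (LINT x|\<mu>. h \<omega> x) = 0"
      using lap by auto
  qed (rule nb f_rv h_rv f_cont h_cont)+
  have "\<exists>d. \<forall>x. L.glin (\<lambda>\<omega>. h \<omega> x) (d x)"
    by (intro choice allI L.h_glin)
  then obtain \<beta>h where \<beta>h: "\<And>x. L.glin (\<lambda>\<omega>. h \<omega> x) (\<beta>h x)" by blast
  define \<beta>f where "\<beta>f x k = - (c (Suc k) * \<phi> (Suc k) x)" for x k
  have \<beta>f: "L.glin (\<lambda>\<omega>. f \<omega> x) (\<beta>f x)" for x
    using L.f_glin[of x] unfolding \<beta>f_def .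
  define \<beta>w where "\<beta>w x k = \<beta>h x k + R0 x * \<beta>f x k" for x k
  have \<beta>w: "L.glin (\<lambda>\<omega>. w \<omega> x) (\<beta>w x)" for x
    unfolding w_eq \<beta>w_def by (intro L.glin_add L.glin_scale \<beta>h \<beta>f)
  have w_rv: "(\<lambda>\<omega>. w \<omega> x) \<in> borel_measurable M" for x
    unfolding w_eq using f_rv[of x] h_rv[of x] by measurable
  have ff: "gauss_field M X r f \<beta>f"
    by (intro gauss_field.intro X r gauss_field_axioms.intro f_rv \<beta>f f_cont)
  have hf: "gauss_field M X r h \<beta>h"
    by (intro gauss_field.intro X r gauss_field_axioms.intro h_rv \<beta>h h_cont)
  have wf: "gauss_field M X r w \<beta>w"
    by (intro gauss_field.intro X r gauss_field_axioms.intro w_rv \<beta>w w_cont)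
  let ?v = "\<lambda>x. L.expectation (\<lambda>\<omega>. (w \<omega> x)\<^sup>2)"
  obtain K where K: "\<And>x. ?v x \<le> K"
    using gauss_field.variance_bounded[OF wf] by blast
  then have bdd: "bdd_above (range ?v)" by (intro bdd_aboveI[of _ K]) auto
  have var_le: "?v x \<le> sigma_w\<^sup>2" for x
    unfolding sigma_w_sq by (rule cSUP_upper[OF UNIV_I bdd])
  have var_ge: "\<exists>x. v < ?v x" if "v < sigma_w\<^sup>2" for v
    using that unfolding sigma_w_sq less_cSUP_iff[OF UNIV_not_empty bdd] by blast
  have "sigma_w \<noteq> 0"
  proof
    assume "sigma_w = 0"
    have zero: "AE \<omega> in M. h \<omega> x + R0 x * f \<omega> x = 0" for x
    proof -
      have "?v x = 0"
        using var_le[of x] \<open>sigma_w = 0\<close> by (intro antisym) auto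
      then have "AE \<omega> in M. (w \<omega> x)\<^sup>2 = 0"
        using L.glin_square_integrable[OF \<beta>w w_rv, of x]
        by (subst (asm) integral_nonneg_eq_0_iff_AE) auto
      then show ?thesis by (simp add: w_eq)
    qed
    show False
      by (rule L.nondegenerate[OF R0_cont lam_pos c_eq c_pos zero])
  qed
  then have "sigma_w > 0" using sigma_w_nonneg by simp
  from curvature_log_asymptotics[OF ff hf wf w_eq R0_cont this var_le var_ge]
  show ?thesis
    unfolding R1_eq conformal_scalar_curvature_def .
qed

end
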